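(* Let $\Gamma\subset\mathrm{PGL}_2(K)$ be a Schottky group with $g\ge1$ generators, with domain of regular points $\Omega$ and compact clopen fundamental domain $\mathscr{F}\subset K$, and let $\mathcal{U}\in\mathrm{Cov}(\mathscr{F})$ be verticial. Let $A$ be a symmetric $\mathcal{U}$-matrix with non-negative real entries and $A_{UU}=0$ for all $U\in\mathcal{U}$, and let $\alpha\in\mathbb{R}$, $s>1$, $\epsilon>0$. Then there exists a probability measure $p_t(x,\cdot)$, for $t\ge0$, $x\in\Omega$, on the Borel $\sigma$-algebra of $\Omega$ such that for fixed $h_0\in C(\Omega)^\Gamma$ the Cauchy problem of finding $h(t,x)\in C^1([0,\infty),C(\Omega)^\Gamma)$ with $$\left(\frac{\partial}{\partial t}-\epsilon\,\mathcal{D}^\alpha_{A,\Gamma}\right)h(t,x)=0\quad(t\ge0,\ x\in\Omega),\qquad h(0,x)=h_0(x),$$ has a unique solution, and it is of the form $$h(t,x)=\int_{\Omega,s}h_0(y)\,p_t(x,dy).$$ In addition, $p_t(x,\cdot)$ is the transition function of a Markov process whose paths are right continuous and have no discontinuities other than jumps.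
   Context: $K$ is a non-archimedean local field with absolute value $|\cdot|_K$, Haar measure $\mu$ (also $dx$) with $\mu(O_K)=1$; $1_U$ is the indicator function of $U$. $\gamma\in\mathrm{PGL}_2(K)$ is hyperbolic if $|\mathrm{Tr}(A_\gamma)|_K^2>1$ for a representative $A_\gamma$ of determinant $1$. A Schottky group is a discrete subgroup of $\mathrm{PGL}_2(K)$ freely generated by $g\ge1$ hyperbolic transformations. $\Omega\subset\mathbb{P}^1(K)$ is the complement of the closure of the set of limit points of $\Gamma$, and $\mathscr{F}\subset\Omega$ is a fundamental domain for $\Gamma$, chosen to be a compact clopen subset of $K$. $\mathrm{Cov}(\mathscr{F})$ is the set of coverings of $\mathscr{F}$ by mutually disjoint holed discs (discs with finitely many pairwise disjoint subdiscs removed); a covering is verticial if each member is an intersection of spheres $\{x:|x-a|_K=r\}$ of equal radius $r$ (which may depend on the member). A $\mathcal{U}$-matrix is a matrix indexed by $\mathcal{U}$. $C(\Omega)^\Gamma$ is the space of $\Gamma$-invariant continuous (real-valued) functions on $\Omega$ with the sup norm. A $\Gamma$-periodic function has the form $f(x)=\sum_{\gamma\in\Gamma}\sum_{U\in\mathcal{U}}f_U(\gamma^{-1}x)1_{\gamma U}(x)$. With $m_{\gamma,U}=\max\{1,\max_U|\gamma'|_K\}$ its weighted integral is $\int_{\Omega,s}f(x)\,dx=\sum_{U\in\mathcal{U}}\sum_{\gamma\in\Gamma}m_{\gamma,U}^{-s}\int_{\gamma U}f_U(\gamma^{-1}x)\,dx$; the notation $\int_{\Omega,s}$ with another measure in place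 of $dx$ has the analogous meaning. The operator is $\mathcal{D}^\alpha_{A,\Gamma}f(x)=\int_{\Omega,s}A^\alpha_\Gamma(x,y)(f(y)-f(x))\,dy$ with kernel $A^\alpha_\Gamma(x,y)=\sum_{U,V\in\mathcal{U}}A_{UV}\sum_{\gamma,\delta\in\Gamma}|\gamma^{-1}x-\delta^{-1}y|_K^\alpha 1_{\gamma U}(x)1_{\delta V}(y)$.
   Formalization: The initial condition p_0(x,·)=δ_x is required only for x in translates γU with m_{γ,U}=1; elsewhere it contradicts the weighted-integral formula for h_0=1. Sums over Γ that diverge are given the value 0. *)

theory Defs
  imports "HOL-Probability.Probability" "HOL-Algebra.Coset" "HOL-Algebra.Generated_Groups"
begin

section \<open>Non-archimedean local fields\<close>

text \<open>
  The constant \<^const>\<open>norm\<close> can only be used on \<^class>\<open>real_normed_vector\<close>, so a field of this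
  kind needs an absolute value of its own.
\<close>

class nonarch_local_field = field + metric_space +
  fixes absval :: "'a \<Rightarrow> real"
  assumes dist_absval: "dist x y = absval (x - y)"
    and absval_mult: "absval (x * y) = absval x * absval y"
    and absval_ultrametric: "absval (x + y) \<le> max (absval x) (absval y)"
    and absval_nontrivial: "\<exists>x. x \<noteq> 0 \<and> absval x \<noteq> 1"
    and locally_compact_field: "\<exists>U C. x \<in> U \<and> open U \<and> U \<subseteq> C \<and> compact C"

definition haar_measure :: "'a::nonarch_local_field measure \<Rightarrow> bool" where
  "haar_measure \<mu> \<longleftrightarrow>
     sets \<mu> = sets borel \<and>
     (\<forall>a. \<forall>B \<in> sets borel. emeasure \<mu> ((+) a ` B) = emeasure \<mu> B) \<and>
     emeasure \<mu> {x. absval x \<le> 1} = 1"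

section \<open>The group PGL(2,K) and its action on the projective line\<close>

definition GL2 :: "('a::nonarch_local_field ^ 2 ^ 2) monoid" where
  "GL2 = \<lparr>carrier = {A. invertible A}, mult = (**), one = mat 1\<rparr>"

definition scalar_matrices :: "('a::nonarch_local_field ^ 2 ^ 2) set" where
  "scalar_matrices = {mat k | k. k \<noteq> 0}"

definition PGL2 :: "('a::nonarch_local_field ^ 2 ^ 2) set monoid" where
  "PGL2 = GL2 Mod scalar_matrices"

lemma mat_mult_nth: "(mat k ** A) $ i $ j = k * A $ i $ (j :: 'n::finite)"
  and mult_mat_nth: "(A ** mat k) $ i $ j = A $ i $ j * k"
  for k :: "'a::comm_semiring_1" and A :: "'a ^ 'n ^ 'n"
proof -
  have "(mat k ** A) $ i $ j = (\<Sum>l\<in>UNIV. if l = i then k * A $ l $ j else 0)"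
    unfolding matrix_matrix_mult_def mat_def vec_lambda_beta by (rule sum.cong) auto
  then show "(mat k ** A) $ i $ j = k * A $ i $ j" by simp
  have "(A ** mat k) $ i $ j = (\<Sum>l\<in>UNIV. if l = j then A $ i $ l * k else 0)"
    unfolding matrix_matrix_mult_def mat_def vec_lambda_beta by (rule sum.cong) auto
  then show "(A ** mat k) $ i $ j = A $ i $ j * k" by simp
qed

lemma mat_commutes: "mat k ** A = A ** mat k"
  for k :: "'a::comm_semiring_1" and A :: "'a ^ 'n ^ 'n"
  by (simp add: vec_eq_iff mat_mult_nth mult_mat_nth mult.commute)

lemma mat_mult_mat: "mat k ** mat l = (mat (k * l) :: 'a::comm_semiring_1 ^ 'n ^ 'n)"
  by (simp add: vec_eq_iff mat_mult_nth) (simp add: mat_def)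

lemma invertible_mat: "k \<noteq> 0 \<Longrightarrow> invertible (mat k :: 'a::field ^ 'n ^ 'n)"
  unfolding invertible_def by (rule exI[of _ "mat (inverse k)"]) (simp add: mat_mult_mat)

lemma group_GL2: "group (GL2 :: ('a::nonarch_local_field ^ 2 ^ 2) monoid)"
proof (rule groupI)
  fix A assume "A \<in> carrier (GL2 :: ('a ^ 2 ^ 2) monoid)"
  then show "\<exists>B \<in> carrier GL2. B \<otimes>\<^bsub>GL2\<^esub> A = \<one>\<^bsub>GL2\<^esub>"
    by (auto simp: GL2_def invertible_def)
qed (auto simp: GL2_def invertible_mult matrix_mul_assoc invertible_mat)

lemma inv_GL2_mat:
  assumes "k \<noteq> 0"
  shows "inv\<^bsub>GL2\<^esub> (mat k :: 'a::nonarch_local_field ^ 2 ^ 2) = mat (inverse k)"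
proof -
  interpret group "GL2 :: ('a ^ 2 ^ 2) monoid" by (rule group_GL2)
  show ?thesis
    using assms by (intro inv_equality) (auto simp: GL2_def mat_mult_mat invertible_mat)
qed

lemma scalar_matricesI: "k \<noteq> 0 \<Longrightarrow> mat k \<in> scalar_matrices"
  by (auto simp: scalar_matrices_def)

lemma scalar_matricesE:
  assumes "A \<in> scalar_matrices"
  obtains k where "A = mat k" "k \<noteq> 0"
  using assms by (auto simp: scalar_matrices_def)

lemma normal_scalar_matrices:
  "scalar_matrices \<lhd> (GL2 :: ('a::nonarch_local_field ^ 2 ^ 2) monoid)"
proof -
  interpret group "GL2 :: ('a ^ 2 ^ 2) monoid" by (rule group_GL2)
  have sub: "subgroup scalar_matrices (GL2 :: ('a ^ 2 ^ 2) monoid)"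
  proof (rule subgroupI)
    show "scalar_matrices \<subseteq> carrier (GL2 :: ('a ^ 2 ^ 2) monoid)"
      by (auto simp: GL2_def invertible_mat elim: scalar_matricesE)
    show "scalar_matrices \<noteq> ({} :: ('a ^ 2 ^ 2) set)"
      using scalar_matricesI[OF one_neq_zero] by (metis empty_iff)
  next
    fix A :: "'a ^ 2 ^ 2"
    assume "A \<in> scalar_matrices"
    then show "inv\<^bsub>GL2\<^esub> A \<in> scalar_matrices"
      by (elim scalar_matricesE) (simp add: inv_GL2_mat scalar_matricesI)
  next
    fix A B :: "'a ^ 2 ^ 2"
    assume "A \<in> scalar_matrices" "B \<in> scalar_matrices"
    then show "A \<otimes>\<^bsub>GL2\<^esub> B \<in> scalar_matrices"
      by (elim scalar_matricesE) (simp add: GL2_def mat_mult_mat scalar_matricesI)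
  qed
  have "scalar_matrices #>\<^bsub>GL2\<^esub> A = A <#\<^bsub>GL2\<^esub> scalar_matrices" for A :: "'a ^ 2 ^ 2"
  proof -
    have "B ** A = A ** B" if "B \<in> scalar_matrices" for B
      using that by (elim scalar_matricesE) (simp add: mat_commutes)
    then show ?thesis by (simp add: GL2_def r_coset_def l_coset_def)
  qed
  with sub show ?thesis by (intro normalI) auto
qed

lemma group_PGL2: "group (PGL2 :: ('a::nonarch_local_field ^ 2 ^ 2) set monoid)"
  unfolding PGL2_def by (rule normal.factorgroup_is_group[OF normal_scalar_matrices])

text \<open>The quotient topology, with the topology of $K^{2\times 2}$ on the general linear group.\<close>

definition PGL2_topology :: "('a::nonarch_local_field ^ 2 ^ 2) set topology" where
  "PGL2_topology = topology (\<lambda>W. W \<subseteq> carrier PGL2 \<and>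
     openin (top_of_set (carrier GL2)) {A \<in> carrier GL2. scalar_matrices #>\<^bsub>GL2\<^esub> A \<in> W})"

lemma openin_PGL2_topology:
  "openin PGL2_topology W \<longleftrightarrow> W \<subseteq> carrier (PGL2 :: ('a::nonarch_local_field ^ 2 ^ 2) set monoid) \<and>
     openin (top_of_set (carrier GL2)) {A \<in> carrier GL2. scalar_matrices #>\<^bsub>GL2\<^esub> A \<in> W}"
proof -
  let ?pre = "\<lambda>W :: ('a ^ 2 ^ 2) set set. {A \<in> carrier GL2. scalar_matrices #>\<^bsub>GL2\<^esub> A \<in> W}"
  let ?P = "\<lambda>W. W \<subseteq> carrier (PGL2 :: ('a ^ 2 ^ 2) set monoid) \<and>
     openin (top_of_set (carrier GL2)) (?pre W)"
  have "?P (S \<inter> T)" if "?P S" "?P T" for S T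
  proof -
    have "?pre (S \<inter> T) = ?pre S \<inter> ?pre T" by auto
    then show ?thesis using that by (auto intro: openin_Int)
  qed
  moreover have "?P (\<Union>\<W>)" if "\<forall>W\<in>\<W>. ?P W" for \<W>
  proof -
    have "?pre (\<Union>\<W>) = (\<Union>W\<in>\<W>. ?pre W)" by auto
    moreover have "openin (top_of_set (carrier GL2)) (\<Union>W\<in>\<W>. ?pre W)"
      using that by (intro openin_Union) auto
    ultimately show ?thesis using that by auto
  qed
  ultimately have "istopology ?P" unfolding istopology_def by blast
  then show ?thesis unfolding PGL2_topology_def by (simp add: topology_inverse')
qed

definition discrete_subgroup :: "('a::nonarch_local_field ^ 2 ^ 2) set set \<Rightarrow> bool" where
  "discrete_subgroup \<Gamma> \<longleftrightarrow>
     subgroup \<Gamma> PGL2 \<and> subtopology PGL2_topology \<Gamma> = discrete_topology \<Gamma>"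

text \<open>
  Everything below that is expressed by a chosen representative matrix is invariant under
  multiplication of the matrix by a nonzero scalar.
\<close>

definition pgl_rep :: "('a::nonarch_local_field ^ 2 ^ 2) set \<Rightarrow> 'a ^ 2 ^ 2" where
  "pgl_rep \<gamma> = (SOME A. A \<in> \<gamma>)"

text \<open>
  The representative of determinant 1 is $A/\sqrt{\det A}$, possibly over a quadratic extension;
  its squared trace $(\mathrm{Tr} A)^2/\det A$ lies in $K$.
\<close>

definition hyperbolic :: "('a::nonarch_local_field ^ 2 ^ 2) set \<Rightarrow> bool" where
  "hyperbolic \<gamma> \<longleftrightarrow> absval ((trace (pgl_rep \<gamma>))\<^sup>2 / det (pgl_rep \<gamma>)) > 1"

text \<open>
  The projective line is \<^typ>\<open>'a option\<close> with \<^term>\<open>None\<close> as the point at infinity.  As the field is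
  locally compact, its topology is that of the one-point compactification.
\<close>

definition P1 :: "'a::nonarch_local_field option topology" where
  "P1 = Alexandroff_compactification euclidean"

fun mobius :: "'a::nonarch_local_field ^ 2 ^ 2 \<Rightarrow> 'a option \<Rightarrow> 'a option" where
  "mobius A (Some x) =
     (if A $ 2 $ 1 * x + A $ 2 $ 2 = 0 then None
      else Some ((A $ 1 $ 1 * x + A $ 1 $ 2) / (A $ 2 $ 1 * x + A $ 2 $ 2)))"
| "mobius A None = (if A $ 2 $ 1 = 0 then None else Some (A $ 1 $ 1 / A $ 2 $ 1))"

definition pgl_act :: "('a::nonarch_local_field ^ 2 ^ 2) set \<Rightarrow> 'a option \<Rightarrow> 'a option" where
  "pgl_act \<gamma> = mobius (pgl_rep \<gamma>)"

text \<open>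
  The derivative of $x \mapsto (ax+b)/(cx+d)$ is $(ad-bc)/(cx+d)^2$; at a pole its absolute value
  is infinite.
\<close>

definition abs_deriv :: "('a::nonarch_local_field ^ 2 ^ 2) set \<Rightarrow> 'a \<Rightarrow> ennreal" where
  "abs_deriv \<gamma> x =
     (let A = pgl_rep \<gamma>; q = A $ 2 $ 1 * x + A $ 2 $ 2
      in if q = 0 then \<infinity> else ennreal (absval (det A / q\<^sup>2)))"

section \<open>Schottky groups\<close>

text \<open>The letter \<open>(i, True)\<close> of a word stands for the generator \<open>t i\<close>, \<open>(i, False)\<close> for its inverse.\<close>

definition eval_word :: "('g, 'm) monoid_scheme \<Rightarrow> (nat \<Rightarrow> 'g) \<Rightarrow> (nat \<times> bool) list \<Rightarrow> 'g" where
  "eval_word G t w =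
     foldr (\<lambda>(i, b) z. (if b then t i else inv\<^bsub>G\<^esub> t i) \<otimes>\<^bsub>G\<^esub> z) w \<one>\<^bsub>G\<^esub>"

definition reduced_word :: "(nat \<times> bool) list \<Rightarrow> bool" where
  "reduced_word w \<longleftrightarrow>
     (\<forall>k. Suc k < length w \<longrightarrow> \<not> (fst (w ! k) = fst (w ! Suc k) \<and> snd (w ! k) \<noteq> snd (w ! Suc k)))"

definition freely_generated_by ::
    "('g, 'm) monoid_scheme \<Rightarrow> 'g set \<Rightarrow> nat \<Rightarrow> (nat \<Rightarrow> 'g) \<Rightarrow> bool" where
  "freely_generated_by G H g t \<longleftrightarrow>
     t ` {..<g} \<subseteq> carrier G \<and>
     H = generate G (t ` {..<g}) \<and>
     (\<forall>w. w \<noteq> [] \<and> fst ` set w \<subseteq> {..<g} \<and> reduced_word w \<longrightarrow> eval_word G t w \<noteq> \<one>\<^bsub>G\<^esub>)"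

definition schottky_group :: "nat \<Rightarrow> ('a::nonarch_local_field ^ 2 ^ 2) set set \<Rightarrow> bool" where
  "schottky_group g \<Gamma> \<longleftrightarrow>
     g \<ge> 1 \<and> discrete_subgroup \<Gamma> \<and>
     (\<exists>t. (\<forall>i<g. hyperbolic (t i)) \<and> freely_generated_by PGL2 \<Gamma> g t)"

definition limit_points :: "('a::nonarch_local_field ^ 2 ^ 2) set set \<Rightarrow> 'a option set" where
  "limit_points \<Gamma> =
     {a. \<exists>b \<sigma>. inj \<sigma> \<and> range \<sigma> \<subseteq> \<Gamma> \<and> limitin P1 (\<lambda>n::nat. pgl_act (\<sigma> n) b) a sequentially}"

definition regular_domain :: "('a::nonarch_local_field ^ 2 ^ 2) set set \<Rightarrow> 'a option set" where
  "regular_domain \<Gamma> = topspace P1 - P1 closure_of limit_points \<Gamma>"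

definition Omega_topology :: "('a::nonarch_local_field ^ 2 ^ 2) set set \<Rightarrow> 'a option topology" where
  "Omega_topology \<Gamma> = subtopology P1 (regular_domain \<Gamma>)"

text \<open>\<open>translate \<gamma> U\<close> is the set $\gamma U \subseteq \mathbb{P}^1(K)$, for $U \subseteq K$.\<close>

definition translate :: "('a::nonarch_local_field ^ 2 ^ 2) set \<Rightarrow> 'a set \<Rightarrow> 'a option set" where
  "translate \<gamma> U = pgl_act \<gamma> ` Some ` U"

definition fundamental_domain :: "('a::nonarch_local_field ^ 2 ^ 2) set set \<Rightarrow> 'a set \<Rightarrow> bool" where
  "fundamental_domain \<Gamma> F \<longleftrightarrow>
     compact F \<and> open F \<and> closed F \<and> Some ` F \<subseteq> regular_domain \<Gamma> \<and>
     (\<forall>x \<in> regular_domain \<Gamma>. \<exists>!\<gamma>. \<gamma> \<in> \<Gamma> \<and> x \<in> translate \<gamma> F)"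

section \<open>Coverings by holed discs\<close>

definition disc :: "'a::metric_space set \<Rightarrow> bool" where
  "disc D \<longleftrightarrow> (\<exists>a r. r > 0 \<and> D = cball a r)"

definition holed_disc :: "'a::metric_space set \<Rightarrow> bool" where
  "holed_disc U \<longleftrightarrow>
     (\<exists>D \<H>. disc D \<and> finite \<H> \<and> disjoint \<H> \<and> (\<forall>H \<in> \<H>. disc H \<and> H \<subseteq> D) \<and> U = D - \<Union>\<H>)"

definition Cov :: "'a::metric_space set \<Rightarrow> 'a set set set" where
  "Cov F = {\<U>. (\<forall>U \<in> \<U>. holed_disc U) \<and> disjoint \<U> \<and> \<Union>\<U> = F}"

definition verticial :: "'a::metric_space set set \<Rightarrow> bool" where
  "verticial \<U> \<longleftrightarrow>
     (\<forall>U \<in> \<U>. \<exists>r > 0. \<exists>C. C \<noteq> {} \<and> U = (\<Inter>a \<in> C. sphere a r))"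

section \<open>Weighted integrals and the diffusion operator\<close>

definition borel_of :: "'e topology \<Rightarrow> 'e measure" where
  "borel_of T = sigma (topspace T) {W. openin T W}"

text \<open>
  The measure $dx$ on $\Omega$: the point at infinity, if it belongs to $\Omega$, is a null set.
\<close>

definition Omega_measure ::
    "('a::nonarch_local_field ^ 2 ^ 2) set set \<Rightarrow> 'a measure \<Rightarrow> 'a option measure" where
  "Omega_measure \<Gamma> \<mu> = restrict_space (distr \<mu> (borel_of P1) Some) (regular_domain \<Gamma>)"

definition max_deriv :: "('a::nonarch_local_field ^ 2 ^ 2) set \<Rightarrow> 'a set \<Rightarrow> ennreal" where
  "max_deriv \<gamma> U = max 1 (SUP x\<in>U. abs_deriv \<gamma> x)"

text \<open>
  $m_{\gamma,U}^{-s}$; it is 0 if $m_{\gamma,U} = \infty$, that is if $\infty \in \gamma U$, since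
  \<^term>\<open>enn2real \<infinity> = 0\<close> and \<^term>\<open>0 powr a = (0::real)\<close>.
\<close>

definition weight :: "real \<Rightarrow> ('a::nonarch_local_field ^ 2 ^ 2) set \<Rightarrow> 'a set \<Rightarrow> real" where
  "weight s \<gamma> U = enn2real (max_deriv \<gamma> U) powr (- s)"

text \<open>
  A periodic function $f$ agrees on $\gamma U$ with $f_U(\gamma^{-1}\,\cdot\,)$, so the pieces $f_U$
  need not be mentioned.  A sum over $\Gamma$ that does not converge absolutely has the value 0.
\<close>

definition weighted_integral ::
    "('a::nonarch_local_field ^ 2 ^ 2) set set \<Rightarrow> 'a set set \<Rightarrow> real \<Rightarrow>
     'a option measure \<Rightarrow> ('a option \<Rightarrow> real) \<Rightarrow> real" where
  "weighted_integral \<Gamma> \<U> s \<nu> f =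
     (\<Sum>U\<in>\<U>. \<Sum>\<^sub>\<infinity>\<gamma>\<in>\<Gamma>. weight s \<gamma> U * (LINT y:translate \<gamma> U|\<nu>. f y))"

text \<open>
  For $x \in \gamma U$ the point $\gamma^{-1}x$ lies in $U \subseteq K$, so \<^const>\<open>the\<close> is harmless;
  at most one term of the inner sum is nonzero.
\<close>

definition diffusion_kernel ::
    "('a::nonarch_local_field ^ 2 ^ 2) set set \<Rightarrow> 'a set set \<Rightarrow> ('a set \<Rightarrow> 'a set \<Rightarrow> real) \<Rightarrow> real \<Rightarrow>
     'a option \<Rightarrow> 'a option \<Rightarrow> real" where
  "diffusion_kernel \<Gamma> \<U> A \<alpha> x y =
     (\<Sum>U\<in>\<U>. \<Sum>V\<in>\<U>. A U V * (\<Sum>\<^sub>\<infinity>(\<gamma>, \<delta>)\<in>\<Gamma> \<times> \<Gamma>.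
        absval (the (pgl_act (inv\<^bsub>PGL2\<^esub> \<gamma>) x) - the (pgl_act (inv\<^bsub>PGL2\<^esub> \<delta>) y)) powr \<alpha>
        * indicator (translate \<gamma> U) x * indicator (translate \<delta> V) y))"

definition diffusion_operator ::
    "'a::nonarch_local_field measure \<Rightarrow> ('a ^ 2 ^ 2) set set \<Rightarrow> 'a set set \<Rightarrow>
     ('a set \<Rightarrow> 'a set \<Rightarrow> real) \<Rightarrow> real \<Rightarrow> real \<Rightarrow> ('a option \<Rightarrow> real) \<Rightarrow> 'a option \<Rightarrow> real" where
  "diffusion_operator \<mu> \<Gamma> \<U> A \<alpha> s f x =
     weighted_integral \<Gamma> \<U> s (Omega_measure \<Gamma> \<mu>)
       (\<lambda>y. diffusion_kernel \<Gamma> \<U> A \<alpha> x y * (f y - f x))"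

section \<open>The Cauchy problem\<close>

text \<open>
  The values of the functions outside of $\Omega$ are irrelevant.  Convergence in sup norm on
  $\Omega$ is \<^const>\<open>uniform_limit\<close>.
\<close>

definition invariant_continuous ::
    "('a::nonarch_local_field ^ 2 ^ 2) set set \<Rightarrow> ('a option \<Rightarrow> real) set" where
  "invariant_continuous \<Gamma> =
     {f. continuous_map (Omega_topology \<Gamma>) euclideanreal f \<and>
         (\<forall>\<gamma> \<in> \<Gamma>. \<forall>x \<in> regular_domain \<Gamma>. f (pgl_act \<gamma> x) = f x)}"

definition C1_with_derivative ::
    "('a::nonarch_local_field ^ 2 ^ 2) set set \<Rightarrow>
     (real \<Rightarrow> 'a option \<Rightarrow> real) \<Rightarrow> (real \<Rightarrow> 'a option \<Rightarrow> real) \<Rightarrow> bool" where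
  "C1_with_derivative \<Gamma> h h' \<longleftrightarrow>
     (\<forall>t\<ge>0. h t \<in> invariant_continuous \<Gamma> \<and> h' t \<in> invariant_continuous \<Gamma> \<and>
        uniform_limit (regular_domain \<Gamma>) (\<lambda>r x. (h r x - h t x) / (r - t)) (h' t)
          (at t within {0..}) \<and>
        uniform_limit (regular_domain \<Gamma>) h' (h' t) (at t within {0..}))"

definition cauchy_solution ::
    "'a::nonarch_local_field measure \<Rightarrow> ('a ^ 2 ^ 2) set set \<Rightarrow> 'a set set \<Rightarrow>
     ('a set \<Rightarrow> 'a set \<Rightarrow> real) \<Rightarrow> real \<Rightarrow> real \<Rightarrow> real \<Rightarrow>
     ('a option \<Rightarrow> real) \<Rightarrow> (real \<Rightarrow> 'a option \<Rightarrow> real) \<Rightarrow> bool" where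
  "cauchy_solution \<mu> \<Gamma> \<U> A \<alpha> s \<epsilon> h0 h \<longleftrightarrow>
     (\<exists>h'. C1_with_derivative \<Gamma> h h' \<and>
       (\<forall>t\<ge>0. \<forall>x \<in> regular_domain \<Gamma>.
          h' t x - \<epsilon> * diffusion_operator \<mu> \<Gamma> \<U> A \<alpha> s (h t) x = 0)) \<and>
     (\<forall>x \<in> regular_domain \<Gamma>. h 0 x = h0 x)"

section \<open>Markov processes\<close>

text \<open>
  The initial condition that \<open>p 0 x\<close> is the point mass at \<open>x\<close> is not part of the next definition:
  it is required only for \<open>x\<close> in a set \<open>E\<close>.  In a representation of the solution by weighted
  integrals of probability measures, all weights being at most 1, \<open>h0 = 1\<close> (with solution 1) forces all of the \<open>p t x\<close> to be
  concentrated on the translates of weight 1, so the point mass is excluded at all other points.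
\<close>

definition transition_function ::
    "'e topology \<Rightarrow> 'e set \<Rightarrow> (real \<Rightarrow> 'e \<Rightarrow> 'e measure) \<Rightarrow> bool" where
  "transition_function T E p \<longleftrightarrow>
     (\<forall>t\<ge>0. p t \<in> borel_of T \<rightarrow>\<^sub>M prob_algebra (borel_of T)) \<and>
     (\<forall>x \<in> E. p 0 x = return (borel_of T) x) \<and>
     (\<forall>r\<ge>0. \<forall>t\<ge>0. \<forall>x \<in> topspace T. \<forall>B \<in> sets (borel_of T).
        emeasure (p (r + t) x) B = (\<integral>\<^sup>+ y. emeasure (p t y) B \<partial>p r x))"

definition weight_one_points ::
    "('a::nonarch_local_field ^ 2 ^ 2) set set \<Rightarrow> 'a set set \<Rightarrow> 'a option set" where
  "weight_one_points \<Gamma> \<U> = (\<Union>\<gamma>\<in>\<Gamma>. \<Union>U\<in>{U \<in> \<U>. max_deriv \<gamma> U = 1}. translate \<gamma> U)"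

definition natural_filtration ::
    "'w measure \<Rightarrow> 'e measure \<Rightarrow> (real \<Rightarrow> 'w \<Rightarrow> 'e) \<Rightarrow> real \<Rightarrow> 'w measure" where
  "natural_filtration W N X r =
     sigma (space W) {X u -` B \<inter> space W | u B. 0 \<le> u \<and> u \<le> r \<and> B \<in> sets N}"

text \<open>
  The laws \<open>P x\<close> live on the \<open>\<sigma>\<close>-algebra of \<open>W\<close>, whose own measure plays no role.
  Under \<open>P x\<close> the process started from \<open>x\<close> has initial distribution \<open>p 0 x\<close>.
\<close>

definition markov_process ::
    "'e topology \<Rightarrow> (real \<Rightarrow> 'e \<Rightarrow> 'e measure) \<Rightarrow>
     'w measure \<Rightarrow> (real \<Rightarrow> 'w \<Rightarrow> 'e) \<Rightarrow> ('e \<Rightarrow> 'w measure) \<Rightarrow> bool" where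
  "markov_process T p W X P \<longleftrightarrow>
     (\<forall>t\<ge>0. X t \<in> W \<rightarrow>\<^sub>M borel_of T) \<and>
     (\<forall>x \<in> topspace T.
        prob_space (P x) \<and> sets (P x) = sets W \<and>
        (\<forall>t\<ge>0. distr (P x) (borel_of T) (X t) = p t x) \<and>
        (\<forall>r\<ge>0. \<forall>t\<ge>0. \<forall>B \<in> sets (borel_of T).
           AE \<omega> in P x.
             real_cond_exp (P x) (natural_filtration W (borel_of T) X r)
               (\<lambda>\<omega>'. indicator B (X (r + t) \<omega>')) \<omega>
             = measure (p t (X r \<omega>)) B))"

definition right_continuous_with_jumps ::
    "'e topology \<Rightarrow> 'w measure \<Rightarrow> (real \<Rightarrow> 'w \<Rightarrow> 'e) \<Rightarrow> bool" where
  "right_continuous_with_jumps T W X \<longleftrightarrow>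
     (\<forall>\<omega> \<in> space W.
        (\<forall>t\<ge>0. limitin T (\<lambda>r. X r \<omega>) (X t \<omega>) (at_right t)) \<and>
        (\<forall>t>0. \<exists>l. limitin T (\<lambda>r. X r \<omega>) l (at_left t)))"

end

theory Submission
  imports Defs
begin

text \<open>
  The operator is a bounded jump operator, and the process is built by rejection sampling.

  Suppose that \<open>U\<close> is an intersection of spheres of one radius.  Then every point outside of \<open>U\<close> has
  the same distance to all points of \<open>U\<close> (\<open>verticial_dist_eq\<close>).  This has two consequences.  Firstly,
  the kernel is constant on each \<open>\<gamma>U \<times> \<delta>V\<close> (\<open>diffusion_kernel_eq\<close>); there is no singularity at the
  diagonal, because \<open>A\<close> vanishes there.  Secondly, a Moebius transformation \<open>\<delta>\<close> whose pole is not in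
  \<open>V\<close> is a similarity on \<open>V\<close>, so that it multiplies Haar measure on \<open>V\<close> by a constant
  (\<open>similarity_pushforward\<close>); if the pole lies in \<open>V\<close>, the weight of \<open>\<delta>V\<close> is 0.  Hence on an invariant
  function \<open>f\<close> and for \<open>x\<close> in the orbit of \<open>U\<close> the operator is
  \<open>\<Sum>V. q U V * \<integral>\<^sub>V (f z - f x) dz\<close> with constants \<open>q U V \<ge> 0\<close> (\<open>diffusion_operator_eq\<close>).  In the sum over
  \<open>\<Gamma>\<close> each \<open>\<delta>\<close> contributes a nonnegative number times one and the same integral, so the identity holds
  whether that sum converges or has the value 0 by convention.

  An operator of this form is \<open>\<Lambda> (M - 1)\<close> with a Markov kernel \<open>M\<close>: at the times of a Poisson process of
  a large rate \<open>\<Lambda>\<close>, propose a point \<open>z\<close> of the fundamental domain, distributed like normalised Haar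
  measure, and jump to it with a probability proportional to the rate between the cells of \<open>x\<close> and
  \<open>z\<close>.  All randomness is an independent sequence of waiting times and proposals.  As waiting times
  are memoryless, the noise after a fixed time \<open>r\<close> is independent of the position at time \<open>r\<close> and
  has the original law (\<open>nn_integral_position_restart\<close>).  This one fact yields the
  Chapman-Kolmogorov equation, the semigroup property of the expectations \<open>E f (X\<^sub>t)\<close>, and the Markov
  property.  Paths are step functions with finitely many jumps in bounded time.

  Expanding \<open>E f (X\<^sub>t)\<close> for small \<open>t\<close> up to an error of order \<open>t\<^sup>2\<close> (\<open>expect_expansion\<close>) identifies the
  generator, uniformly in the starting point, so the expectations solve the Cauchy problem.  They
  remain continuous, since two processes that start in the same cell and use the same noise coincide
  from the first jump on (\<open>chain_coupling\<close>).  Uniqueness is the usual iteration for linear equations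
  with a bounded right-hand side (\<open>linear_evolution_zero\<close>).

  In the weighted integral of the constant function 1, all weights are at most 1; so the laws must be
  concentrated on the translates of weight 1.  The process therefore starts at \<open>x\<close> if \<open>x\<close> lies in such
  a translate, and at the representative of \<open>x\<close> in the fundamental domain otherwise.  Proposals lie
  in the fundamental domain, which has weight 1, so the process never leaves the set.
\<close>

section \<open>Waiting times and jump chains\<close>

text \<open>
  The first components of the marks are waiting times: \<open>jumps n t \<omega>\<close> says that exactly \<open>n\<close> of them
  have elapsed at time \<open>t\<close>.  The recursion removes the first mark, as all later arguments condition
  on it.  Streams with a negative waiting time, a null set, are excluded in the same way as explosions:
  they have no count at all at large times.
\<close>

primrec jumps :: "nat \<Rightarrow> real \<Rightarrow> (real \<times> 'u) stream \<Rightarrow> bool" where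
  "jumps 0 t \<omega> \<longleftrightarrow> t < fst (shd \<omega>)"
| "jumps (Suc n) t \<omega> \<longleftrightarrow> 0 \<le> fst (shd \<omega>) \<and> fst (shd \<omega>) \<le> t \<and> jumps n (t - fst (shd \<omega>)) (stl \<omega>)"

text \<open>
  The stream as seen from time \<open>t\<close> on, when \<open>n\<close> waiting times have elapsed: the current waiting time
  is shortened, but keeps its mark.
\<close>

primrec restart :: "nat \<Rightarrow> real \<Rightarrow> (real \<times> 'u) stream \<Rightarrow> (real \<times> 'u) stream" where
  "restart 0 t \<omega> = (fst (shd \<omega>) - t, snd (shd \<omega>)) ## stl \<omega>"
| "restart (Suc n) t \<omega> = restart n (t - fst (shd \<omega>)) (stl \<omega>)"

definition jump_count :: "real \<Rightarrow> (real \<times> 'u) stream \<Rightarrow> nat" where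
  "jump_count t \<omega> = (LEAST n. jumps n t \<omega>)"

text \<open>
  Integer times suffice by the next lemmas; they make this a measurable event.
\<close>

definition nonexplosive :: "(real \<times> 'u) stream \<Rightarrow> bool" where
  "nonexplosive \<omega> \<longleftrightarrow> (\<forall>k::nat. \<exists>n. jumps n (real k) \<omega>)"

lemma jumps_unique: "jumps n t \<omega> \<Longrightarrow> jumps m t \<omega> \<Longrightarrow> n = m"
proof (induction n arbitrary: m t \<omega>)
  case 0
  then show ?case by (cases m) auto
next
  case (Suc n)
  then show ?case by (cases m) auto
qed

lemma jump_count_eq: "jumps n t \<omega> \<Longrightarrow> jump_count t \<omega> = n"
  unfolding jump_count_def by (metis LeastI jumps_unique)

lemma jumps_earlier: "jumps n t \<omega> \<Longrightarrow> s \<le> t \<Longrightarrow> \<exists>m\<le>n. jumps m s \<omega>"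
proof (induction n arbitrary: s t \<omega>)
  case 0
  then show ?case by auto
next
  case (Suc n)
  show ?case
  proof (cases "s < fst (shd \<omega>)")
    case True
    then show ?thesis by (intro exI[of _ 0]) auto
  next
    case False
    from Suc.prems have "jumps n (t - fst (shd \<omega>)) (stl \<omega>)" "s - fst (shd \<omega>) \<le> t - fst (shd \<omega>)"
      by auto
    from Suc.IH[OF this] obtain m where "m \<le> n" "jumps m (s - fst (shd \<omega>)) (stl \<omega>)" by auto
    with False Suc.prems show ?thesis by (intro exI[of _ "Suc m"]) auto
  qed
qed

lemma nonexplosiveD: "nonexplosive \<omega> \<Longrightarrow> \<exists>n. jumps n t \<omega>"
  unfolding nonexplosive_def by (meson jumps_earlier real_arch_simple)

lemma nonexplosive_jumps: "nonexplosive \<omega> \<Longrightarrow> jumps (jump_count t \<omega>) t \<omega>"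
  using nonexplosiveD jump_count_eq by metis

lemma nonexplosive_nonneg:
  assumes "nonexplosive \<omega>" shows "0 \<le> fst (shd \<omega>)"
proof -
  obtain n where n: "jumps n 0 \<omega>" using nonexplosiveD[OF assms] by blast
  then show ?thesis by (cases n) auto
qed

lemma nonexplosive_stl:
  assumes "nonexplosive \<omega>" shows "nonexplosive (stl \<omega>)"
  unfolding nonexplosive_def
proof
  fix k :: nat
  obtain n where n: "jumps n (real k + fst (shd \<omega>)) \<omega>" using nonexplosiveD[OF assms] by blast
  then show "\<exists>n. jumps n (real k) (stl \<omega>)" by (cases n) auto
qed

lemma jump_count_Suc:
  assumes "nonexplosive \<omega>" "fst (shd \<omega>) \<le> t"
  shows "jump_count t \<omega> = Suc (jump_count (t - fst (shd \<omega>)) (stl \<omega>))"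
  using assms nonexplosive_jumps[OF nonexplosive_stl[OF assms(1)], of "t - fst (shd \<omega>)"]
  by (intro jump_count_eq) (auto simp: nonexplosive_nonneg)

lemma jump_count_0: "t < fst (shd \<omega>) \<Longrightarrow> jump_count t \<omega> = 0"
  by (intro jump_count_eq) auto

lemma measurable_jumps [measurable (raw)]:
  assumes "f \<in> borel_measurable M" "g \<in> M \<rightarrow>\<^sub>M stream_space (borel \<Otimes>\<^sub>M R)"
  shows "Measurable.pred M (\<lambda>z. jumps n (f z) (g z))"
  using assms
proof (induction n arbitrary: f g)
  case 0
  note [measurable] = 0
  show ?case unfolding jumps.simps by measurable
next
  case (Suc n)
  note [measurable] = Suc.prems
  have [measurable]: "Measurable.pred M (\<lambda>z. jumps n (f z - fst (shd (g z))) (stl (g z)))"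
    by (rule Suc.IH) measurable
  show ?case unfolding jumps.simps by measurable
qed

lemma measurable_restart [measurable (raw)]:
  assumes "f \<in> borel_measurable M" "g \<in> M \<rightarrow>\<^sub>M stream_space (borel \<Otimes>\<^sub>M R)"
  shows "(\<lambda>z. restart n (f z) (g z)) \<in> M \<rightarrow>\<^sub>M stream_space (borel \<Otimes>\<^sub>M R)"
  using assms
proof (induction n arbitrary: f g)
  case 0
  note [measurable] = 0
  show ?case unfolding restart.simps by measurable
next
  case (Suc n)
  note [measurable] = Suc.prems
  show ?case unfolding restart.simps by (rule Suc.IH) measurable
qed

text \<open>
  This lemma and the next one are the path regularity: the count is constant immediately to the right
  of each time and immediately to the left of it.
\<close>

lemma jumps_right_constant: "jumps n t \<omega> \<Longrightarrow> \<exists>d>0. \<forall>s. t \<le> s \<and> s < t + d \<longrightarrow> jumps n s \<omega>"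
proof (induction n arbitrary: t \<omega>)
  case 0
  then show ?case by (intro exI[of _ "fst (shd \<omega>) - t"]) auto
next
  case (Suc n)
  then have "jumps n (t - fst (shd \<omega>)) (stl \<omega>)" by simp
  from Suc.IH[OF this] obtain d where d: "d > 0"
      "\<And>s. t - fst (shd \<omega>) \<le> s \<Longrightarrow> s < t - fst (shd \<omega>) + d \<Longrightarrow> jumps n s (stl \<omega>)"
    by blast
  have "jumps (Suc n) s \<omega>" if "t \<le> s" "s < t + d" for s
    using Suc.prems d(2)[of "s - fst (shd \<omega>)"] that by simp
  with d(1) show ?case by blast
qed

lemma jumps_left_constant:
  "jumps n t \<omega> \<Longrightarrow> 0 < t \<Longrightarrow> \<exists>m. \<exists>d>0. \<forall>s. t - d < s \<and> s < t \<longrightarrow> jumps m s \<omega>"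
proof (induction n arbitrary: t \<omega>)
  case 0
  then show ?case by (intro exI[of _ 0] exI[of _ t]) auto
next
  case (Suc n)
  show ?case
  proof (cases "fst (shd \<omega>) < t")
    case True
    have "jumps n (t - fst (shd \<omega>)) (stl \<omega>)" "0 < t - fst (shd \<omega>)" using Suc.prems True by simp_all
    from Suc.IH[OF this] obtain m d where d: "d > 0"
        "\<And>s. t - fst (shd \<omega>) - d < s \<Longrightarrow> s < t - fst (shd \<omega>) \<Longrightarrow> jumps m s (stl \<omega>)"
      by blast
    define d' where "d' = min d (t - fst (shd \<omega>))"
    have "jumps (Suc m) s \<omega>" if "t - d' < s" "s < t" for s
      using Suc.prems d(2)[of "s - fst (shd \<omega>)"] that by (simp add: d'_def)
    moreover have "d' > 0" using d(1) True by (simp add: d'_def)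
    ultimately show ?thesis by blast
  next
    case False
    with Suc.prems have "jumps 0 s \<omega>" if "0 < s" "s < t" for s using that by simp
    with Suc.prems(2) show ?thesis by (intro exI[of _ 0] exI[of _ t]) simp
  qed
qed

primrec chain :: "('e \<Rightarrow> 'u \<Rightarrow> 'e) \<Rightarrow> nat \<Rightarrow> 'e \<Rightarrow> (real \<times> 'u) stream \<Rightarrow> 'e" where
  "chain step 0 x \<omega> = x"
| "chain step (Suc n) x \<omega> = chain step n (step x (snd (shd \<omega>))) (stl \<omega>)"

text \<open>
  Two chains driven by the same marks stay where they are until they jump to a common point.
\<close>

lemma chain_coupling:
  assumes "\<And>u. step x u = step y u \<or> (step x u = x \<and> step y u = y)"
  shows "chain step n x \<omega> = chain step n y \<omega> \<or> (chain step n x \<omega> = x \<and> chain step n y \<omega> = y)"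
proof (induction n arbitrary: \<omega>)
  case (Suc n)
  show ?case
  proof (cases "step x (snd (shd \<omega>)) = step y (snd (shd \<omega>))")
    case False
    then have "step x (snd (shd \<omega>)) = x" "step y (snd (shd \<omega>)) = y" using assms by blast+
    then show ?thesis using Suc.IH[of "stl \<omega>"] by simp
  qed simp
qed simp

section \<open>Random maps at the times of a Poisson process\<close>

text \<open>
  A Markov jump process as an iteration of independent random maps \<open>\<lambda>x. step x u\<close>, applied at the
  times of a Poisson process.  A map may leave a point fixed, which allows jump rates that depend on
  the point although the clock has the constant rate \<open>\<Lambda>\<close>.
\<close>

locale poisson_maps = R: prob_space R for R :: "'u measure" +
  fixes N :: "'e measure" and step :: "'e \<Rightarrow> 'u \<Rightarrow> 'e" and \<Lambda> :: real
  assumes measurable_step: "(\<lambda>(x, u). step x u) \<in> N \<Otimes>\<^sub>M R \<rightarrow>\<^sub>M N"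
    and rate_pos: "\<Lambda> > 0"
begin

definition clock :: "real measure" where "clock = density lborel (exponential_density \<Lambda>)"

definition mark :: "(real \<times> 'u) measure" where "mark = clock \<Otimes>\<^sub>M R"

definition noise :: "(real \<times> 'u) stream measure" where "noise = stream_space mark"

definition position :: "real \<Rightarrow> 'e \<Rightarrow> (real \<times> 'u) stream \<Rightarrow> 'e" where
  "position t x \<omega> = chain step (jump_count t \<omega>) x \<omega>"

lemma sets_clock [simp, measurable_cong]: "sets clock = sets borel"
  by (simp add: clock_def)

sublocale clock: prob_space clock
  unfolding clock_def by (rule prob_space_exponential_density[OF rate_pos])

sublocale mark: prob_space mark
proof -
  interpret pair_prob_space clock R ..
  show "prob_space mark" unfolding mark_def by unfold_locales
qed

sublocale noise: prob_space noise
  unfolding noise_def by (rule mark.prob_space_stream_space)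

lemma sets_noise [measurable_cong]: "sets noise = sets (stream_space (borel \<Otimes>\<^sub>M R))"
  unfolding noise_def mark_def by (intro sets_stream_space_cong sets_pair_measure_cong) auto

lemma noise_measurable_iff: "g \<in> M \<rightarrow>\<^sub>M noise \<longleftrightarrow> g \<in> M \<rightarrow>\<^sub>M stream_space (borel \<Otimes>\<^sub>M R)"
  by (simp add: measurable_cong_sets[OF refl sets_noise])

lemma nn_integral_noise:
  assumes [measurable]: "f \<in> borel_measurable noise"
  shows "(\<integral>\<^sup>+\<omega>. f \<omega> \<partial>noise) = (\<integral>\<^sup>+\<tau>. (\<integral>\<^sup>+u. (\<integral>\<^sup>+\<omega>. f ((\<tau>, u) ## \<omega>) \<partial>noise) \<partial>R) \<partial>clock)"
proof -
  have [measurable]: "f \<in> borel_measurable (stream_space mark)" using assms by (simp add: noise_def)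
  interpret s: prob_space "stream_space mark" by (rule mark.prob_space_stream_space)
  have m[measurable]: "(\<lambda>q. \<integral>\<^sup>+\<omega>. f (q ## \<omega>) \<partial>stream_space mark) \<in> borel_measurable mark" by measurable
  have "(\<integral>\<^sup>+\<omega>. f \<omega> \<partial>noise) = (\<integral>\<^sup>+q. (\<integral>\<^sup>+\<omega>. f (q ## \<omega>) \<partial>noise) \<partial>(clock \<Otimes>\<^sub>M R))"
    unfolding noise_def mark_def[symmetric] by (rule mark.nn_integral_stream_space) measurable
  also have "\<dots> = (\<integral>\<^sup>+\<tau>. (\<integral>\<^sup>+u. (\<integral>\<^sup>+\<omega>. f ((\<tau>, u) ## \<omega>) \<partial>noise) \<partial>R) \<partial>clock)"
    using m by (subst R.nn_integral_fst[symmetric]) (auto simp: noise_def mark_def)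
  finally show ?thesis .
qed

lemma nn_integral_clock_memoryless:
  assumes [measurable]: "H \<in> borel_measurable borel" and r: "0 \<le> r"
  shows "(\<integral>\<^sup>+\<tau>. (if r < \<tau> then H (\<tau> - r) else 0) \<partial>clock) = ennreal (exp (- \<Lambda> * r)) * (\<integral>\<^sup>+\<tau>. H \<tau> \<partial>clock)"
proof -
  have "(\<integral>\<^sup>+\<tau>. (if r < \<tau> then H (\<tau> - r) else 0) \<partial>clock)
     = (\<integral>\<^sup>+\<tau>. ennreal (exponential_density \<Lambda> \<tau>) * (if r < \<tau> then H (\<tau> - r) else 0) \<partial>lborel)"
    unfolding clock_def by (rule nn_integral_density) measurable
  also have "\<dots> = (\<integral>\<^sup>+\<tau>. ennreal (exponential_density \<Lambda> (r + 1 * \<tau>)) * (if r < r + 1 * \<tau> then H (r + 1 * \<tau> - r) else 0) \<partial>lborel)"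
    by (subst nn_integral_real_affine[where c=1 and t=r]) auto
  also have "\<dots> = (\<integral>\<^sup>+\<tau>. ennreal (exp (- \<Lambda> * r)) * (ennreal (exponential_density \<Lambda> \<tau>) * H \<tau>) \<partial>lborel)"
  proof (rule nn_integral_cong_AE)
    have "AE \<tau> in lborel. \<tau> \<noteq> (0::real)" by (rule AE_lborel_singleton)
    then show "AE \<tau> in lborel. ennreal (exponential_density \<Lambda> (r + 1 * \<tau>)) * (if r < r + 1 * \<tau> then H (r + 1 * \<tau> - r) else 0)
       = ennreal (exp (- \<Lambda> * r)) * (ennreal (exponential_density \<Lambda> \<tau>) * H \<tau>)"
    proof eventually_elim
      case (elim \<tau>)
      show ?case
      proof (cases "\<tau> > 0")
        case True
        then have "exponential_density \<Lambda> (r + \<tau>) = exp (- \<Lambda> * r) * exponential_density \<Lambda> \<tau>"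
          using r by (simp add: exponential_density_def algebra_simps flip: exp_add)
        with True show ?thesis
          using rate_pos by (simp add: ennreal_mult' mult.assoc)
      next
        case False
        with elim show ?thesis by (simp add: exponential_density_def)
      qed
    qed
  qed
  also have "\<dots> = ennreal (exp (- \<Lambda> * r)) * (\<integral>\<^sup>+\<tau>. ennreal (exponential_density \<Lambda> \<tau>) * H \<tau> \<partial>lborel)"
    by (rule nn_integral_cmult) measurable
  also have "(\<integral>\<^sup>+\<tau>. ennreal (exponential_density \<Lambda> \<tau>) * H \<tau> \<partial>lborel) = (\<integral>\<^sup>+\<tau>. H \<tau> \<partial>clock)"
    unfolding clock_def by (rule nn_integral_density[symmetric]) measurable
  finally show ?thesis .
qed

lemma measurable_chain [measurable (raw)]:
  assumes "h \<in> M \<rightarrow>\<^sub>M N" "g \<in> M \<rightarrow>\<^sub>M noise"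
  shows "(\<lambda>z. chain step n (h z) (g z)) \<in> M \<rightarrow>\<^sub>M N"
  using assms
proof (induction n arbitrary: h g)
  case (Suc n)
  note [measurable] = Suc.prems
  have [measurable]: "g \<in> M \<rightarrow>\<^sub>M stream_space (clock \<Otimes>\<^sub>M R)" using Suc.prems(2) by (simp add: noise_def mark_def)
  have "(\<lambda>z. (h z, snd (shd (g z)))) \<in> M \<rightarrow>\<^sub>M N \<Otimes>\<^sub>M R" by measurable
  from measurable_compose[OF this measurable_step]
  have 1: "(\<lambda>z. step (h z) (snd (shd (g z)))) \<in> M \<rightarrow>\<^sub>M N" by simp
  have 2: "(\<lambda>z. stl (g z)) \<in> M \<rightarrow>\<^sub>M noise" unfolding noise_def mark_def by measurable
  show ?case using Suc.IH[OF 1 2] by simp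
qed simp

lemma pred_jumps [measurable (raw)]:
  "f \<in> borel_measurable M \<Longrightarrow> g \<in> M \<rightarrow>\<^sub>M noise \<Longrightarrow> Measurable.pred M (\<lambda>z. jumps n (f z) (g z))"
  by (rule measurable_jumps[where R=R]) (auto simp: noise_measurable_iff)

lemma measurable_restart' [measurable (raw)]:
  "f \<in> borel_measurable M \<Longrightarrow> g \<in> M \<rightarrow>\<^sub>M noise \<Longrightarrow> (\<lambda>z. restart n (f z) (g z)) \<in> M \<rightarrow>\<^sub>M noise"
  using measurable_restart[where R=R] by (auto simp: noise_measurable_iff)

lemma measurable_jump_count [measurable (raw)]:
  assumes [measurable]: "f \<in> borel_measurable M" "g \<in> M \<rightarrow>\<^sub>M noise"
  shows "(\<lambda>z. jump_count (f z) (g z)) \<in> M \<rightarrow>\<^sub>M count_space UNIV"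
  unfolding jump_count_def by measurable

lemma measurable_position [measurable (raw)]:
  assumes [measurable]: "f \<in> borel_measurable M" "h \<in> M \<rightarrow>\<^sub>M N" "g \<in> M \<rightarrow>\<^sub>M noise"
  shows "(\<lambda>z. position (f z) (h z) (g z)) \<in> M \<rightarrow>\<^sub>M N"
  unfolding position_def
  by (rule measurable_compose_countable'[where I=UNIV]) (auto simp: measurable_chain)

lemma pred_nonexplosive [measurable]: "Measurable.pred noise nonexplosive"
  unfolding nonexplosive_def by measurable

lemma measurable_Cons_noise [measurable (raw)]:
  assumes [measurable]: "f \<in> borel_measurable M" "v \<in> M \<rightarrow>\<^sub>M R" "g \<in> M \<rightarrow>\<^sub>M noise"
  shows "(\<lambda>z. (f z, v z) ## g z) \<in> M \<rightarrow>\<^sub>M noise"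
proof -
  have [measurable]: "f \<in> M \<rightarrow>\<^sub>M clock"
    by (subst measurable_cong_sets[OF refl sets_clock]) measurable
  have [measurable]: "g \<in> M \<rightarrow>\<^sub>M stream_space (clock \<Otimes>\<^sub>M R)" using assms(3) by (simp add: noise_def mark_def)
  show ?thesis unfolding noise_def mark_def by measurable
qed

lemma measurable_step' [measurable (raw)]:
  assumes [measurable]: "h \<in> M \<rightarrow>\<^sub>M N" "v \<in> M \<rightarrow>\<^sub>M R"
  shows "(\<lambda>z. step (h z) (v z)) \<in> M \<rightarrow>\<^sub>M N"
proof -
  have "(\<lambda>z. (h z, v z)) \<in> M \<rightarrow>\<^sub>M N \<Otimes>\<^sub>M R" by measurable
  from measurable_compose[OF this measurable_step] show ?thesis by simp
qed

text \<open>
  The core of the construction.  If no waiting time has elapsed, the residual waiting time is again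
  exponentially distributed; otherwise the claim follows by conditioning on the first mark and
  induction.
\<close>

lemma nn_integral_restart_at_jump:
  assumes g[measurable]: "g \<in> borel_measurable (N \<Otimes>\<^sub>M noise)"
  shows "x \<in> space N \<Longrightarrow> 0 \<le> r \<Longrightarrow>
    (\<integral>\<^sup>+\<omega>. (if jumps n r \<omega> then g (chain step n x \<omega>, restart n r \<omega>) else 0) \<partial>noise) =
    (\<integral>\<^sup>+\<omega>. (if jumps n r \<omega> then \<integral>\<^sup>+\<omega>'. g (chain step n x \<omega>, \<omega>') \<partial>noise else 0) \<partial>noise)"
proof (induction n arbitrary: x r)
  case (0 x r)
  note [measurable] = 0
  define H where "H \<tau> = (\<integral>\<^sup>+u. (\<integral>\<^sup>+\<omega>. g (x, (\<tau>, u) ## \<omega>) \<partial>noise) \<partial>R)" for \<tau>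
  have [measurable]: "H \<in> borel_measurable borel" unfolding H_def by measurable
  have "(\<integral>\<^sup>+\<omega>. (if jumps 0 r \<omega> then g (chain step 0 x \<omega>, restart 0 r \<omega>) else 0) \<partial>noise)
     = (\<integral>\<^sup>+\<tau>. (\<integral>\<^sup>+u. (\<integral>\<^sup>+\<omega>. (if jumps 0 r ((\<tau>, u) ## \<omega>) then g (chain step 0 x ((\<tau>, u) ## \<omega>), restart 0 r ((\<tau>, u) ## \<omega>)) else 0)
        \<partial>noise) \<partial>R) \<partial>clock)"
    by (rule nn_integral_noise) measurable
  also have "\<dots> = (\<integral>\<^sup>+\<tau>. (if r < \<tau> then H (\<tau> - r) else 0) \<partial>clock)"
    by (intro nn_integral_cong) (auto simp: H_def)
  also have "\<dots> = ennreal (exp (- \<Lambda> * r)) * (\<integral>\<^sup>+\<tau>. H \<tau> \<partial>clock)"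
    by (rule nn_integral_clock_memoryless) (use 0 in auto)
  also have "(\<integral>\<^sup>+\<tau>. H \<tau> \<partial>clock) = (\<integral>\<^sup>+\<omega>'. g (x, \<omega>') \<partial>noise)"
    unfolding H_def by (rule nn_integral_noise[symmetric]) measurable
  finally have 1: "(\<integral>\<^sup>+\<omega>. (if jumps 0 r \<omega> then g (chain step 0 x \<omega>, restart 0 r \<omega>) else 0) \<partial>noise)
     = ennreal (exp (- \<Lambda> * r)) * (\<integral>\<^sup>+\<omega>'. g (x, \<omega>') \<partial>noise)" .
  define c where "c = (\<integral>\<^sup>+\<omega>'. g (x, \<omega>') \<partial>noise)"
  have "(\<integral>\<^sup>+\<omega>. (if jumps 0 r \<omega> then c else 0) \<partial>noise) =
    (\<integral>\<^sup>+\<tau>. (\<integral>\<^sup>+u. (\<integral>\<^sup>+\<omega>. (if jumps 0 r ((\<tau>, u) ## \<omega>) then c else 0) \<partial>noise) \<partial>R) \<partial>clock)"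
    by (rule nn_integral_noise) measurable
  also have "\<dots> = (\<integral>\<^sup>+\<tau>. (if r < \<tau> then c else 0) \<partial>clock)"
    by (intro nn_integral_cong) (auto simp: noise.emeasure_space_1 R.emeasure_space_1)
  also have "\<dots> = ennreal (exp (- \<Lambda> * r)) * c"
    using nn_integral_clock_memoryless[of "\<lambda>_. c" r] 0 by (simp add: clock.emeasure_space_1)
  finally show ?case using 1 by (simp only: c_def chain.simps)
next
  case (Suc n x r)
  note [measurable] = Suc.prems
  let ?G = "\<lambda>y. \<integral>\<^sup>+\<omega>'. g (y, \<omega>') \<partial>noise"
  have "(\<integral>\<^sup>+\<omega>. (if jumps (Suc n) r \<omega> then g (chain step (Suc n) x \<omega>, restart (Suc n) r \<omega>) else 0) \<partial>noise)
     = (\<integral>\<^sup>+\<tau>. (\<integral>\<^sup>+u. (\<integral>\<^sup>+\<omega>. (if jumps (Suc n) r ((\<tau>, u) ## \<omega>) then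
          g (chain step (Suc n) x ((\<tau>, u) ## \<omega>), restart (Suc n) r ((\<tau>, u) ## \<omega>)) else 0)
        \<partial>noise) \<partial>R) \<partial>clock)"
    by (rule nn_integral_noise) measurable
  also have "\<dots> = (\<integral>\<^sup>+\<tau>. (\<integral>\<^sup>+u. (\<integral>\<^sup>+\<omega>. (if jumps (Suc n) r ((\<tau>, u) ## \<omega>) then
          ?G (chain step (Suc n) x ((\<tau>, u) ## \<omega>)) else 0)
        \<partial>noise) \<partial>R) \<partial>clock)"
  proof (intro nn_integral_cong[where M=clock] nn_integral_cong[where M=R])
    fix \<tau> u assume u: "u \<in> space R"
    have s: "step x u \<in> space N" using measurable_space[OF measurable_step, of "(x, u)"] u Suc.prems(1)
      by (simp add: space_pair_measure)
    show "(\<integral>\<^sup>+\<omega>. (if jumps (Suc n) r ((\<tau>, u) ## \<omega>) then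
          g (chain step (Suc n) x ((\<tau>, u) ## \<omega>), restart (Suc n) r ((\<tau>, u) ## \<omega>)) else 0) \<partial>noise)
     = (\<integral>\<^sup>+\<omega>. (if jumps (Suc n) r ((\<tau>, u) ## \<omega>) then ?G (chain step (Suc n) x ((\<tau>, u) ## \<omega>)) else 0) \<partial>noise)"
      using Suc.IH[OF s, of "r - \<tau>"] by (cases "0 \<le> \<tau> \<and> \<tau> \<le> r") (auto cong: if_cong)
  qed
  also have "\<dots> = (\<integral>\<^sup>+\<omega>. (if jumps (Suc n) r \<omega> then ?G (chain step (Suc n) x \<omega>) else 0) \<partial>noise)"
    by (rule nn_integral_noise[symmetric]) measurable
  finally show ?case .
qed

lemma prob_clock_gt:
  assumes "0 \<le> t" shows "emeasure clock {t<..} = ennreal (exp (- \<Lambda> * t))"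
proof -
  have "(\<integral>\<^sup>+\<tau>. (if t < \<tau> then 1 else 0) \<partial>clock) = (\<integral>\<^sup>+\<tau>. indicator {t<..} \<tau> \<partial>clock)"
    by (intro nn_integral_cong) (auto split: split_indicator)
  also have "\<dots> = emeasure clock {t<..}" by simp
  finally have "emeasure clock {t<..} = (\<integral>\<^sup>+\<tau>. (if t < \<tau> then 1 else 0) \<partial>clock)" ..
  then show ?thesis using nn_integral_clock_memoryless[of "\<lambda>_. 1" t] assms by (simp add: clock.emeasure_space_1)
qed

lemma prob_clock_le:
  assumes "0 \<le> t" shows "emeasure clock {..t} = ennreal (1 - exp (- \<Lambda> * t))"
proof -
  have "measure clock {t<..} = exp (- \<Lambda> * t)" using prob_clock_gt[OF assms] by (simp add: measure_def)
  moreover have "measure clock {..t} = 1 - measure clock {t<..}"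
    using clock.prob_compl[of "{t<..}"] by (simp add: clock_def Compl_eq_Diff_UNIV[symmetric] Compl_greaterThan)
  ultimately show ?thesis by (simp add: clock.emeasure_eq_measure)
qed

lemma AE_clock_nonneg: "AE \<tau> in clock. 0 \<le> \<tau>"
  unfolding clock_def by (subst AE_density) (auto simp: exponential_density_def)

text \<open>
  Let \<open>e t\<close> be the probability that infinitely many waiting times elapse before \<open>t\<close>.  The first waiting
  time must be at most \<open>t\<close>, and the remaining ones explode before \<open>t\<close> as well; hence
  \<open>e t \<le> (1 - exp (- \<Lambda> t)) * e t\<close>, which forces \<open>e t = 0\<close>.
\<close>

lemma AE_noise_nonexplosive: "AE \<omega> in noise. nonexplosive \<omega>"
proof -
  define e where "e t = (\<integral>\<^sup>+\<omega>. (if \<exists>n. jumps n t \<omega> then 0 else 1) \<partial>noise)" for t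
  have le1: "e t \<le> 1" for t
  proof -
    have "e t \<le> (\<integral>\<^sup>+\<omega>. 1 \<partial>noise)" unfolding e_def by (intro nn_integral_mono) auto
    then show ?thesis by (simp add: noise.emeasure_space_1)
  qed
  have mono: "e s \<le> e t" if "s \<le> t" for s t
    unfolding e_def using jumps_earlier[OF _ that] by (intro nn_integral_mono) (simp, blast)
  have e0: "e t = 0" if t: "0 \<le> t" for t
  proof -
    have "e t = (\<integral>\<^sup>+\<tau>. (\<integral>\<^sup>+u. (\<integral>\<^sup>+\<omega>. (if \<exists>n. jumps n t ((\<tau>, u) ## \<omega>) then 0 else 1) \<partial>noise) \<partial>R) \<partial>clock)"
      unfolding e_def by (rule nn_integral_noise) measurable
    also have "\<dots> \<le> (\<integral>\<^sup>+\<tau>. e t * indicator {..t} \<tau> \<partial>clock)"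
    proof (rule nn_integral_mono_AE, use AE_clock_nonneg in eventually_elim)
      fix \<tau> :: real assume \<tau>: "0 \<le> \<tau>"
      have "(\<integral>\<^sup>+\<omega>. (if \<exists>n. jumps n t ((\<tau>, u) ## \<omega>) then 0 else 1) \<partial>noise) \<le> e t * indicator {..t} \<tau>" for u
      proof (cases "\<tau> \<le> t")
        case True
        have "(\<integral>\<^sup>+\<omega>. (if \<exists>n. jumps n t ((\<tau>, u) ## \<omega>) then 0 else 1) \<partial>noise) \<le> e (t - \<tau>)"
          unfolding e_def
        proof (intro nn_integral_mono)
          fix \<omega>
          have "jumps (Suc n) t ((\<tau>, u) ## \<omega>)" if "jumps n (t - \<tau>) \<omega>" for n
            using that True \<tau> by simp
          then show "(if \<exists>n. jumps n t ((\<tau>, u) ## \<omega>) then 0 else 1::ennreal) \<le> (if \<exists>n. jumps n (t - \<tau>) \<omega> then 0 else 1)"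
            by (simp del: jumps.simps) blast
        qed
        also have "\<dots> \<le> e t" using mono[of "t - \<tau>" t] \<tau> by simp
        finally show ?thesis using True by simp
      next
        case False
        then have "jumps 0 t ((\<tau>, u) ## \<omega>)" for \<omega> by simp
        then have "\<exists>n. jumps n t ((\<tau>, u) ## \<omega>)" for \<omega> by blast
        then show ?thesis by simp
      qed
      then have "(\<integral>\<^sup>+u. (\<integral>\<^sup>+\<omega>. (if \<exists>n. jumps n t ((\<tau>, u) ## \<omega>) then 0 else 1) \<partial>noise) \<partial>R) \<le> (\<integral>\<^sup>+u. e t * indicator {..t} \<tau> \<partial>R)"
        by (intro nn_integral_mono)
      then show "(\<integral>\<^sup>+u. (\<integral>\<^sup>+\<omega>. (if \<exists>n. jumps n t ((\<tau>, u) ## \<omega>) then 0 else 1) \<partial>noise) \<partial>R) \<le> e t * indicator {..t} \<tau>"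
        by (simp add: R.emeasure_space_1)
    qed
    also have "\<dots> = e t * ennreal (1 - exp (- \<Lambda> * t))"
      by (subst nn_integral_cmult_indicator) (auto simp: prob_clock_le[OF t])
    finally have le: "e t \<le> e t * ennreal (1 - exp (- \<Lambda> * t))" .
    obtain a where a: "e t = ennreal a" "0 \<le> a" using le1[of t] by (cases "e t") (auto simp: top_unique)
    have "exp (- \<Lambda> * t) \<le> 1" using rate_pos t by simp
    with le a have "ennreal a \<le> ennreal (a * (1 - exp (- \<Lambda> * t)))" by (simp add: ennreal_mult)
    then have "a \<le> a * (1 - exp (- \<Lambda> * t))"
      using a \<open>exp (- \<Lambda> * t) \<le> 1\<close> by (subst (asm) ennreal_le_iff) auto
    then have "a * exp (- \<Lambda> * t) \<le> 0" by (simp add: algebra_simps)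
    then have "a \<le> 0" by (metis exp_gt_zero mult_pos_pos not_le)
    then show ?thesis using a by simp
  qed
  have "AE \<omega> in noise. \<exists>n. jumps n (real k) \<omega>" for k
  proof -
    have "AE \<omega> in noise. (if \<exists>n. jumps n (real k) \<omega> then 0 else 1 :: ennreal) = 0"
      using e0[OF of_nat_0_le_iff, of k] unfolding e_def by (subst (asm) nn_integral_0_iff_AE) auto
    then show ?thesis by eventually_elim (auto split: if_splits)
  qed
  then show ?thesis unfolding nonexplosive_def by (simp add: AE_all_countable)
qed

abbreviation restart_time :: "real \<Rightarrow> (real \<times> 'u) stream \<Rightarrow> (real \<times> 'u) stream" where
  "restart_time t \<omega> \<equiv> restart (jump_count t \<omega>) t \<omega>"

lemma measurable_restart_time [measurable (raw)]:
  assumes [measurable]: "f \<in> borel_measurable M" "g \<in> M \<rightarrow>\<^sub>M noise"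
  shows "(\<lambda>z. restart_time (f z) (g z)) \<in> M \<rightarrow>\<^sub>M noise"
  by (rule measurable_compose_countable'[where I=UNIV and f="\<lambda>n z. restart n (f z) (g z)"
        and g="\<lambda>z. jump_count (f z) (g z)"]) (simp_all, measurable)

lemma space_step: "x \<in> space N \<Longrightarrow> u \<in> space R \<Longrightarrow> step x u \<in> space N"
  using measurable_space[OF measurable_step, of "(x, u)"] by (simp add: space_pair_measure)

lemma space_position: "x \<in> space N \<Longrightarrow> \<omega> \<in> space noise \<Longrightarrow> position t x \<omega> \<in> space N"
proof -
  assume "x \<in> space N" "\<omega> \<in> space noise"
  then have [measurable]: "(\<lambda>z. x) \<in> noise \<rightarrow>\<^sub>M N" by simp
  have "(\<lambda>z. position t x z) \<in> noise \<rightarrow>\<^sub>M N" by measurable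
  from measurable_space[OF this \<open>\<omega> \<in> space noise\<close>] show ?thesis .
qed

text \<open>
  The position at time \<open>r\<close> and the noise after time \<open>r\<close> are independent, and the latter is distributed
  like the original noise: sum \<open>nn_integral_restart_at_jump\<close> over the number of jumps.
\<close>

lemma nn_integral_position_restart:
  assumes g[measurable]: "g \<in> borel_measurable (N \<Otimes>\<^sub>M noise)" and x: "x \<in> space N" and r: "0 \<le> r"
  shows "(\<integral>\<^sup>+\<omega>. g (position r x \<omega>, restart_time r \<omega>) \<partial>noise) =
    (\<integral>\<^sup>+\<omega>. (\<integral>\<^sup>+\<omega>'. g (position r x \<omega>, \<omega>') \<partial>noise) \<partial>noise)"
proof -
  note [measurable] = x
  have split: "(\<integral>\<^sup>+\<omega>. a (jump_count r \<omega>) \<omega> \<partial>noise) = (\<Sum>n. \<integral>\<^sup>+\<omega>. (if jumps n r \<omega> then a n \<omega> else 0) \<partial>noise)"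
    if [measurable]: "\<And>n. a n \<in> borel_measurable noise" for a :: "nat \<Rightarrow> (real \<times> 'u) stream \<Rightarrow> ennreal"
  proof -
    have "(\<integral>\<^sup>+\<omega>. a (jump_count r \<omega>) \<omega> \<partial>noise) = (\<integral>\<^sup>+\<omega>. (\<Sum>n. (if jumps n r \<omega> then a n \<omega> else 0)) \<partial>noise)"
    proof (rule nn_integral_cong_AE, use AE_noise_nonexplosive in eventually_elim)
      fix \<omega> :: "(real \<times> 'u) stream" assume "nonexplosive \<omega>"
      then have "jumps n r \<omega> \<longleftrightarrow> n = jump_count r \<omega>" for n
        using nonexplosive_jumps jump_count_eq by blast
      then show "a (jump_count r \<omega>) \<omega> = (\<Sum>n. (if jumps n r \<omega> then a n \<omega> else 0))"
        using sums_unique[OF sums_single[of "jump_count r \<omega>" "\<lambda>n. a n \<omega>"]] by simp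
    qed
    also have "\<dots> = (\<Sum>n. \<integral>\<^sup>+\<omega>. (if jumps n r \<omega> then a n \<omega> else 0) \<partial>noise)"
      by (rule nn_integral_suminf) measurable
    finally show ?thesis .
  qed
  have "(\<integral>\<^sup>+\<omega>. g (position r x \<omega>, restart_time r \<omega>) \<partial>noise)
     = (\<Sum>n. \<integral>\<^sup>+\<omega>. (if jumps n r \<omega> then g (chain step n x \<omega>, restart n r \<omega>) else 0) \<partial>noise)"
    unfolding position_def
    by (rule split[of "\<lambda>n \<omega>. g (chain step n x \<omega>, restart n r \<omega>)"]) measurable
  also have "\<dots> = (\<Sum>n. \<integral>\<^sup>+\<omega>. (if jumps n r \<omega> then \<integral>\<^sup>+\<omega>'. g (chain step n x \<omega>, \<omega>') \<partial>noise else 0) \<partial>noise)"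
    by (simp only: nn_integral_restart_at_jump[OF g x r])
  also have "\<dots> = (\<integral>\<^sup>+\<omega>. (\<integral>\<^sup>+\<omega>'. g (position r x \<omega>, \<omega>') \<partial>noise) \<partial>noise)"
    unfolding position_def
    by (rule split[symmetric, of "\<lambda>n \<omega>. \<integral>\<^sup>+\<omega>'. g (chain step n x \<omega>, \<omega>') \<partial>noise"]) measurable
  finally show ?thesis .
qed

text \<open>
  The pathwise flow property: running the process up to \<open>r\<close> and then with the restarted noise is the
  same as running it without interruption.
\<close>

lemma position_add_jump:
  assumes "nonexplosive \<omega>" "jumps n r \<omega>" "0 \<le> t"
  shows "position (r + t) x \<omega> = position t (chain step n x \<omega>) (restart n r \<omega>)"
  using assms(1,2)
proof (induction n arbitrary: r \<omega> x)
  case 0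
  define m where "m = jump_count (r + t) \<omega>"
  have "jumps m (r + t) \<omega>" using 0 by (simp add: m_def nonexplosive_jumps)
  then have "jumps m t (restart 0 r \<omega>)" using 0 by (cases m) (auto simp: algebra_simps)
  then have "jump_count t (restart 0 r \<omega>) = m" by (rule jump_count_eq)
  moreover have "chain step m x \<omega> = chain step m x (restart 0 r \<omega>)" by (cases m) auto
  ultimately show ?case by (simp add: position_def m_def)
next
  case (Suc n)
  have "position (r + t) x \<omega> = position (r - fst (shd \<omega>) + t) (step x (snd (shd \<omega>))) (stl \<omega>)"
    using Suc.prems assms(3) by (simp add: position_def jump_count_Suc algebra_simps)
  also have "\<dots> = position t (chain step n (step x (snd (shd \<omega>))) (stl \<omega>)) (restart n (r - fst (shd \<omega>)) (stl \<omega>))"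
    using Suc.prems by (intro Suc.IH) (auto simp: nonexplosive_stl)
  finally show ?case by simp
qed

lemma position_add:
  assumes "nonexplosive \<omega>" "0 \<le> t"
  shows "position (r + t) x \<omega> = position t (position r x \<omega>) (restart_time r \<omega>)"
  using position_add_jump[OF assms(1) nonexplosive_jumps[OF assms(1)] assms(2)] by (simp add: position_def)

lemma AE_position_0: "AE \<omega> in noise. position 0 x \<omega> = x"
proof -
  have "emeasure noise {\<omega>\<in>space noise. \<not> 0 < fst (shd \<omega>)} = 0"
  proof -
    have [measurable]: "Measurable.pred noise (\<lambda>\<omega>. 0 < fst (shd \<omega>))"
      using pred_jumps[of "\<lambda>_. 0" noise "\<lambda>\<omega>. \<omega>" 0] by simp
    have "emeasure noise {\<omega>\<in>space noise. \<not> 0 < fst (shd \<omega>)} =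
        (\<integral>\<^sup>+\<omega>. indicator {\<omega>\<in>space noise. \<not> 0 < fst (shd \<omega>)} \<omega> \<partial>noise)"
      by (subst nn_integral_indicator) auto
    also have "\<dots> = (\<integral>\<^sup>+\<omega>. (if \<not> 0 < fst (shd \<omega>) then 1 else 0) \<partial>noise)"
      by (intro nn_integral_cong) (auto split: split_indicator)
    also have "\<dots> = (\<integral>\<^sup>+\<tau>. (\<integral>\<^sup>+u. (\<integral>\<^sup>+\<omega>. (if \<not> 0 < fst (shd ((\<tau>, u) ## \<omega>)) then 1 else 0) \<partial>noise) \<partial>R) \<partial>clock)"
      by (rule nn_integral_noise) measurable
    also have "\<dots> = (\<integral>\<^sup>+\<tau>. indicator {..0} \<tau> \<partial>clock)"
      by (intro nn_integral_cong) (auto simp: noise.emeasure_space_1 R.emeasure_space_1 split: split_indicator)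
    also have "\<dots> = 0" using prob_clock_le[of 0] by simp
    finally show ?thesis .
  qed
  then have "AE \<omega> in noise. 0 < fst (shd \<omega>)"
    using pred_jumps[of "\<lambda>_. 0" noise "\<lambda>\<omega>. \<omega>" 0] by (subst AE_iff_measurable[OF _ refl]) auto
  then show ?thesis by eventually_elim (simp add: position_def jump_count_0)
qed

text \<open>
  Membership in a finite-dimensional cylinder, the times and target sets being listed.
\<close>

definition visits :: "(real \<times> 'e set) list \<Rightarrow> 'e \<Rightarrow> (real \<times> 'u) stream \<Rightarrow> bool" where
  "visits l x \<omega> \<longleftrightarrow> (\<forall>(u, B)\<in>set l. position u x \<omega> \<in> B)"

lemma pred_visits [measurable (raw)]:
  assumes "h \<in> M \<rightarrow>\<^sub>M N" "g \<in> M \<rightarrow>\<^sub>M noise" "\<And>u B. (u, B) \<in> set l \<Longrightarrow> B \<in> sets N"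
  shows "Measurable.pred M (\<lambda>z. visits l (h z) (g z))"
proof -
  note [measurable] = assms(1,2)
  have *: "Measurable.pred M (\<lambda>z. position u (h z) (g z) \<in> B)" if "(u, B) \<in> set l" for u B
  proof -
    note [measurable] = assms(3)[OF that]
    show ?thesis by measurable
  qed
  have "(\<lambda>z. visits l (h z) (g z)) = (\<lambda>z. \<forall>p\<in>set l. position (fst p) (h z) (g z) \<in> snd p)"
    by (auto simp: visits_def split_beta)
  moreover have "Measurable.pred M (\<lambda>z. \<forall>p\<in>set l. position (fst p) (h z) (g z) \<in> snd p)"
    by (intro pred_intros_finite) (auto intro!: *)
  ultimately show ?thesis by simp
qed

lemma nn_integral_visits_Cons:
  assumes h[measurable]: "h \<in> borel_measurable N" and x[measurable]: "x \<in> space N" and u: "0 \<le> u" and v: "u \<le> v"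
    and l: "\<And>w C. (w, C) \<in> set l \<Longrightarrow> u \<le> w \<and> C \<in> sets N" and B[measurable]: "B \<in> sets N"
  defines "l' \<equiv> map (\<lambda>(w, C). (w - u, C)) l"
  shows "(\<integral>\<^sup>+\<omega>. (if visits ((u, B) # l) x \<omega> then h (position v x \<omega>) else 0) \<partial>noise) =
    (\<integral>\<^sup>+\<omega>. (if position u x \<omega> \<in> B then
        \<integral>\<^sup>+\<omega>'. (if visits l' (position u x \<omega>) \<omega>' then h (position (v - u) (position u x \<omega>) \<omega>') else 0) \<partial>noise
      else 0) \<partial>noise)"
proof -
  define G where "G = (\<lambda>(y, \<omega>'). if y \<in> B then if visits l' y \<omega>' then h (position (v - u) y \<omega>') else 0 else 0 :: ennreal)"
  have [measurable]: "Measurable.pred (N \<Otimes>\<^sub>M noise) (\<lambda>z. visits l' (fst z) (snd z))"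
    by (rule pred_visits) (use l in \<open>auto simp: l'_def\<close>)
  have [measurable]: "G \<in> borel_measurable (N \<Otimes>\<^sub>M noise)"
    unfolding G_def split_beta by measurable
  have "(\<integral>\<^sup>+\<omega>. (if visits ((u, B) # l) x \<omega> then h (position v x \<omega>) else 0) \<partial>noise)
    = (\<integral>\<^sup>+\<omega>. G (position u x \<omega>, restart_time u \<omega>) \<partial>noise)"
  proof (rule nn_integral_cong_AE, use AE_noise_nonexplosive in eventually_elim)
    fix \<omega> :: "(real \<times> 'u) stream" assume ne: "nonexplosive \<omega>"
    have pos: "position w x \<omega> = position (w - u) (position u x \<omega>) (restart_time u \<omega>)" if "u \<le> w" for w
      using position_add[OF ne, of "w - u" u x] that by simp
    have "visits ((u, B) # l) x \<omega> \<longleftrightarrow> position u x \<omega> \<in> B \<and> visits l' (position u x \<omega>) (restart_time u \<omega>)"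
    proof -
      have "visits ((u, B) # l) x \<omega> \<longleftrightarrow> position u x \<omega> \<in> B \<and> (\<forall>p\<in>set l. position (fst p) x \<omega> \<in> snd p)"
        by (simp add: visits_def split_beta)
      moreover have "visits l' (position u x \<omega>) (restart_time u \<omega>) \<longleftrightarrow>
          (\<forall>p\<in>set l. position (fst p - u) (position u x \<omega>) (restart_time u \<omega>) \<in> snd p)"
        by (simp add: visits_def l'_def split_beta)
      moreover have "position (fst p) x \<omega> = position (fst p - u) (position u x \<omega>) (restart_time u \<omega>)"
        if "p \<in> set l" for p
        by (rule pos) (use l[of "fst p" "snd p"] that in simp)
      ultimately show ?thesis by (metis (no_types, lifting))
    qed
    then show "(if visits ((u, B) # l) x \<omega> then h (position v x \<omega>) else 0) = G (position u x \<omega>, restart_time u \<omega>)"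
      unfolding G_def prod.case pos[OF v] by (simp del: restart.simps)
  qed
  also have "\<dots> = (\<integral>\<^sup>+\<omega>. (\<integral>\<^sup>+\<omega>'. G (position u x \<omega>, \<omega>') \<partial>noise) \<partial>noise)"
    by (rule nn_integral_position_restart[of G]) (use x u in auto)
  also have "\<dots> = (\<integral>\<^sup>+\<omega>. (if position u x \<omega> \<in> B then
        \<integral>\<^sup>+\<omega>'. (if visits l' (position u x \<omega>) \<omega>' then h (position (v - u) (position u x \<omega>) \<omega>') else 0) \<partial>noise
      else 0) \<partial>noise)"
    by (intro nn_integral_cong) (auto simp: G_def)
  finally show ?thesis .
qed

text \<open>
  The Markov property, tested on cylinders in the past of \<open>r\<close>.  By induction on the number of times:
  restart at the earliest one and apply the induction hypothesis to the remaining process.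
\<close>

lemma nn_integral_position_Markov:
  assumes g[measurable]: "g \<in> borel_measurable N" and t: "0 \<le> t"
  shows "x \<in> space N \<Longrightarrow> 0 \<le> r \<Longrightarrow> sorted (map fst l) \<Longrightarrow>
    (\<And>u B. (u, B) \<in> set l \<Longrightarrow> 0 \<le> u \<and> u \<le> r \<and> B \<in> sets N) \<Longrightarrow>
    (\<integral>\<^sup>+\<omega>. (if visits l x \<omega> then g (position (r + t) x \<omega>) else 0) \<partial>noise) =
    (\<integral>\<^sup>+\<omega>. (if visits l x \<omega> then \<integral>\<^sup>+\<omega>'. g (position t (position r x \<omega>) \<omega>') \<partial>noise else 0) \<partial>noise)"
proof (induction "length l" arbitrary: x r l)
  case 0
  note [measurable] = 0(2)
  have "(\<integral>\<^sup>+\<omega>. g (position (r + t) x \<omega>) \<partial>noise) = (\<integral>\<^sup>+\<omega>. g (position t (position r x \<omega>) (restart_time r \<omega>)) \<partial>noise)"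
    by (rule nn_integral_cong_AE, use AE_noise_nonexplosive in eventually_elim) (simp add: position_add t)
  also have "\<dots> = (\<integral>\<^sup>+\<omega>. \<integral>\<^sup>+\<omega>'. g (position t (position r x \<omega>) \<omega>') \<partial>noise \<partial>noise)"
    using nn_integral_position_restart[of "\<lambda>(y, \<omega>'). g (position t y \<omega>')" x r] 0 by simp
  finally show ?case using 0(1) by (simp add: visits_def)
next
  case (Suc n)
  obtain u B l1 where l: "l = (u, B) # l1" using Suc(2) by (cases l) auto
  note x[measurable] = Suc(3)
  have u: "0 \<le> u" "u \<le> r" and B[measurable]: "B \<in> sets N" using Suc(6)[of u B] by (auto simp: l)
  have l1: "u \<le> w \<and> C \<in> sets N" if "(w, C) \<in> set l1" for w C
    using that Suc(5) Suc(6)[of w C] by (force simp: l)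
  define l' where "l' = map (\<lambda>(w, C). (w - u, C)) l1"
  define K where "K y = (\<integral>\<^sup>+\<omega>'. g (position t y \<omega>') \<partial>noise)" for y
  have [measurable]: "K \<in> borel_measurable N" unfolding K_def by measurable
  have sorted': "sorted (map fst l')"
  proof -
    have "map fst l' = map (\<lambda>w. w - u) (map fst l1)" by (simp add: l'_def split_beta)
    then show ?thesis using Suc(5) by (simp add: l sorted_map sorted_wrt_map)
  qed
  have set': "0 \<le> w \<and> w \<le> r - u \<and> C \<in> sets N" if "(w, C) \<in> set l'" for w C
    using that l1 Suc(6) by (fastforce simp: l'_def l)
  have len: "n = length l'" using Suc(2) by (simp add: l'_def l)
  have "(\<integral>\<^sup>+\<omega>. (if visits l x \<omega> then g (position (r + t) x \<omega>) else 0) \<partial>noise) =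
    (\<integral>\<^sup>+\<omega>. (if position u x \<omega> \<in> B then
        \<integral>\<^sup>+\<omega>'. (if visits l' (position u x \<omega>) \<omega>' then g (position (r + t - u) (position u x \<omega>) \<omega>') else 0) \<partial>noise
      else 0) \<partial>noise)"
    unfolding l l'_def by (rule nn_integral_visits_Cons[OF g]) (use u l1 t x in auto)
  also have "\<dots> = (\<integral>\<^sup>+\<omega>. (if position u x \<omega> \<in> B then
        \<integral>\<^sup>+\<omega>'. (if visits l' (position u x \<omega>) \<omega>' then K (position (r - u) (position u x \<omega>) \<omega>') else 0) \<partial>noise
      else 0) \<partial>noise)"
  proof (rule nn_integral_cong)
    fix \<omega> assume \<omega>: "\<omega> \<in> space noise"
    have eq: "r - u + t = r + t - u" by simp
    have "0 \<le> r - u" using u by simp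
    from Suc(1)[OF len space_position[OF x \<omega>, of u] this sorted' set']
    have "(\<integral>\<^sup>+\<omega>'. (if visits l' (position u x \<omega>) \<omega>' then g (position (r + t - u) (position u x \<omega>) \<omega>') else 0) \<partial>noise)
     = (\<integral>\<^sup>+\<omega>'. (if visits l' (position u x \<omega>) \<omega>' then K (position (r - u) (position u x \<omega>) \<omega>') else 0) \<partial>noise)"
      unfolding K_def eq .
    then show "(if position u x \<omega> \<in> B then
        \<integral>\<^sup>+\<omega>'. (if visits l' (position u x \<omega>) \<omega>' then g (position (r + t - u) (position u x \<omega>) \<omega>') else 0) \<partial>noise
      else 0) = (if position u x \<omega> \<in> B then
        \<integral>\<^sup>+\<omega>'. (if visits l' (position u x \<omega>) \<omega>' then K (position (r - u) (position u x \<omega>) \<omega>') else 0) \<partial>noise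
      else 0)"
      by (simp only:)
  qed
  also have "\<dots> = (\<integral>\<^sup>+\<omega>. (if visits l x \<omega> then K (position r x \<omega>) else 0) \<partial>noise)"
    unfolding l l'_def by (rule nn_integral_visits_Cons[symmetric, of K]) (use u l1 t x in auto)
  finally show ?case unfolding K_def .
qed

lemma distr_position_restart:
  assumes x[measurable]: "x \<in> space N" and r: "0 \<le> r"
  shows "distr noise (N \<Otimes>\<^sub>M noise) (\<lambda>\<omega>. (position r x \<omega>, restart_time r \<omega>)) =
    distr noise N (position r x) \<Otimes>\<^sub>M noise" (is "?L = ?R")
proof (rule measure_eqI)
  have [measurable]: "position r x \<in> noise \<rightarrow>\<^sub>M N" by measurable
  have MM: "(\<lambda>\<omega>. (position r x \<omega>, restart_time r \<omega>)) \<in> noise \<rightarrow>\<^sub>M N \<Otimes>\<^sub>M noise" by measurable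
  show "sets ?L = sets ?R" by simp
  fix A assume "A \<in> sets ?L"
  then have A[measurable]: "A \<in> sets (N \<Otimes>\<^sub>M noise)" by simp
  have "emeasure ?L A = (\<integral>\<^sup>+\<omega>. indicator A (position r x \<omega>, restart_time r \<omega>) \<partial>noise)"
    using nn_integral_distr[OF MM, of "indicator A"] by simp
  also have "\<dots> = (\<integral>\<^sup>+\<omega>. (\<integral>\<^sup>+\<omega>'. indicator A (position r x \<omega>, \<omega>') \<partial>noise) \<partial>noise)"
    by (rule nn_integral_position_restart[of "indicator A"]) (use x r in auto)
  also have "\<dots> = (\<integral>\<^sup>+y. (\<integral>\<^sup>+\<omega>'. indicator A (y, \<omega>') \<partial>noise) \<partial>distr noise N (position r x))"
    by (subst nn_integral_distr) auto
  also have "\<dots> = emeasure ?R A"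
    by (subst noise.emeasure_pair_measure) auto
  finally show "emeasure ?L A = emeasure ?R A" .
qed

section \<open>The semigroup of expectations and its generator\<close>

definition expect :: "real \<Rightarrow> ('e \<Rightarrow> real) \<Rightarrow> 'e \<Rightarrow> real" where
  "expect t f x = (\<integral>\<omega>. f (position t x \<omega>) \<partial>noise)"

definition jump_mean :: "('e \<Rightarrow> real) \<Rightarrow> 'e \<Rightarrow> real" where
  "jump_mean f x = (\<integral>u. f (step x u) \<partial>R)"

lemma integrable_position:
  assumes [measurable]: "f \<in> borel_measurable N" and b: "\<And>y. y \<in> space N \<Longrightarrow> \<bar>f y\<bar> \<le> (C::real)" and x[measurable]: "x \<in> space N"
  shows "integrable noise (\<lambda>\<omega>. f (position t x \<omega>))"
  by (rule noise.integrable_const_bound[where B=C]) (auto intro!: AE_I2 b space_position x)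

lemma expect_bound:
  assumes [measurable]: "f \<in> borel_measurable N" and b: "\<And>y. y \<in> space N \<Longrightarrow> \<bar>f y\<bar> \<le> (C::real)" and x: "x \<in> space N"
  shows "\<bar>expect t f x\<bar> \<le> C"
proof -
  have "\<bar>expect t f x\<bar> \<le> (\<integral>\<omega>. \<bar>f (position t x \<omega>)\<bar> \<partial>noise)"
    unfolding expect_def by (rule integral_abs_bound)
  also have "\<dots> \<le> (\<integral>\<omega>. C \<partial>noise)"
    by (rule integral_mono) (auto intro!: integrable_abs integrable_position[OF assms] b space_position x)
  finally show ?thesis by (simp add: noise.prob_space)
qed

lemma measurable_expect [measurable]:
  assumes [measurable]: "f \<in> borel_measurable N"
  shows "expect t f \<in> borel_measurable N"
  unfolding expect_def by measurable

lemma expect_add: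
  assumes f[measurable]: "f \<in> borel_measurable N" and b: "\<And>y. y \<in> space N \<Longrightarrow> \<bar>f y\<bar> \<le> (C::real)" and x[measurable]: "x \<in> space N"
    and "0 \<le> r" "0 \<le> t"
  shows "expect (r + t) f x = expect r (expect t f) x"
proof -
  have [measurable]: "position r x \<in> noise \<rightarrow>\<^sub>M N" by measurable
  interpret D: prob_space "distr noise N (position r x)" by (rule noise.prob_space_distr) measurable
  interpret pair_sigma_finite "distr noise N (position r x)" noise ..
  interpret DP: pair_prob_space "distr noise N (position r x)" noise ..
  have "expect (r + t) f x = (\<integral>\<omega>. f (position t (position r x \<omega>) (restart_time r \<omega>)) \<partial>noise)"
    unfolding expect_def
    by (rule integral_cong_AE, measurable, use AE_noise_nonexplosive in eventually_elim)
       (simp add: position_add assms)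
  also have "\<dots> = (\<integral>z. f (position t (fst z) (snd z)) \<partial>distr noise (N \<Otimes>\<^sub>M noise) (\<lambda>\<omega>. (position r x \<omega>, restart_time r \<omega>)))"
    by (subst integral_distr) auto
  also have "\<dots> = (\<integral>z. f (position t (fst z) (snd z)) \<partial>(distr noise N (position r x) \<Otimes>\<^sub>M noise))"
    by (simp add: distr_position_restart assms)
  also have "\<dots> = (\<integral>y. (\<integral>\<omega>'. f (position t y \<omega>') \<partial>noise) \<partial>distr noise N (position r x))"
  proof (subst integral_fst'[symmetric])
    show "integrable (distr noise N (position r x) \<Otimes>\<^sub>M noise) (\<lambda>z. f (position t (fst z) (snd z)))"
      by (rule DP.P.integrable_const_bound[where B=C]) (auto intro!: AE_I2 b space_position simp: space_pair_measure)
  qed simp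
  also have "\<dots> = expect r (expect t f) x"
    unfolding expect_def by (subst integral_distr) auto
  finally show ?thesis .
qed

lemma shd_mark: "shd \<in> noise \<rightarrow>\<^sub>M mark"
  unfolding noise_def by measurable

lemma distr_noise_shd: "distr noise mark shd = mark"
proof (rule measure_eqI)
  have MM[measurable]: "shd \<in> noise \<rightarrow>\<^sub>M mark" unfolding noise_def by measurable
  fix A assume "A \<in> sets (distr noise mark shd)"
  then have [measurable]: "A \<in> sets mark" by simp
  have "emeasure (distr noise mark shd) A = (\<integral>\<^sup>+\<omega>. indicator A (shd \<omega>) \<partial>noise)"
    using nn_integral_distr[OF MM, of "indicator A"] by simp
  also have "\<dots> = (\<integral>\<^sup>+q. (\<integral>\<^sup>+\<omega>. indicator A (shd (q ## \<omega>)) \<partial>noise) \<partial>mark)"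
    unfolding noise_def by (rule mark.nn_integral_stream_space) measurable
  also have "\<dots> = emeasure mark A" by (simp add: noise.emeasure_space_1)
  finally show "emeasure (distr noise mark shd) A = emeasure mark A" .
qed simp

lemma prob_two_jumps:
  assumes t: "0 \<le> t"
  shows "(\<integral>\<omega>. indicator {\<omega>. fst (shd \<omega>) \<le> t \<and> fst (shd (stl \<omega>)) \<le> t} \<omega> \<partial>noise) = (1 - exp (- \<Lambda> * t))\<^sup>2"
proof -
  let ?q = "ennreal (1 - exp (- \<Lambda> * t))"
  have [measurable]: "(\<lambda>\<omega>. shd \<omega>) \<in> noise \<rightarrow>\<^sub>M borel \<Otimes>\<^sub>M R" "(\<lambda>\<omega>. stl \<omega>) \<in> noise \<rightarrow>\<^sub>M noise"
    by (simp_all add: measurable_cong_sets[OF sets_noise refl] measurable_cong_sets[OF sets_noise sets_noise])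
  define I :: "(real \<times> 'u) stream \<Rightarrow> real" where "I = indicator {\<omega>. fst (shd \<omega>) \<le> t \<and> fst (shd (stl \<omega>)) \<le> t}"
  have [measurable]: "I \<in> borel_measurable noise"
    unfolding I_def indicator_def of_bool_def mem_Collect_eq by measurable
  have 1: "(\<integral>\<^sup>+\<omega>. (if fst (shd \<omega>) \<le> t then 1 else 0) \<partial>noise) = ?q"
  proof -
    have "(\<integral>\<^sup>+\<omega>. (if fst (shd \<omega>) \<le> t then 1 else 0) \<partial>noise) =
      (\<integral>\<^sup>+\<tau>. (\<integral>\<^sup>+u. (\<integral>\<^sup>+\<omega>. (if fst (shd ((\<tau>, u) ## \<omega>)) \<le> t then 1 else 0) \<partial>noise) \<partial>R) \<partial>clock)"
      by (rule nn_integral_noise) measurable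
    also have "\<dots> = (\<integral>\<^sup>+\<tau>. indicator {..t} \<tau> \<partial>clock)"
      by (intro nn_integral_cong) (auto simp: noise.emeasure_space_1 R.emeasure_space_1 split: split_indicator)
    finally show ?thesis using prob_clock_le[OF t] by simp
  qed
  have "(\<integral>\<^sup>+\<omega>. ennreal (I \<omega>) \<partial>noise) = (\<integral>\<^sup>+\<tau>. (\<integral>\<^sup>+u. (\<integral>\<^sup>+\<omega>. ennreal (I ((\<tau>, u) ## \<omega>)) \<partial>noise) \<partial>R) \<partial>clock)"
    by (rule nn_integral_noise) measurable
  also have "\<dots> = (\<integral>\<^sup>+\<tau>. (\<integral>\<^sup>+u. ?q * indicator {..t} \<tau> \<partial>R) \<partial>clock)"
  proof (intro nn_integral_cong)
    fix \<tau> u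
    show "(\<integral>\<^sup>+\<omega>. ennreal (I ((\<tau>, u) ## \<omega>)) \<partial>noise) = ?q * indicator {..t} \<tau>"
    proof (cases "\<tau> \<le> t")
      case True
      then have "(\<integral>\<^sup>+\<omega>. ennreal (I ((\<tau>, u) ## \<omega>)) \<partial>noise) = (\<integral>\<^sup>+\<omega>. (if fst (shd \<omega>) \<le> t then 1 else 0) \<partial>noise)"
        by (intro nn_integral_cong) (auto simp: I_def)
      with True show ?thesis by (simp add: 1)
    qed (simp add: I_def)
  qed
  also have "\<dots> = ?q * ?q"
    using prob_clock_le[OF t] by (simp add: R.emeasure_space_1 nn_integral_cmult_indicator)
  also have "\<dots> = ennreal ((1 - exp (- \<Lambda> * t))\<^sup>2)"
    using rate_pos t by (simp add: ennreal_mult power2_eq_square)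
  finally have "(\<integral>\<omega>. I \<omega> \<partial>noise) = (1 - exp (- \<Lambda> * t))\<^sup>2"
    by (intro integral_eq_nn_integral[THEN trans]) (auto simp: I_def)
  then show ?thesis by (simp add: I_def)
qed

text \<open>
  Up to an event of probability at most \<open>(\<Lambda> t)\<^sup>2\<close>, at most one waiting time elapses before \<open>t\<close>.  On the
  complement the position is given by the first mark alone.
\<close>

lemma expect_expansion:
  assumes f[measurable]: "f \<in> borel_measurable N" and b: "\<And>y. y \<in> space N \<Longrightarrow> \<bar>f y\<bar> \<le> (C::real)" and x[measurable]: "x \<in> space N"
    and t: "0 \<le> t"
  shows "\<bar>expect t f x - f x - t * (\<Lambda> * (jump_mean f x - f x))\<bar> \<le> 3 * C * (\<Lambda> * t)\<^sup>2"
proof -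
  let ?e = "exp (- \<Lambda> * t)" and ?J = "jump_mean f x"
  have [measurable]: "(\<lambda>\<omega>. shd \<omega>) \<in> noise \<rightarrow>\<^sub>M borel \<Otimes>\<^sub>M R" "(\<lambda>\<omega>. stl \<omega>) \<in> noise \<rightarrow>\<^sub>M noise" "shd \<in> noise \<rightarrow>\<^sub>M mark"
    using shd_mark by (simp_all add: measurable_cong_sets[OF sets_noise refl] measurable_cong_sets[OF sets_noise sets_noise])
  have C0: "0 \<le> C" using b[OF x] by linarith
  have st: "\<bar>f (step x u)\<bar> \<le> C" if "u \<in> space R" for u using b space_step x that by blast
  have J: "\<bar>?J\<bar> \<le> C"
  proof -
    have "\<bar>?J\<bar> \<le> (\<integral>u. \<bar>f (step x u)\<bar> \<partial>R)" unfolding jump_mean_def by (rule integral_abs_bound)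
    also have "\<dots> \<le> (\<integral>u. C \<partial>R)"
      by (rule integral_mono) (auto intro!: integrable_abs R.integrable_const_bound[where B=C] AE_I2 st)
    finally show ?thesis by (simp add: R.prob_space)
  qed
  define G where "G q = (if t < fst q then f x else f (step x (snd q)))" for q :: "real \<times> 'u"
  have G[measurable]: "G \<in> borel_measurable (borel \<Otimes>\<^sub>M R)" unfolding G_def by measurable
  have G'[measurable]: "G \<in> borel_measurable mark" using G
    by (subst measurable_cong_sets[where M'="borel \<Otimes>\<^sub>M R"]) (auto simp: mark_def intro!: sets_pair_measure_cong)
  have Gb: "\<bar>G q\<bar> \<le> C" if "q \<in> space mark" for q
    using that b[OF x] st by (auto simp: G_def mark_def space_pair_measure)
  have intG: "integrable mark G"
    by (rule mark.integrable_const_bound[where B=C]) (auto intro!: AE_I2 Gb)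
  have intG2: "integrable noise (\<lambda>\<omega>. G (shd \<omega>))"
    using intG distr_noise_shd by (subst integrable_distr_eq[symmetric, where N=mark]) auto
  have EG: "(\<integral>\<omega>. G (shd \<omega>) \<partial>noise) = ?e * f x + (1 - ?e) * ?J"
  proof -
    have "(\<integral>\<omega>. G (shd \<omega>) \<partial>noise) = (\<integral>q. G q \<partial>mark)"
      by (subst distr_noise_shd[symmetric], subst integral_distr) auto
    also have "\<dots> = (\<integral>\<tau>. (\<integral>u. G (\<tau>, u) \<partial>R) \<partial>clock)"
    proof -
      interpret pair_sigma_finite clock R ..
      show ?thesis using integral_fst'[of G] intG by (simp add: mark_def)
    qed
    also have "\<dots> = (\<integral>\<tau>. f x * indicator {t<..} \<tau> + ?J * indicator {..t} \<tau> \<partial>clock)"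
      by (intro Bochner_Integration.integral_cong) (auto simp: G_def jump_mean_def R.prob_space split: split_indicator)
    also have "\<dots> = f x * measure clock {t<..} + ?J * measure clock {..t}"
      by (subst Bochner_Integration.integral_add) (auto simp: clock.emeasure_eq_measure)
    also have "measure clock {t<..} = ?e" using prob_clock_gt[OF t] by (simp add: measure_def)
    also have "measure clock {..t} = 1 - ?e" using prob_clock_le[OF t] rate_pos t by (simp add: measure_def)
    finally show ?thesis by (simp add: algebra_simps)
  qed
  let ?I = "indicator {\<omega>. fst (shd \<omega>) \<le> t \<and> fst (shd (stl \<omega>)) \<le> t} :: (real \<times> 'u) stream \<Rightarrow> real"
  have [measurable]: "?I \<in> borel_measurable noise"
    unfolding indicator_def of_bool_def mem_Collect_eq by measurable
  have intI: "integrable noise (\<lambda>\<omega>. 2 * C * ?I \<omega>)"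
    by (rule noise.integrable_const_bound[where B="2*C"]) (use C0 in \<open>auto intro!: AE_I2 split: split_indicator\<close>)
  have intf: "integrable noise (\<lambda>\<omega>. f (position t x \<omega>))" by (rule integrable_position[OF f b x])
  have "\<bar>expect t f x - (?e * f x + (1 - ?e) * ?J)\<bar> = \<bar>\<integral>\<omega>. f (position t x \<omega>) - G (shd \<omega>) \<partial>noise\<bar>"
    unfolding EG[symmetric] expect_def using Bochner_Integration.integral_diff[OF intf intG2] by simp
  also have "\<dots> \<le> (\<integral>\<omega>. \<bar>f (position t x \<omega>) - G (shd \<omega>)\<bar> \<partial>noise)" by (rule integral_abs_bound)
  also have "\<dots> \<le> (\<integral>\<omega>. 2 * C * ?I \<omega> \<partial>noise)"
  proof (rule integral_mono_AE)
    show "integrable noise (\<lambda>\<omega>. \<bar>f (position t x \<omega>) - G (shd \<omega>)\<bar>)" using intf intG2 by auto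
    show "AE \<omega> in noise. \<bar>f (position t x \<omega>) - G (shd \<omega>)\<bar> \<le> 2 * C * ?I \<omega>"
      using AE_noise_nonexplosive AE_space
    proof eventually_elim
      case (elim \<omega>)
      have sp: "shd \<omega> \<in> space mark" using measurable_space[OF \<open>shd \<in> noise \<rightarrow>\<^sub>M mark\<close>] elim by simp
      show ?case
      proof (cases "fst (shd \<omega>) \<le> t \<and> fst (shd (stl \<omega>)) \<le> t")
        case True
        have "\<bar>f (position t x \<omega>)\<bar> \<le> C" "\<bar>G (shd \<omega>)\<bar> \<le> C"
          using b[OF space_position[OF x elim(2)]] Gb[OF sp] by auto
        with True show ?thesis by simp
      next
        case False
        have "f (position t x \<omega>) = G (shd \<omega>)"
        proof (cases "t < fst (shd \<omega>)")
          case True then show ?thesis by (simp add: position_def jump_count_0 G_def)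
        next
          case F: False
          have "t - fst (shd \<omega>) < fst (shd (stl \<omega>))" using F False nonexplosive_nonneg[OF elim(1)] by auto
          then have "jump_count t \<omega> = Suc 0" using jump_count_Suc[OF elim(1)] F jump_count_0 by fastforce
          then show ?thesis using F by (simp add: position_def G_def)
        qed
        then show ?thesis using C0 by simp
      qed
    qed
  qed (rule intI)
  also have "\<dots> = 2 * C * (1 - ?e)\<^sup>2" using prob_two_jumps[OF t] by simp
  finally have A: "\<bar>expect t f x - (?e * f x + (1 - ?e) * ?J)\<bar> \<le> 2 * C * (1 - ?e)\<^sup>2" .
  define a where "a = \<Lambda> * t"
  have a: "0 \<le> a" using rate_pos t by (simp add: a_def)
  have e1: "0 \<le> 1 - exp (- a)" "1 - exp (- a) \<le> a" using a exp_ge_add_one_self[of "-a"] by auto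
  have e2: "\<bar>(1 - exp (- a)) - a\<bar> \<le> a\<^sup>2 / 2"
  proof -
    have "exp (- a) \<le> 1 - a + a\<^sup>2 / 2"
    proof -
      have "exp (- a) \<le> 1 + (-a) + (-a)\<^sup>2/2"
      proof -
        define \<phi> where "\<phi> s = 1 - s + s\<^sup>2/2 - exp (- s)" for s :: real
        have "\<phi> 0 \<le> \<phi> a"
        proof (rule DERIV_nonneg_imp_nondecreasing[OF a])
          fix s :: real assume "0 \<le> s" "s \<le> a"
          have "(\<phi> has_real_derivative (-1 + s + exp (-s))) (at s)"
            unfolding \<phi>_def by (auto intro!: derivative_eq_intros)
          moreover have "0 \<le> -1 + s + exp (-s)" using exp_ge_add_one_self[of "-s"] by simp
          ultimately show "\<exists>y. (\<phi> has_real_derivative y) (at s) \<and> 0 \<le> y" by blast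
        qed
        then show ?thesis by (simp add: \<phi>_def)
      qed
      then show ?thesis by simp
    qed
    with e1 show ?thesis by auto
  qed
  have "expect t f x - f x - t * (\<Lambda> * (?J - f x)) =
    (expect t f x - (?e * f x + (1 - ?e) * ?J)) + ((1 - exp (- a)) - a) * (?J - f x)"
    by (simp add: a_def algebra_simps)
  also have "\<bar>\<dots>\<bar> \<le> \<bar>expect t f x - (?e * f x + (1 - ?e) * ?J)\<bar> + \<bar>(1 - exp (- a)) - a\<bar> * \<bar>?J - f x\<bar>"
    by (rule order_trans[OF abs_triangle_ineq]) (simp add: abs_mult)
  also have "\<dots> \<le> 2 * C * a\<^sup>2 + (a\<^sup>2 / 2) * (2 * C)"
  proof (intro add_mono mult_mono)
    show "\<bar>expect t f x - (?e * f x + (1 - ?e) * ?J)\<bar> \<le> 2 * C * a\<^sup>2"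
    proof (rule order_trans[OF A])
      have "(1 - exp (-a))\<^sup>2 \<le> a\<^sup>2" using e1 by (intro power_mono) auto
      then show "2 * C * (1 - ?e)\<^sup>2 \<le> 2 * C * a\<^sup>2" using C0 by (simp add: a_def mult_left_mono)
    qed
    show "\<bar>?J - f x\<bar> \<le> 2 * C" using J b[OF x] by simp
  qed (use e2 in auto)
  finally show ?thesis by (simp add: a_def algebra_simps)
qed

lemma expect_coupling:
  assumes f: "f \<in> borel_measurable N" and b: "\<And>y. y \<in> space N \<Longrightarrow> \<bar>f y\<bar> \<le> (C::real)" and x: "x \<in> space N" and y: "y \<in> space N"
    and st: "\<And>u. step x u = step y u \<or> (step x u = x \<and> step y u = y)"
  shows "\<bar>expect t f x - expect t f y\<bar> \<le> \<bar>f x - f y\<bar>"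
proof -
  note ix = integrable_position[OF f b x, of t] and iy = integrable_position[OF f b y, of t]
  have "\<bar>expect t f x - expect t f y\<bar> = \<bar>\<integral>\<omega>. f (position t x \<omega>) - f (position t y \<omega>) \<partial>noise\<bar>"
    unfolding expect_def using Bochner_Integration.integral_diff[OF ix iy] by simp
  also have "\<dots> \<le> (\<integral>\<omega>. \<bar>f (position t x \<omega>) - f (position t y \<omega>)\<bar> \<partial>noise)" by (rule integral_abs_bound)
  also have "\<dots> \<le> (\<integral>\<omega>. \<bar>f x - f y\<bar> \<partial>noise)"
  proof (rule integral_mono)
    fix \<omega>
    show "\<bar>f (position t x \<omega>) - f (position t y \<omega>)\<bar> \<le> \<bar>f x - f y\<bar>"
      using chain_coupling[of step x y "jump_count t \<omega>" \<omega>] st by (auto simp: position_def)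
  qed (use ix iy in auto)
  finally show ?thesis by (simp add: noise.prob_space)
qed

lemma jump_mean_coupling:
  assumes f[measurable]: "f \<in> borel_measurable N" and b: "\<And>y. y \<in> space N \<Longrightarrow> \<bar>f y\<bar> \<le> (C::real)" and x[measurable]: "x \<in> space N" and y[measurable]: "y \<in> space N"
    and st: "\<And>u. step x u = step y u \<or> (step x u = x \<and> step y u = y)"
  shows "\<bar>jump_mean f x - jump_mean f y\<bar> \<le> \<bar>f x - f y\<bar>"
proof -
  have i: "integrable R (\<lambda>u. f (step z u))" if [measurable]: "z \<in> space N" for z
    by (rule R.integrable_const_bound[where B=C]) (use that in \<open>auto intro!: AE_I2 b space_step\<close>)
  have "\<bar>jump_mean f x - jump_mean f y\<bar> = \<bar>\<integral>u. f (step x u) - f (step y u) \<partial>R\<bar>"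
    unfolding jump_mean_def using Bochner_Integration.integral_diff[OF i[OF x] i[OF y]] by simp
  also have "\<dots> \<le> (\<integral>u. \<bar>f (step x u) - f (step y u)\<bar> \<partial>R)" by (rule integral_abs_bound)
  also have "\<dots> \<le> (\<integral>u. \<bar>f x - f y\<bar> \<partial>R)"
  proof (rule integral_mono)
    fix u
    show "\<bar>f (step x u) - f (step y u)\<bar> \<le> \<bar>f x - f y\<bar>"
      using st[of u] by auto
  qed (use i[OF x] i[OF y] in auto)
  finally show ?thesis by (simp add: R.prob_space)
qed

definition generator :: "('e \<Rightarrow> real) \<Rightarrow> 'e \<Rightarrow> real" where
  "generator f x = \<Lambda> * (jump_mean f x - f x)"

lemma generator_diff_le:
  assumes f[measurable]: "f \<in> borel_measurable N" and fb: "\<And>y. y \<in> space N \<Longrightarrow> \<bar>f y\<bar> \<le> (C::real)"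
    and g[measurable]: "g \<in> borel_measurable N" and gb: "\<And>y. y \<in> space N \<Longrightarrow> \<bar>g y\<bar> \<le> (C'::real)"
    and d: "\<And>y. y \<in> space N \<Longrightarrow> \<bar>f y - g y\<bar> \<le> \<delta>" and x[measurable]: "x \<in> space N"
  shows "\<bar>generator f x - generator g x\<bar> \<le> 2 * \<Lambda> * \<delta>"
proof -
  have i: "integrable R (\<lambda>u. f (step x u))" "integrable R (\<lambda>u. g (step x u))"
    by (rule R.integrable_const_bound[where B=C], use x in \<open>auto intro!: AE_I2 fb space_step\<close>,
        rule R.integrable_const_bound[where B=C'], use x in \<open>auto intro!: AE_I2 gb space_step\<close>)
  have "\<bar>jump_mean f x - jump_mean g x\<bar> = \<bar>\<integral>u. f (step x u) - g (step x u) \<partial>R\<bar>"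
    unfolding jump_mean_def using Bochner_Integration.integral_diff[OF i] by simp
  also have "\<dots> \<le> (\<integral>u. \<bar>f (step x u) - g (step x u)\<bar> \<partial>R)" by (rule integral_abs_bound)
  also have "\<dots> \<le> (\<integral>u. \<delta> \<partial>R)"
    by (rule integral_mono) (use i x in \<open>auto intro!: d space_step\<close>)
  finally have "\<bar>jump_mean f x - jump_mean g x\<bar> \<le> \<delta>" by (simp add: R.prob_space)
  then have "\<bar>(jump_mean f x - jump_mean g x) - (f x - g x)\<bar> \<le> 2 * \<delta>" using d[OF x] by linarith
  then have "\<Lambda> * \<bar>(jump_mean f x - jump_mean g x) - (f x - g x)\<bar> \<le> \<Lambda> * (2 * \<delta>)"
    using rate_pos by (intro mult_left_mono) auto
  moreover have "generator f x - generator g x = \<Lambda> * ((jump_mean f x - jump_mean g x) - (f x - g x))"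
    by (simp add: generator_def algebra_simps)
  ultimately show ?thesis using rate_pos by (simp add: abs_mult mult_ac)
qed

lemma generator_le:
  assumes f: "f \<in> borel_measurable N" and fb: "\<And>y. y \<in> space N \<Longrightarrow> \<bar>f y\<bar> \<le> (C::real)" and x: "x \<in> space N"
  shows "\<bar>generator f x\<bar> \<le> 2 * \<Lambda> * C"
  using generator_diff_le[OF f fb, of "\<lambda>_. 0" 0 C x] fb x by (simp add: generator_def jump_mean_def)

lemma expect_lipschitz:
  assumes f: "f \<in> borel_measurable N" and fb: "\<And>y. y \<in> space N \<Longrightarrow> \<bar>f y\<bar> \<le> (C::real)" and x: "x \<in> space N"
    and r: "0 \<le> r" and d: "0 \<le> d" "d \<le> 1"
  shows "\<bar>expect (r + d) f x - expect r f x\<bar> \<le> (2 * \<Lambda> * C + 3 * C * \<Lambda>\<^sup>2) * d"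
proof -
  have C0: "0 \<le> C" using fb[OF x] by linarith
  have fb': "\<bar>expect r f y\<bar> \<le> C" if "y \<in> space N" for y by (rule expect_bound[OF f fb that])
  have eq: "expect (r + d) f x = expect d (expect r f) x"
    using expect_add[OF f fb x d(1) r] by (simp add: add.commute)
  have "\<bar>expect d (expect r f) x - expect r f x - d * generator (expect r f) x\<bar> \<le> 3 * C * (\<Lambda> * d)\<^sup>2"
    unfolding generator_def by (rule expect_expansion[OF measurable_expect[OF f] fb' x d(1)])
  moreover have "\<bar>d * generator (expect r f) x\<bar> \<le> d * (2 * \<Lambda> * C)"
    using generator_le[OF measurable_expect[OF f] fb' x] d by (simp add: abs_mult mult_left_mono)
  moreover have "3 * C * (\<Lambda> * d)\<^sup>2 \<le> 3 * C * \<Lambda>\<^sup>2 * d"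
  proof -
    have "d * d \<le> d" using d by (simp add: mult_left_le)
    then have "3 * C * \<Lambda>\<^sup>2 * (d * d) \<le> 3 * C * \<Lambda>\<^sup>2 * d" using C0 by (intro mult_left_mono) auto
    then show ?thesis by (simp add: power_mult_distrib power2_eq_square mult_ac)
  qed
  ultimately show ?thesis unfolding eq by (simp add: algebra_simps)
qed

text \<open>
  The semigroup property moves the expansion at 0 to any time.  For \<open>r < t\<close> the expansion is taken at
  \<open>r\<close>, and the Lipschitz bound replaces the generator at \<open>r\<close> by the one at \<open>t\<close>.
\<close>

lemma expect_deriv:
  assumes f: "f \<in> borel_measurable N" and fb: "\<And>y. y \<in> space N \<Longrightarrow> \<bar>f y\<bar> \<le> (C::real)"
  shows "\<exists>M\<ge>0. \<forall>t\<ge>0. \<forall>r\<ge>0. \<forall>x\<in>space N. \<bar>r - t\<bar> \<le> 1 \<longrightarrow>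
    (r \<noteq> t \<longrightarrow> \<bar>(expect r f x - expect t f x) / (r - t) - generator (expect t f) x\<bar> \<le> M * \<bar>r - t\<bar>) \<and>
    \<bar>generator (expect r f) x - generator (expect t f) x\<bar> \<le> M * \<bar>r - t\<bar>"
proof (cases "space N = {}")
  case True
  then show ?thesis by (intro exI[of _ 0]) auto
next
  case False
  then have C0: "0 \<le> C" using fb by fastforce
  define L where "L = 2 * \<Lambda> * C + 3 * C * \<Lambda>\<^sup>2"
  have L0: "0 \<le> L" using C0 rate_pos by (simp add: L_def)
  define M where "M = 3 * C * \<Lambda>\<^sup>2 + 2 * \<Lambda> * L"
  have M0: "0 \<le> M" "2 * \<Lambda> * L \<le> M" "3 * C * \<Lambda>\<^sup>2 \<le> M" using C0 rate_pos L0 by (auto simp: M_def)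
  have em: "expect t f \<in> borel_measurable N" for t by (rule measurable_expect[OF f])
  have eb: "\<bar>expect t f y\<bar> \<le> C" if "y \<in> space N" for t y by (rule expect_bound[OF f fb that])
  have lip1: "\<bar>expect r f y - expect t f y\<bar> \<le> L * (r - t)" if "0 \<le> t" "t \<le> r" "r - t \<le> 1" "y \<in> space N" for r t y
    using expect_lipschitz[OF f fb that(4,1), of "r - t"] that by (simp add: L_def)
  have lip: "\<bar>expect r f y - expect t f y\<bar> \<le> L * \<bar>r - t\<bar>" if "0 \<le> t" "0 \<le> r" "\<bar>r - t\<bar> \<le> 1" "y \<in> space N" for r t y
    using lip1[of t r y] lip1[of r t y] that by (cases "t \<le> r") (auto simp: abs_minus_commute)
  have gen: "\<bar>generator (expect r f) x - generator (expect t f) x\<bar> \<le> 2 * \<Lambda> * L * \<bar>r - t\<bar>"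
    if "0 \<le> t" "0 \<le> r" "\<bar>r - t\<bar> \<le> 1" "x \<in> space N" for r t x
  proof -
    have "\<bar>generator (expect r f) x - generator (expect t f) x\<bar> \<le> 2 * \<Lambda> * (L * \<bar>r - t\<bar>)"
      by (rule generator_diff_le[OF em eb em eb lip that(4)]) (use that in auto)
    then show ?thesis by (simp add: mult.assoc)
  qed
  have exp: "\<bar>expect r f x - expect t f x - (r - t) * generator (expect t f) x\<bar> \<le> 3 * C * \<Lambda>\<^sup>2 * (r - t)\<^sup>2"
    if "0 \<le> t" "t \<le> r" "x \<in> space N" for r t x
  proof -
    have "expect r f x = expect (r - t) (expect t f) x"
      using expect_add[OF f fb that(3), of "r - t" t] that by simp
    then show ?thesis
      using expect_expansion[OF em eb that(3), of "r - t" t] that by (simp add: generator_def power_mult_distrib mult.assoc)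
  qed
  have quot: "\<bar>(expect r f x - expect t f x) / (r - t) - generator (expect t f) x\<bar> \<le> M * \<bar>r - t\<bar>"
    if t: "0 \<le> t" and r: "0 \<le> r" and rt: "\<bar>r - t\<bar> \<le> 1" "r \<noteq> t" and x: "x \<in> space N" for r t x
  proof -
    have div: "\<bar>y / e - c\<bar> \<le> b" if "e > 0" "\<bar>y - e * c\<bar> \<le> b * e" for y e c b :: real
    proof -
      have "y / e - c = (y - e * c) / e" using that by (simp add: field_simps)
      then show ?thesis using that by (simp add: abs_divide divide_le_eq)
    qed
    show ?thesis
    proof (cases "t < r")
      case True
      have "\<bar>(expect r f x - expect t f x) / (r - t) - generator (expect t f) x\<bar> \<le> 3 * C * \<Lambda>\<^sup>2 * (r - t)"
        by (rule div) (use exp[of t r x] t True x in \<open>auto simp: power2_eq_square\<close>)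
      also have "\<dots> \<le> M * (r - t)" using M0 True by (intro mult_right_mono) auto
      finally show ?thesis using True by simp
    next
      case False
      then have lt: "r < t" using rt by simp
      have "\<bar>(expect t f x - expect r f x) / (t - r) - generator (expect r f) x\<bar> \<le> 3 * C * \<Lambda>\<^sup>2 * (t - r)"
        by (rule div) (use exp[of r t x] r lt x in \<open>auto simp: power2_eq_square\<close>)
      moreover have "(expect r f x - expect t f x) / (r - t) = (expect t f x - expect r f x) / (t - r)"
        using minus_divide_divide[of "expect t f x - expect r f x" "t - r"] by simp
      moreover have "\<bar>generator (expect r f) x - generator (expect t f) x\<bar> \<le> 2 * \<Lambda> * L * (t - r)"
        using gen[OF t r rt(1) x] lt by simp
      ultimately show ?thesis using lt by (simp add: M_def algebra_simps)
    qed
  qed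
  show ?thesis
  proof (intro exI[of _ M] conjI allI ballI impI M0(1))
    fix t r :: real and x assume *: "0 \<le> t" "0 \<le> r" "x \<in> space N" "\<bar>r - t\<bar> \<le> 1"
    show "\<bar>(expect r f x - expect t f x) / (r - t) - generator (expect t f) x\<bar> \<le> M * \<bar>r - t\<bar>" if "r \<noteq> t"
      by (rule quot) (use * that in auto)
    have "\<bar>generator (expect r f) x - generator (expect t f) x\<bar> \<le> 2 * \<Lambda> * L * \<bar>r - t\<bar>" by (rule gen) (use * in auto)
    also have "\<dots> \<le> M * \<bar>r - t\<bar>" using M0 by (intro mult_right_mono) auto
    finally show "\<bar>generator (expect r f) x - generator (expect t f) x\<bar> \<le> M * \<bar>r - t\<bar>" .
  qed
qed

end

section \<open>Transition laws and paths with values in a topological space\<close>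

lemma space_borel_of [simp]: "space (borel_of T) = topspace T"
  unfolding borel_of_def by (rule space_measure_of) (auto dest: openin_subset)

lemma sets_borel_of: "sets (borel_of T) = sigma_sets (topspace T) {W. openin T W}"
  unfolding borel_of_def by (rule sets_measure_of) (auto dest: openin_subset)

lemma borel_of_open: "openin T W \<Longrightarrow> W \<in> sets (borel_of T)"
  by (auto simp: sets_borel_of)

lemma measurable_borel_ofI:
  assumes "f \<in> space M \<rightarrow> topspace T" "\<And>W. openin T W \<Longrightarrow> f -` W \<inter> space M \<in> sets M"
  shows "f \<in> M \<rightarrow>\<^sub>M borel_of T"
  unfolding borel_of_def
  by (rule measurable_measure_of) (use assms in \<open>auto dest: openin_subset\<close>)

text \<open>
  The process with starting point \<open>start x\<close> instead of \<open>x\<close>.  As the steps preserve the range of the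
  retraction \<open>start\<close>, the laws still satisfy the Chapman-Kolmogorov equation, while at time 0 only the
  fixed points of \<open>start\<close> have a point mass at themselves.
\<close>

locale poisson_maps_from = poisson_maps R "borel_of T" step \<Lambda>
  for R :: "'u measure" and T :: "'e topology" and step \<Lambda> +
  fixes start :: "'e \<Rightarrow> 'e"
  assumes measurable_start [measurable]: "start \<in> borel_of T \<rightarrow>\<^sub>M borel_of T"
    and start_idem: "x \<in> topspace T \<Longrightarrow> start (start x) = start x"
    and start_step: "x \<in> topspace T \<Longrightarrow> start x = x \<Longrightarrow> u \<in> space R \<Longrightarrow> start (step x u) = step x u"
begin

abbreviation "N \<equiv> borel_of T"

definition law :: "real \<Rightarrow> 'e \<Rightarrow> 'e measure" where
  "law t x = distr noise N (position t (start x))"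

lemma sets_law [simp, measurable_cong]: "sets (law t x) = sets N" and space_law [simp]: "space (law t x) = topspace T"
  by (simp_all add: law_def)

lemma space_start: "x \<in> topspace T \<Longrightarrow> start x \<in> topspace T"
  using measurable_space[OF measurable_start, of x] by simp

lemma measurable_position_at: "x \<in> topspace T \<Longrightarrow> position t x \<in> noise \<rightarrow>\<^sub>M N"
proof -
  assume "x \<in> topspace T"
  then have [measurable]: "x \<in> space N" by simp
  show ?thesis by measurable
qed

lemma prob_space_law: "x \<in> topspace T \<Longrightarrow> prob_space (law t x)"
  unfolding law_def by (rule noise.prob_space_distr) (simp add: measurable_position_at space_start)

lemma start_position:
  assumes "x \<in> topspace T" "start x = x" "\<omega> \<in> space noise"
  shows "start (position t x \<omega>) = position t x \<omega>"
proof -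
  have "start (chain step n x \<omega>) = chain step n x \<omega>" if "x \<in> topspace T" "start x = x" "\<omega> \<in> space noise" for n x \<omega>
    using that
  proof (induction n arbitrary: x \<omega>)
    case (Suc n)
    have "\<omega> \<in> streams (UNIV \<times> space R)"
      using Suc.prems(3) sets_eq_imp_space_eq[OF sets_noise] by (simp add: space_stream_space space_pair_measure)
    then obtain \<tau> u \<omega>' where \<omega>: "\<omega> = (\<tau>, u) ## \<omega>'" "u \<in> space R" "\<omega>' \<in> streams (UNIV \<times> space R)"
      by (cases \<omega>) (auto simp: streams_Stream)
    then have \<omega>': "\<omega>' \<in> space noise"
      using sets_eq_imp_space_eq[OF sets_noise] by (simp add: space_stream_space space_pair_measure)
    show ?case
      using Suc.IH[of "step x u" \<omega>'] Suc.prems \<omega> \<omega>' space_step[of x u] start_step[of x u] by simp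
  qed simp
  with assms show ?thesis by (simp add: position_def)
qed

lemma measurable_law: "law t \<in> N \<rightarrow>\<^sub>M prob_algebra N"
proof -
  have c: "(\<lambda>x. noise) \<in> N \<rightarrow>\<^sub>M prob_algebra noise"
    by (rule measurable_const) (simp add: space_prob_algebra noise.prob_space_axioms)
  have "(\<lambda>x. distr noise N (\<lambda>\<omega>. position t (start x) \<omega>)) \<in> N \<rightarrow>\<^sub>M prob_algebra N"
    by (rule measurable_distr_prob_space2[OF c]) measurable
  then show ?thesis by (simp add: law_def[abs_def])
qed

lemma emeasure_law:
  assumes x: "x \<in> topspace T" and B[measurable]: "B \<in> sets N"
  shows "emeasure (law t x) B = (\<integral>\<^sup>+\<omega>. indicator B (position t (start x) \<omega>) \<partial>noise)"
  using nn_integral_distr[OF measurable_position_at[OF space_start[OF x]], of "indicator B" t]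
  by (simp add: law_def)

lemma law_0:
  assumes x: "x \<in> topspace T" "start x = x"
  shows "law 0 x = return N x"
proof (rule measure_eqI)
  fix B assume "B \<in> sets (law 0 x)"
  then have B[measurable]: "B \<in> sets N" by simp
  have "emeasure (law 0 x) B = (\<integral>\<^sup>+\<omega>. indicator B (position 0 x \<omega>) \<partial>noise)" by (simp add: emeasure_law x)
  also have "\<dots> = (\<integral>\<^sup>+\<omega>. indicator B x \<partial>noise)"
    by (rule nn_integral_cong_AE, use AE_position_0[of x] in eventually_elim) simp
  finally show "emeasure (law 0 x) B = emeasure (return N x) B"
    by (simp add: noise.emeasure_space_1)
qed simp

lemma Chapman_Kolmogorov:
  assumes x: "x \<in> topspace T" and r: "0 \<le> r" and t: "0 \<le> t" and B[measurable]: "B \<in> sets N"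
  shows "emeasure (law (r + t) x) B = (\<integral>\<^sup>+y. emeasure (law t y) B \<partial>law r x)"
proof -
  have [measurable]: "position r (start x) \<in> noise \<rightarrow>\<^sub>M N" by (simp add: measurable_position_at space_start x)
  have [measurable]: "(\<lambda>y. emeasure (law t y) B) \<in> borel_measurable N"
    by (rule measurable_compose[OF measurable_prob_algebraD[OF measurable_law] measurable_emeasure_subprob_algebra]) simp
  have s: "start x \<in> space N" by (simp add: space_start x)
  have "emeasure (law (r + t) x) B = (\<integral>\<^sup>+\<omega>. indicator B (position (r + t) (start x) \<omega>) \<partial>noise)"
    by (simp add: emeasure_law x)
  also have "\<dots> = (\<integral>\<^sup>+\<omega>. (\<integral>\<^sup>+\<omega>'. indicator B (position t (position r (start x) \<omega>) \<omega>') \<partial>noise) \<partial>noise)"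
    using nn_integral_position_Markov[of "indicator B" t "start x" r "[]"] s r t by (simp add: visits_def)
  also have "\<dots> = (\<integral>\<^sup>+\<omega>. emeasure (law t (position r (start x) \<omega>)) B \<partial>noise)"
  proof (rule nn_integral_cong)
    fix \<omega> assume \<omega>: "\<omega> \<in> space noise"
    show "(\<integral>\<^sup>+\<omega>'. indicator B (position t (position r (start x) \<omega>) \<omega>') \<partial>noise) = emeasure (law t (position r (start x) \<omega>)) B"
      using emeasure_law[of "position r (start x) \<omega>" B t] space_position[OF s \<omega>, of r]
        start_position[OF _ start_idem[OF x] \<omega>, of r] s by simp
  qed
  also have "\<dots> = (\<integral>\<^sup>+y. emeasure (law t y) B \<partial>law r x)"
    unfolding law_def[of r] by (subst nn_integral_distr) auto
  finally show ?thesis .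
qed

lemma transition_function_law:
  assumes "\<And>x. x \<in> E \<Longrightarrow> x \<in> topspace T \<and> start x = x"
  shows "transition_function T E law"
  unfolding transition_function_def
  using measurable_law law_0 Chapman_Kolmogorov assms by blast

definition jump_paths :: "(real \<Rightarrow> 'e) set" where
  "jump_paths = {w. (\<forall>t\<ge>0. w t \<in> topspace T \<and> limitin T w (w t) (at_right t)) \<and> (\<forall>t>0. \<exists>l. limitin T w l (at_left t))}"

definition path_space :: "(real \<Rightarrow> 'e) measure" where
  "path_space = sigma jump_paths {{w \<in> jump_paths. w t \<in> B} | t B. 0 \<le> t \<and> B \<in> sets N}"

text \<open>
  On the null set of explosions the path is replaced by a constant one, so that every realisation has
  one-sided limits.
\<close>

definition path :: "'e \<Rightarrow> (real \<times> 'u) stream \<Rightarrow> real \<Rightarrow> 'e" where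
  "path x \<omega> = (if nonexplosive \<omega> then (\<lambda>t. position t (start x) \<omega>) else (\<lambda>t. start x))"

definition path_law :: "'e \<Rightarrow> (real \<Rightarrow> 'e) measure" where
  "path_law x = distr noise path_space (path x)"

lemma limitin_eventually_eq:
  assumes "l \<in> topspace T" "eventually (\<lambda>s. w s = l) F"
  shows "limitin T w l F"
  unfolding limitin_def using assms by (auto elim!: eventually_mono)

lemma path_in_jump_paths:
  assumes x: "x \<in> topspace T" and \<omega>: "\<omega> \<in> space noise"
  shows "path x \<omega> \<in> jump_paths"
proof -
  have s: "start x \<in> topspace T" by (simp add: space_start x)
  show ?thesis
  proof (cases "nonexplosive \<omega>")
    case False
    then show ?thesis using s by (auto simp: path_def jump_paths_def intro!: exI[of _ "start x"])
  next
    case True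
    have pos: "position t (start x) \<omega> \<in> topspace T" for t using space_position[of "start x" \<omega> t] s \<omega> by simp
    have eq: "position u (start x) \<omega> = position v (start x) \<omega>" if "jumps n u \<omega>" "jumps n v \<omega>" for u v n
      using that by (simp add: position_def jump_count_eq)
    have right: "limitin T (\<lambda>t. position t (start x) \<omega>) (position t (start x) \<omega>) (at_right t)" for t
    proof (rule limitin_eventually_eq[OF pos])
      have j: "jumps (jump_count t \<omega>) t \<omega>" by (rule nonexplosive_jumps[OF True])
      from jumps_right_constant[OF this] obtain d where d: "d > 0"
        "\<And>s. t \<le> s \<Longrightarrow> s < t + d \<Longrightarrow> jumps (jump_count t \<omega>) s \<omega>" by blast
      have "eventually (\<lambda>s. s \<in> {t<..<t + d}) (at_right t)"
        using d(1) by (intro eventually_at_right_real) simp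
      then show "\<forall>\<^sub>F s in at_right t. position s (start x) \<omega> = position t (start x) \<omega>"
        by eventually_elim (rule eq[OF d(2) j], auto)
    qed
    have left: "\<exists>l. limitin T (\<lambda>t. position t (start x) \<omega>) l (at_left t)" if "t > 0" for t
    proof -
      from jumps_left_constant[OF nonexplosive_jumps[OF True] that] obtain m d where d: "d > 0"
        "\<And>s. t - d < s \<Longrightarrow> s < t \<Longrightarrow> jumps m s \<omega>" by blast
      have m: "jumps m (t - d / 2) \<omega>" using d by auto
      have "limitin T (\<lambda>t. position t (start x) \<omega>) (position (t - d / 2) (start x) \<omega>) (at_left t)"
      proof (rule limitin_eventually_eq[OF pos])
        have "eventually (\<lambda>s. s \<in> {t - d<..<t}) (at_left t)"
          using d(1) by (intro eventually_at_left_real) simp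
        then show "\<forall>\<^sub>F s in at_left t. position s (start x) \<omega> = position (t - d / 2) (start x) \<omega>"
          by eventually_elim (rule eq[OF d(2) m], auto)
      qed
      then show ?thesis by blast
    qed
    show ?thesis using True pos right left by (simp add: path_def jump_paths_def)
  qed
qed

lemma path_space_generators:
  "{{w \<in> jump_paths. w t \<in> B} | t B. 0 \<le> t \<and> B \<in> sets N} \<subseteq> Pow jump_paths"
  by auto

lemma space_path_space [simp]: "space path_space = jump_paths"
  unfolding path_space_def by (rule space_measure_of[OF path_space_generators])

lemma sets_path_space:
  "sets path_space = sigma_sets jump_paths {{w \<in> jump_paths. w t \<in> B} | t B. 0 \<le> t \<and> B \<in> sets N}"
  unfolding path_space_def by (rule sets_measure_of[OF path_space_generators])

lemma measurable_coordinate: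
  assumes "0 \<le> t" shows "(\<lambda>w. w t) \<in> path_space \<rightarrow>\<^sub>M N"
proof (rule measurableI)
  fix w assume "w \<in> space path_space"
  then show "w t \<in> space N" using assms by (simp add: jump_paths_def)
next
  fix B assume "B \<in> sets N"
  then have "{w \<in> jump_paths. w t \<in> B} \<in> sets path_space"
    unfolding sets_path_space using assms by (intro sigma_sets.Basic) auto
  moreover have "(\<lambda>w. w t) -` B \<inter> space path_space = {w \<in> jump_paths. w t \<in> B}" by auto
  ultimately show "(\<lambda>w. w t) -` B \<inter> space path_space \<in> sets path_space" by simp
qed

lemma measurable_path:
  assumes x: "x \<in> topspace T" shows "path x \<in> noise \<rightarrow>\<^sub>M path_space"
  unfolding path_space_def
proof (rule measurable_measure_of[OF path_space_generators])
  show "path x \<in> space noise \<rightarrow> jump_paths" using path_in_jump_paths[OF x] by blast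
  fix A assume "A \<in> {{w \<in> jump_paths. w t \<in> B} | t B. 0 \<le> t \<and> B \<in> sets N}"
  then obtain t B where A: "A = {w \<in> jump_paths. w t \<in> B}" and B[measurable]: "B \<in> sets N" by blast
  have [measurable]: "position t (start x) \<in> noise \<rightarrow>\<^sub>M N" by (simp add: measurable_position_at space_start x)
  have "path x -` A \<inter> space noise = {\<omega> \<in> space noise. if nonexplosive \<omega> then position t (start x) \<omega> \<in> B else start x \<in> B}"
  proof -
    have "path x \<omega> \<in> A \<longleftrightarrow> (if nonexplosive \<omega> then position t (start x) \<omega> \<in> B else start x \<in> B)"
      if "\<omega> \<in> space noise" for \<omega>
      using path_in_jump_paths[OF x that] by (simp add: A path_def split: if_splits)
    then show ?thesis by blast
  qed
  also have "\<dots> \<in> sets noise" by measurable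
  finally show "path x -` A \<inter> space noise \<in> sets noise" .
qed

lemma prob_space_path_law: "x \<in> topspace T \<Longrightarrow> prob_space (path_law x)"
  unfolding path_law_def by (rule noise.prob_space_distr[OF measurable_path])

lemma sets_path_law [simp]: "sets (path_law x) = sets path_space"
  and space_path_law [simp]: "space (path_law x) = jump_paths"
  by (simp_all add: path_law_def)

lemma distr_path_law:
  assumes x: "x \<in> topspace T" and t: "0 \<le> t"
  shows "distr (path_law x) N (\<lambda>w. w t) = law t x"
proof -
  have "distr (path_law x) N (\<lambda>w. w t) = distr noise N (\<lambda>\<omega>. path x \<omega> t)"
    unfolding path_law_def by (subst distr_distr[OF measurable_coordinate[OF t] measurable_path[OF x]]) (simp add: comp_def)
  also have "\<dots> = law t x"
    unfolding law_def
  proof (rule distr_cong_AE)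
    show "AE \<omega> in noise. path x \<omega> t = position t (start x) \<omega>"
      using AE_noise_nonexplosive by eventually_elim (simp add: path_def)
    show "(\<lambda>\<omega>. path x \<omega> t) \<in> noise \<rightarrow>\<^sub>M N"
      using measurable_compose[OF measurable_path[OF x] measurable_coordinate[OF t]] .
  qed (simp_all add: measurable_position_at space_start x)
  finally show ?thesis .
qed

definition cylinder :: "(real \<times> 'e set) list \<Rightarrow> (real \<Rightarrow> 'e) set" where
  "cylinder l = {w \<in> jump_paths. \<forall>p\<in>set l. w (fst p) \<in> snd p}"

abbreviation past :: "real \<Rightarrow> (real \<Rightarrow> 'e) measure" where
  "past r \<equiv> natural_filtration path_space N (\<lambda>t w. w t) r"

lemma cylinder_path_space:
  assumes "\<And>u B. (u, B) \<in> set l \<Longrightarrow> 0 \<le> u \<and> B \<in> sets N"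
  shows "cylinder l \<in> sets path_space"
  using assms
proof (induction l)
  case Nil
  then show ?case using sets.top[of path_space] by (simp add: cylinder_def)
next
  case (Cons p l)
  have p: "0 \<le> fst p" "snd p \<in> sets N" using Cons.prems[of "fst p" "snd p"] by auto
  have "(\<lambda>w. w (fst p)) -` snd p \<inter> space path_space \<in> sets path_space"
    by (rule measurable_sets[OF measurable_coordinate]) (use p in auto)
  moreover have "cylinder l \<in> sets path_space" using Cons by auto
  moreover have "cylinder (p # l) = ((\<lambda>w. w (fst p)) -` snd p \<inter> space path_space) \<inter> cylinder l"
    by (auto simp: cylinder_def)
  ultimately show ?case by auto
qed

lemma nn_integral_path_law_cylinder:
  assumes x: "x \<in> topspace T" and t: "0 \<le> t" and [measurable]: "g \<in> borel_measurable N"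
    and l: "\<And>u B. (u, B) \<in> set l \<Longrightarrow> 0 \<le> u \<and> B \<in> sets N"
  shows "(\<integral>\<^sup>+w. g (w t) * indicator (cylinder l) w \<partial>path_law x) =
    (\<integral>\<^sup>+\<omega>. (if visits l (start x) \<omega> then g (position t (start x) \<omega>) else 0) \<partial>noise)"
proof -
  note [measurable] = measurable_coordinate[OF t] cylinder_path_space[OF l] measurable_path[OF x]
  have "(\<integral>\<^sup>+w. g (w t) * indicator (cylinder l) w \<partial>path_law x) =
     (\<integral>\<^sup>+\<omega>. g (path x \<omega> t) * indicator (cylinder l) (path x \<omega>) \<partial>noise)"
    unfolding path_law_def by (rule nn_integral_distr) measurable
  also have "\<dots> = (\<integral>\<^sup>+\<omega>. (if visits l (start x) \<omega> then g (position t (start x) \<omega>) else 0) \<partial>noise)"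
  proof (rule nn_integral_cong_AE, use AE_noise_nonexplosive AE_space in eventually_elim)
    case (elim \<omega>)
    then have "path x \<omega> \<in> cylinder l \<longleftrightarrow> visits l (start x) \<omega>"
      using path_in_jump_paths[OF x elim(2)] by (simp add: cylinder_def visits_def path_def split_beta)
    then show ?case using elim by (simp add: path_def indicator_def)
  qed
  finally show ?thesis .
qed

lemma nn_integral_Markov_cylinder:
  assumes x: "x \<in> topspace T" and r: "0 \<le> r" and t: "0 \<le> t" and B[measurable]: "B \<in> sets N"
    and l: "\<And>u B. (u, B) \<in> set l \<Longrightarrow> 0 \<le> u \<and> u \<le> r \<and> B \<in> sets N"
  shows "(\<integral>\<^sup>+w. indicator B (w (r + t)) * indicator (cylinder l) w \<partial>path_law x) =
    (\<integral>\<^sup>+w. emeasure (law t (w r)) B * indicator (cylinder l) w \<partial>path_law x)"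
proof -
  \<comment> \<open>a cylinder does not depend on the order of its times\<close>
  define l' where "l' = sort_key fst l"
  have set_l': "set l' = set l" by (simp add: l'_def)
  have cyl: "cylinder l = cylinder l'" by (simp add: cylinder_def set_l')
  have l': "\<And>u B. (u, B) \<in> set l' \<Longrightarrow> 0 \<le> u \<and> u \<le> r \<and> B \<in> sets N" using l by (simp add: set_l')
  then have l'': "\<And>u B. (u, B) \<in> set l' \<Longrightarrow> 0 \<le> u \<and> B \<in> sets N" by blast
  have s: "start x \<in> space N" by (simp add: space_start x)
  have [measurable]: "(\<lambda>y. emeasure (law t y) B) \<in> borel_measurable N"
    by (rule measurable_compose[OF measurable_prob_algebraD[OF measurable_law] measurable_emeasure_subprob_algebra]) simp
  have "(\<integral>\<^sup>+w. indicator B (w (r + t)) * indicator (cylinder l) w \<partial>path_law x) =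
     (\<integral>\<^sup>+\<omega>. (if visits l' (start x) \<omega> then indicator B (position (r + t) (start x) \<omega>) else 0) \<partial>noise)"
    unfolding cyl by (rule nn_integral_path_law_cylinder[OF x _ _ l'']) (use r t in auto)
  also have "\<dots> = (\<integral>\<^sup>+\<omega>. (if visits l' (start x) \<omega> then
      \<integral>\<^sup>+\<omega>'. indicator B (position t (position r (start x) \<omega>) \<omega>') \<partial>noise else 0) \<partial>noise)"
    by (rule nn_integral_position_Markov[OF _ t s r _ l']) (auto simp: l'_def)
  also have "\<dots> = (\<integral>\<^sup>+\<omega>. (if visits l' (start x) \<omega> then emeasure (law t (position r (start x) \<omega>)) B else 0) \<partial>noise)"
  proof (rule nn_integral_cong)
    fix \<omega> assume \<omega>: "\<omega> \<in> space noise"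
    have "(\<integral>\<^sup>+\<omega>'. indicator B (position t (position r (start x) \<omega>) \<omega>') \<partial>noise) = emeasure (law t (position r (start x) \<omega>)) B"
      using emeasure_law[of "position r (start x) \<omega>" B t] space_position[OF s \<omega>, of r]
        start_position[OF _ start_idem[OF x] \<omega>, of r] s by simp
    then show "(if visits l' (start x) \<omega> then \<integral>\<^sup>+\<omega>'. indicator B (position t (position r (start x) \<omega>) \<omega>') \<partial>noise else 0)
      = (if visits l' (start x) \<omega> then emeasure (law t (position r (start x) \<omega>)) B else 0)" by (simp only:)
  qed
  also have "\<dots> = (\<integral>\<^sup>+w. emeasure (law t (w r)) B * indicator (cylinder l) w \<partial>path_law x)"
    unfolding cyl by (rule nn_integral_path_law_cylinder[OF x r _ l'', symmetric]) auto
  finally show ?thesis .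
qed

lemma sets_natural_filtration:
  assumes "0 \<le> r"
  shows "sets (past r) =
    sigma_sets jump_paths {cylinder l | l. \<forall>(u, B)\<in>set l. 0 \<le> u \<and> u \<le> r \<and> B \<in> sets N}" (is "_ = sigma_sets _ ?G")
    and "space (past r) = jump_paths"
proof -
  let ?H = "{(\<lambda>w. w u) -` B \<inter> space path_space | u B. 0 \<le> u \<and> u \<le> r \<and> B \<in> sets N}"
  have sub: "?H \<subseteq> Pow jump_paths" by auto
  show sp: "space (past r) = jump_paths"
    unfolding natural_filtration_def using sub by (simp add: space_measure_of)
  have H: "sets (past r) = sigma_sets jump_paths ?H"
    unfolding natural_filtration_def using sub by (simp add: sets_measure_of)
  show "sets (past r) = sigma_sets jump_paths ?G"
    unfolding H
  proof (rule sigma_sets_eqI)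
    fix A assume "A \<in> ?H"
    then obtain u B where "A = (\<lambda>w. w u) -` B \<inter> space path_space" "0 \<le> u" "u \<le> r" "B \<in> sets N" by blast
    then have "A = cylinder [(u, B)]" "\<forall>(u, B)\<in>set [(u, B)]. 0 \<le> u \<and> u \<le> r \<and> B \<in> sets N"
      by (auto simp: cylinder_def)
    then show "A \<in> sigma_sets jump_paths ?G" by (intro sigma_sets.Basic) blast
  next
    fix A assume "A \<in> ?G"
    then obtain l where A: "A = cylinder l" "\<forall>(u, B)\<in>set l. 0 \<le> u \<and> u \<le> r \<and> B \<in> sets N" by blast
    have "cylinder l \<in> sets (past r)" using A(2)
    proof (induction l)
      case Nil
      have "cylinder [] = jump_paths" by (simp add: cylinder_def)
      then show ?case using sets.top[of "past r"] by (simp only: sp)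
    next
      case (Cons p l)
      have "0 \<le> fst p" "fst p \<le> r" "snd p \<in> sets N" using Cons.prems by (auto simp: split_beta)
      then have "(\<lambda>w. w (fst p)) -` snd p \<inter> space path_space \<in> ?H" by blast
      then have "(\<lambda>w. w (fst p)) -` snd p \<inter> space path_space \<in> sets (past r)"
        unfolding H by (rule sigma_sets.Basic)
      moreover have "cylinder l \<in> sets (past r)"
        by (rule Cons.IH) (use Cons.prems in simp)
      moreover have "cylinder (p # l) = ((\<lambda>w. w (fst p)) -` snd p \<inter> space path_space) \<inter> cylinder l"
        by (auto simp: cylinder_def)
      ultimately show ?case by (simp only: sets.Int)
    qed
    then show "A \<in> sigma_sets jump_paths ?H" unfolding A(1) H .
  qed
qed

text \<open>
  Both sides have the same integral over every cylinder in the past, and these form an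
  intersection-stable generator of the past.
\<close>

lemma Markov_property:
  assumes x: "x \<in> topspace T" and r: "0 \<le> r" and t: "0 \<le> t" and B[measurable]: "B \<in> sets N"
  shows "AE w in path_law x. real_cond_exp (path_law x) (past r)
      (\<lambda>w'. indicator B (w' (r + t))) w = measure (law t (w r)) B"
proof -
  let ?M = "path_law x" and ?F = "past r"
  let ?G = "{cylinder l | l. \<forall>(u, B)\<in>set l. 0 \<le> u \<and> u \<le> r \<and> B \<in> sets N}"
  interpret M: prob_space ?M by (rule prob_space_path_law[OF x])
  have G_sets: "?G \<subseteq> sets path_space" by (auto intro!: cylinder_path_space)
  have F_sub: "sets ?F \<subseteq> sets path_space"
    unfolding sets_natural_filtration(1)[OF r] using sets.sigma_sets_subset[OF G_sets] by simp
  have "subalgebra ?M ?F"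
    unfolding subalgebra_def using F_sub sets_natural_filtration(2)[OF r] by simp
  then have "finite_measure_subalgebra ?M ?F"
    unfolding finite_measure_subalgebra_def finite_measure_subalgebra_axioms_def using M.finite_measure_axioms by simp
  then interpret sigma_finite_subalgebra ?M ?F by (rule finite_measure_subalgebra_is_sigma_finite)
  have rt: "0 \<le> r + t" using r t by simp
  note [measurable] = measurable_coordinate[OF rt] measurable_coordinate[OF r]
  have law_m[measurable]: "(\<lambda>y. measure (law t y) B) \<in> borel_measurable N"
    by (rule measurable_compose[OF measurable_prob_algebraD[OF measurable_law] measurable_measure_subprob_algebra]) simp
  have law_e[measurable]: "(\<lambda>y. emeasure (law t y) B) \<in> borel_measurable N"
    by (rule measurable_compose[OF measurable_prob_algebraD[OF measurable_law] measurable_emeasure_subprob_algebra]) simp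
  have Xr: "(\<lambda>w. w r) \<in> ?F \<rightarrow>\<^sub>M N"
  proof (rule measurableI)
    fix w assume "w \<in> space ?F"
    then show "w r \<in> space N" using r sets_natural_filtration(2)[OF r] by (simp add: jump_paths_def)
  next
    fix C assume C: "C \<in> sets N"
    have "(\<lambda>w. w r) -` C \<inter> space ?F = cylinder [(r, C)]"
      using sets_natural_filtration(2)[OF r] by (auto simp: cylinder_def)
    moreover have "cylinder [(r, C)] \<in> ?G" using C r by (intro CollectI exI[of _ "[(r, C)]"]) simp
    ultimately show "(\<lambda>w. w r) -` C \<inter> space ?F \<in> sets ?F"
      unfolding sets_natural_filtration(1)[OF r] by (auto intro: sigma_sets.Basic)
  qed
  define f :: "(real \<Rightarrow> 'e) \<Rightarrow> real" where "f w = indicator B (w (r + t))" for w :: "real \<Rightarrow> 'e"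
  define g :: "(real \<Rightarrow> 'e) \<Rightarrow> real" where "g w = measure (law t (w r)) B" for w :: "real \<Rightarrow> 'e"
  have fm[measurable]: "f \<in> borel_measurable ?M" unfolding f_def[abs_def] by (simp add: path_law_def)
  have gm[measurable]: "g \<in> borel_measurable ?M" unfolding g_def[abs_def] by (simp add: path_law_def)
  have g01: "0 \<le> g w" "w \<in> space ?M \<Longrightarrow> g w \<le> 1" for w
    using prob_space.prob_le_1[OF prob_space_law, of "w r" t B] r by (auto simp: g_def jump_paths_def)
  have f01: "0 \<le> f w" "f w \<le> 1" for w by (auto simp: f_def)
  have sub: "subalgebra (density ?M f) ?F" "subalgebra (density ?M g) ?F"
    using F_sub sets_natural_filtration(2)[OF r] by (simp_all add: subalgebra_def)
  have GF: "A \<in> sets ?F" if "A \<in> ?G" for A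
    unfolding sets_natural_filtration(1)[OF r] using that by (rule sigma_sets.Basic)
  have top: "cylinder [] = jump_paths" "cylinder [] \<in> ?G" by (auto simp: cylinder_def intro!: exI[of _ "[]"])
  have eqG: "emeasure (density ?M f) A = emeasure (density ?M g) A" if AG: "A \<in> ?G" for A
  proof -
    obtain l where l: "A = cylinder l" "\<forall>(u, B)\<in>set l. 0 \<le> u \<and> u \<le> r \<and> B \<in> sets N" using AG by blast
    have A: "A \<in> sets ?M" using AG G_sets by auto
    have "emeasure (density ?M f) A = (\<integral>\<^sup>+w. ennreal (f w) * indicator A w \<partial>?M)"
      using A by (subst emeasure_density) auto
    also have "\<dots> = (\<integral>\<^sup>+w. indicator B (w (r + t)) * indicator (cylinder l) w \<partial>?M)"
      by (intro nn_integral_cong) (simp add: l(1) f_def ennreal_indicator)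
    also have "\<dots> = (\<integral>\<^sup>+w. emeasure (law t (w r)) B * indicator (cylinder l) w \<partial>?M)"
      by (rule nn_integral_Markov_cylinder[OF x r t B]) (use l(2) in blast)
    also have "\<dots> = (\<integral>\<^sup>+w. ennreal (g w) * indicator A w \<partial>?M)"
    proof (rule nn_integral_cong)
      fix w assume "w \<in> space ?M"
      then interpret L: prob_space "law t (w r)" using r by (intro prob_space_law) (auto simp: jump_paths_def)
      show "emeasure (law t (w r)) B * indicator (cylinder l) w = ennreal (g w) * indicator A w"
        by (simp add: g_def L.emeasure_eq_measure l(1))
    qed
    also have "\<dots> = emeasure (density ?M g) A" using A by (subst emeasure_density) auto
    finally show ?thesis .
  qed
  have "restr_to_subalg (density ?M f) ?F = restr_to_subalg (density ?M g) ?F"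
  proof (rule measure_eqI_generator_eq[where E="?G" and \<Omega>=jump_paths and A="\<lambda>_. cylinder []"])
    show "Int_stable ?G"
    proof (rule Int_stableI)
      fix A B assume "A \<in> ?G" "B \<in> ?G"
      then obtain l k where lk: "A = cylinder l" "B = cylinder k"
        "\<forall>(u, B)\<in>set l. 0 \<le> u \<and> u \<le> r \<and> B \<in> sets N" "\<forall>(u, B)\<in>set k. 0 \<le> u \<and> u \<le> r \<and> B \<in> sets N" by blast
      then have "A \<inter> B = cylinder (l @ k)" "\<forall>(u, B)\<in>set (l @ k). 0 \<le> u \<and> u \<le> r \<and> B \<in> sets N"
        by (auto simp: cylinder_def)
      then show "A \<inter> B \<in> ?G" by blast
    qed
    show "?G \<subseteq> Pow jump_paths" by (auto simp: cylinder_def)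
    show "emeasure (restr_to_subalg (density ?M f) ?F) A = emeasure (restr_to_subalg (density ?M g) ?F) A" if "A \<in> ?G" for A
      using eqG[OF that] GF[OF that] by (simp add: emeasure_restr_to_subalg sub)
    show "sets (restr_to_subalg (density ?M f) ?F) = sigma_sets jump_paths ?G"
      "sets (restr_to_subalg (density ?M g) ?F) = sigma_sets jump_paths ?G"
      by (simp_all only: sets_restr_to_subalg[OF sub(1)] sets_restr_to_subalg[OF sub(2)] sets_natural_filtration(1)[OF r])
    show "range (\<lambda>_. cylinder []) \<subseteq> ?G" "(\<Union>i. cylinder []) = jump_paths" using top by auto
    have "emeasure (density ?M f) jump_paths = (\<integral>\<^sup>+w. ennreal (f w) * indicator jump_paths w \<partial>?M)"
      using sets.top[of ?M] by (subst emeasure_density) auto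
    also have "\<dots> \<le> (\<integral>\<^sup>+w. 1 \<partial>?M)"
      by (rule nn_integral_mono) (use f01 in \<open>auto split: split_indicator\<close>)
    also have "\<dots> = 1" using M.emeasure_space_1 by simp
    finally have "emeasure (density ?M f) (cylinder []) < \<infinity>" by (auto simp: top intro: le_less_trans)
    then show "emeasure (restr_to_subalg (density ?M f) ?F) (cylinder []) \<noteq> \<infinity>"
      using GF[OF top(2)] by (simp add: emeasure_restr_to_subalg sub)
  qed
  then have key: "emeasure (density ?M f) A = emeasure (density ?M g) A" if "A \<in> sets ?F" for A
    using emeasure_restr_to_subalg[OF sub(1) that] emeasure_restr_to_subalg[OF sub(2) that] by simp
  have intf: "integrable ?M f" by (rule M.integrable_const_bound[where B=1]) (use f01 in auto)
  have intg: "integrable ?M g" by (rule M.integrable_const_bound[where B=1]) (use g01 in \<open>auto intro!: AE_I2\<close>)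
  have "AE w in ?M. real_cond_exp ?M ?F f w = g w"
  \<comment> \<open>integrals over the events of the past determine the conditional expectation\<close>
  proof (rule real_cond_exp_charact)
    fix A assume A: "A \<in> sets ?F"
    then have AM[measurable]: "A \<in> sets ?M" using F_sub by auto
    have "(LINT w:A|?M. h w) = measure (density ?M h) A" if [measurable]: "h \<in> borel_measurable ?M" and "\<And>w. 0 \<le> h w" for h
    proof -
      have "(LINT w:A|?M. h w) = (\<integral>w. h w * indicator A w \<partial>?M)"
        by (simp add: set_lebesgue_integral_def mult.commute)
      also have "\<dots> = enn2real (\<integral>\<^sup>+w. ennreal (h w * indicator A w) \<partial>?M)"
        by (rule integral_eq_nn_integral) (use that in auto)
      also have "(\<integral>\<^sup>+w. ennreal (h w * indicator A w) \<partial>?M) = (\<integral>\<^sup>+w. ennreal (h w) * indicator A w \<partial>?M)"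
        using that by (intro nn_integral_cong) (auto simp: ennreal_mult' ennreal_indicator)
      also have "\<dots> = emeasure (density ?M h) A" using AM by (subst emeasure_density) auto
      finally show ?thesis by (simp add: measure_def)
    qed
    then show "(LINT w:A|?M. f w) = (LINT w:A|?M. g w)"
      using key[OF A] f01 g01 by (simp add: measure_def)
    next
    show "g \<in> borel_measurable ?F" unfolding g_def[abs_def] using measurable_compose[OF Xr law_m] .
  qed (rule intf, rule intg)
  then show ?thesis by (simp add: f_def[abs_def] g_def[abs_def])
qed

lemma markov_process_path_law:
  "markov_process T law path_space (\<lambda>t w. w t) path_law"
  unfolding markov_process_def
  using measurable_coordinate prob_space_path_law distr_path_law Markov_property by simp

lemma right_continuous_path_space:
  "right_continuous_with_jumps T path_space (\<lambda>t w. w t)"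
  unfolding right_continuous_with_jumps_def by (simp add: jump_paths_def)

end

section \<open>Linear evolution equations with bounded right-hand side\<close>

text \<open>
  Compactness of an interval, in the form of bisection.
\<close>

lemma locally_bounded_family:
  fixes w :: "real \<Rightarrow> 'b \<Rightarrow> real"
  assumes loc: "\<And>t. 0 \<le> t \<Longrightarrow> \<exists>d>0. \<exists>B. \<forall>r\<ge>0. \<bar>r - t\<bar> < d \<longrightarrow> (\<forall>x\<in>S. \<bar>w r x\<bar> \<le> B)"
  shows "\<exists>B. \<forall>t\<in>{0..b}. \<forall>x\<in>S. \<bar>w t x\<bar> \<le> B"
proof (cases "0 \<le> b")
  case True
  define P where "P u v \<longleftrightarrow> (\<exists>B. \<forall>t\<in>{u..v}. 0 \<le> t \<longrightarrow> (\<forall>x\<in>S. \<bar>w t x\<bar> \<le> B))" for u v :: real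
  have "P 0 b"
    using True
  proof (rule Bolzano)
    fix u v y assume P: "P u v" "P v y" and "u \<le> v" "v \<le> y"
    obtain B1 where B1: "\<And>t x. t \<in> {u..v} \<Longrightarrow> 0 \<le> t \<Longrightarrow> x \<in> S \<Longrightarrow> \<bar>w t x\<bar> \<le> B1" using P(1) unfolding P_def by blast
    obtain B2 where B2: "\<And>t x. t \<in> {v..y} \<Longrightarrow> 0 \<le> t \<Longrightarrow> x \<in> S \<Longrightarrow> \<bar>w t x\<bar> \<le> B2" using P(2) unfolding P_def by blast
    have "\<bar>w t x\<bar> \<le> max B1 B2" if "t \<in> {u..y}" "0 \<le> t" "x \<in> S" for t x
      using B1[of t x] B2[of t x] that by (cases "t \<le> v") auto
    then show "P u y" unfolding P_def by blast
  next
    fix t :: real assume "0 \<le> t" "t \<le> b"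
    from loc[OF this(1)] obtain d B where d: "d > 0" "\<And>r x. 0 \<le> r \<Longrightarrow> \<bar>r - t\<bar> < d \<Longrightarrow> x \<in> S \<Longrightarrow> \<bar>w r x\<bar> \<le> B" by blast
    have "P u v" if "u \<le> t \<and> t \<le> v \<and> v - u < d" for u v
      unfolding P_def using d(2) that by (intro exI[of _ B]) auto
    then show "\<exists>d>0. \<forall>u v. u \<le> t \<and> t \<le> v \<and> v - u < d \<longrightarrow> P u v" using d(1) by blast
  qed
  then show ?thesis unfolding P_def by auto
qed auto

text \<open>
  If \<open>\<bar>w\<bar> \<le> B\<close> up to time \<open>t\<close>, then integrating the inequality for \<open>w'\<close> repeatedly gives
  \<open>\<bar>w r\<bar> \<le> B (K r)\<^sup>n / n!\<close> for all \<open>n\<close>.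
\<close>

lemma linear_evolution_zero:
  fixes w w' :: "real \<Rightarrow> 'b \<Rightarrow> real"
  assumes deriv: "\<And>t x. 0 \<le> t \<Longrightarrow> x \<in> S \<Longrightarrow> ((\<lambda>r. w r x) has_real_derivative w' t x) (at t within {0..})"
    and bound: "\<And>t x B. 0 \<le> t \<Longrightarrow> x \<in> S \<Longrightarrow> (\<And>y. y \<in> S \<Longrightarrow> \<bar>w t y\<bar> \<le> B) \<Longrightarrow> \<bar>w' t x\<bar> \<le> K * B"
    and bdd: "\<And>b. \<exists>B. \<forall>t\<in>{0..b}. \<forall>x\<in>S. \<bar>w t x\<bar> \<le> B"
    and init: "\<And>x. x \<in> S \<Longrightarrow> w 0 x = 0"
    and t: "0 \<le> t" and x: "x \<in> S"
  shows "w t x = 0"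
proof -
  obtain B where B: "\<And>r y. r \<in> {0..t} \<Longrightarrow> y \<in> S \<Longrightarrow> \<bar>w r y\<bar> \<le> B" using bdd[of t] by blast
  have ind: "\<bar>w r y\<bar> \<le> B * (K * r) ^ n / fact n" if "r \<in> {0..t}" "y \<in> S" for n r y
    using that
  proof (induction n arbitrary: r y)
    case 0
    then show ?case using B by simp
  next
    case (Suc n)
    define \<beta> where "\<beta> s = B * (K * s) ^ Suc n / fact (Suc n)" for s :: real
    have d\<beta>: "(\<beta> has_real_derivative K * (B * (K * s) ^ n / fact n)) (at s within X)" for s X
    proof -
      have "((\<lambda>s. K * s) has_real_derivative K) (at s within X)" by (auto intro!: derivative_eq_intros)
      from DERIV_cdivide[OF DERIV_cmult[OF DERIV_power_Suc[OF this, of n], of B], of "fact (Suc n)"]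
      have "(\<beta> has_real_derivative B * ((1 + of_nat n) * (K * (K * s) ^ n)) / fact (Suc n)) (at s within X)"
        unfolding \<beta>_def .
      moreover have "B * ((1 + of_nat n) * (K * (K * s) ^ n)) / fact (Suc n) = K * (B * (K * s) ^ n / fact n)"
        by (simp add: divide_simps)
      ultimately show ?thesis by (simp only:)
    qed
    have *: "\<sigma> * w r y \<le> \<beta> r" if \<sigma>: "\<bar>\<sigma>\<bar> = 1" for \<sigma> :: real
    proof -
      define g where "g s = \<beta> s - \<sigma> * w s y" for s
      have dg: "(g has_real_derivative (K * (B * (K * s) ^ n / fact n) - \<sigma> * w' s y)) (at s within {0..})" if "0 \<le> s" for s
        unfolding g_def using deriv[OF that Suc.prems(2)] d\<beta>[of s "{0..}"]
        by (auto intro!: derivative_eq_intros)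
      have "g 0 \<le> g r"
      proof (cases "r = 0")
        case False
        then have r: "0 \<le> r" using Suc.prems(1) by simp
        show ?thesis
        proof (rule DERIV_nonneg_imp_increasing_open[OF r])
          fix s assume s: "0 < s" "s < r"
          have "(g has_real_derivative (K * (B * (K * s) ^ n / fact n) - \<sigma> * w' s y)) (at s)"
          proof -
            have "s \<in> interior {0..}" using s by (simp add: interior_real_atLeast)
            then have "at s within {0..} = at s" by (rule at_within_interior)
            then show ?thesis using dg[of s] s by simp
          qed
          moreover have "\<bar>w' s y\<bar> \<le> K * (B * (K * s) ^ n / fact n)"
            by (rule bound) (use s Suc in auto)
          then have "\<sigma> * w' s y \<le> K * (B * (K * s) ^ n / fact n)"
            using abs_ge_self[of "\<sigma> * w' s y"] \<sigma> by (simp add: abs_mult)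
          ultimately show "\<exists>y. (g has_real_derivative y) (at s) \<and> 0 \<le> y" by (intro exI conjI) auto
        next
          show "continuous_on {0..r} g"
            unfolding continuous_on_eq_continuous_within
          proof
            fix s assume "s \<in> {0..r}"
            then have "continuous (at s within {0..}) g" using dg[of s] by (auto intro: DERIV_continuous)
            then show "continuous (at s within {0..r}) g" by (rule continuous_within_subset) auto
          qed
        qed
      qed simp
      moreover have "g 0 = 0" using init[OF Suc.prems(2)] by (simp add: g_def \<beta>_def)
      ultimately show ?thesis by (simp add: g_def)
    qed
    show ?case using *[of 1] *[of "-1"] by (simp add: \<beta>_def abs_le_iff)
  qed
  have "(\<lambda>n. B * (K * t) ^ n / fact n) \<longlonglongrightarrow> 0"
  proof -
    have "(\<lambda>n. B * (inverse (fact n) * (K * t) ^ n)) \<longlonglongrightarrow> B * 0"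
      by (intro tendsto_mult tendsto_const summable_LIMSEQ_zero[OF summable_exp])
    then show ?thesis by (simp add: divide_inverse mult_ac)
  qed
  then have "\<bar>w t x\<bar> \<le> 0"
    by (rule LIMSEQ_le_const) (use ind[of t x] t x in auto)
  then show ?thesis by simp
qed

section \<open>Ultrametric balls\<close>

lemma absval_eq_dist: "absval x = dist x (0::'a::nonarch_local_field)"
  by (simp add: dist_absval)

lemma absval_nonneg [simp]: "0 \<le> absval (x::'a::nonarch_local_field)"
  by (simp add: absval_eq_dist)

lemma absval_eq_0_iff [simp]: "absval x = 0 \<longleftrightarrow> x = (0::'a::nonarch_local_field)"
  by (simp add: absval_eq_dist)

lemma absval_zero [simp]: "absval (0::'a::nonarch_local_field) = 0"
  by simp

lemma absval_pos_iff [simp]: "0 < absval x \<longleftrightarrow> x \<noteq> (0::'a::nonarch_local_field)"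
  by (simp add: absval_eq_dist)

lemma absval_one [simp]: "absval (1::'a::nonarch_local_field) = 1"
proof -
  have "absval (1::'a) * absval (1::'a) = absval (1::'a)" by (simp flip: absval_mult)
  then show ?thesis by simp
qed

lemma absval_minus_commute: "absval (x - y) = absval (y - (x::'a::nonarch_local_field))"
  by (metis dist_absval dist_commute)

lemma absval_minus [simp]: "absval (- x) = absval (x::'a::nonarch_local_field)"
  using absval_minus_commute[of 0 x] by simp

lemma absval_inverse: "absval (inverse x) = inverse (absval (x::'a::nonarch_local_field))"
proof (cases "x = 0")
  case False
  have "absval x * absval (inverse x) = 1" using False by (simp flip: absval_mult)
  then show ?thesis by (simp add: inverse_unique)
qed simp

lemma absval_divide: "absval (x / y) = absval x / absval (y::'a::nonarch_local_field)"
  by (simp add: divide_inverse absval_mult absval_inverse)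

lemma absval_power: "absval (x ^ n) = absval (x::'a::nonarch_local_field) ^ n"
  by (induction n) (simp_all add: absval_mult)

lemma absval_add_eq: "absval y < absval x \<Longrightarrow> absval (x + y) = absval (x::'a::nonarch_local_field)"
proof -
  assume a: "absval y < absval x"
  have "absval (x + y) \<le> absval x" using absval_ultrametric[of x y] a by simp
  moreover have "absval x \<le> max (absval (x + y)) (absval y)"
    using absval_ultrametric[of "x + y" "- y"] by simp
  ultimately show ?thesis using a by simp
qed

lemma dist_ultrametric: "dist x z \<le> max (dist x y) (dist y (z::'a::nonarch_local_field))"
  using absval_ultrametric[of "x - y" "y - z"] by (simp add: dist_absval)

lemma dist_eq_of_less: "dist x y < dist y z \<Longrightarrow> dist x z = dist y (z::'a::nonarch_local_field)"
  using absval_add_eq[of "x - y" "y - z"] by (simp add: dist_absval)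

lemma cball_absorb: "y \<in> cball x r \<Longrightarrow> cball y r = cball (x::'a::nonarch_local_field) r"
  using dist_ultrametric[of x _ y] dist_ultrametric[of y _ x] by (auto simp: dist_commute) (smt (verit) dist_commute)+

lemma open_cball: "0 < r \<Longrightarrow> open (cball (x::'a::nonarch_local_field) r)"
  unfolding open_contains_cball using cball_absorb by blast

text \<open>
  By local compactness some ball is compact.  An element of absolute value larger than 1 enlarges it
  to a ball that contains the given one.
\<close>

lemma compact_cball: "compact (cball (x::'a::nonarch_local_field) R)"
proof -
  obtain U C where UC: "(0::'a) \<in> U" "open U" "U \<subseteq> C" "compact C" using locally_compact_field by blast
  then obtain e where e: "e > 0" "cball 0 e \<subseteq> U" using open_contains_cball by blast
  have c0: "compact (cball (0::'a) e)"
    using compact_Int_closed[OF UC(4) closed_cball[of 0 e]] e(2) UC(3) by (simp add: Int_absorb1)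
  obtain y :: 'a where y: "absval y > 1"
  proof -
    obtain z :: 'a where z: "z \<noteq> 0" "absval z \<noteq> 1" using absval_nontrivial by blast
    show ?thesis
    proof (cases "absval z > 1")
      case False
      then have "absval z < 1" "0 < absval z" using z by auto
      then have "absval (inverse z) > 1" by (simp add: absval_inverse one_less_inverse)
      then show ?thesis using that by blast
    qed (use that in blast)
  qed
  obtain n where n: "R / e < absval y ^ n" using real_arch_pow[OF y] by blast
  define c where "c = y ^ n"
  have c: "R < absval c * e" "c \<noteq> 0" using n e(1) y by (auto simp: c_def absval_power field_simps)
  let ?f = "\<lambda>z. c * z + x"
  have "continuous_on UNIV ?f"
    unfolding continuous_on_iff
  proof (intro ballI allI impI)
    fix z :: 'a and d :: real assume "d > 0"
    then show "\<exists>d'>0. \<forall>w\<in>UNIV. dist w z < d' \<longrightarrow> dist (?f w) (?f z) < d"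
      using c(2) by (intro exI[of _ "d / absval c"]) (auto simp: dist_absval field_simps simp flip: absval_mult)
  qed
  then have "compact (?f ` cball 0 e)" using c0 compact_continuous_image continuous_on_subset by blast
  moreover have "cball x R \<subseteq> ?f ` cball 0 e"
  proof
    fix w assume "w \<in> cball x R"
    then have "absval (w - x) \<le> R" by (simp add: dist_absval absval_minus_commute)
    then have "absval ((w - x) / c) \<le> e" using c by (simp add: absval_divide divide_le_eq mult.commute)
    moreover have "w = ?f ((w - x) / c)" using c(2) by simp
    ultimately show "w \<in> ?f ` cball 0 e" by (intro image_eqI[of _ _ "(w - x) / c"]) (simp_all add: dist_absval)
  qed
  ultimately show ?thesis by (metis closed_cball compact_Int_closed inf.absorb2)
qed

section \<open>The projective line\<close>

lemma topspace_P1 [simp]: "topspace P1 = UNIV"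
  by (auto simp: P1_def UNIV_option_conv)

text \<open>
  As balls are compact, the neighbourhoods of infinity are the sets that contain all points of
  sufficiently large absolute value.
\<close>

lemma openin_P1_iff:
  "openin P1 W \<longleftrightarrow> (\<forall>z::'a::nonarch_local_field. Some z \<in> W \<longrightarrow> (\<exists>e>0. \<forall>w. absval (w - z) < e \<longrightarrow> Some w \<in> W)) \<and>
     (None \<in> W \<longrightarrow> (\<exists>R. \<forall>w. absval w > R \<longrightarrow> Some w \<in> W))" (is "_ \<longleftrightarrow> ?A \<and> ?B")
proof -
  have A: "?A \<longleftrightarrow> open (Some -` W)"
    by (auto simp: open_dist dist_absval)
  show ?thesis
  proof
    assume "openin P1 W"
    then consider U where "open U" "W = Some ` U"
      | C where "compact C" "closed C" "W = insert None (Some ` (UNIV - C))"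
      by (auto simp: P1_def openin_Alexandroff_compactification)
    then show "?A \<and> ?B"
    proof cases
      case 1
      then have "Some -` W = U" "None \<notin> W" by auto
      then have "open (Some -` W)" using 1(1) by simp
      with A \<open>None \<notin> W\<close> show ?thesis by blast
    next
      case 2
      then have "Some -` W = - C" by auto
      then have "open (Some -` W)" using 2(2) by (simp add: open_Compl)
      with A have a: ?A by blast
      have "bounded C" using 2(1) by (rule compact_imp_bounded)
      then obtain R where R: "\<forall>y\<in>C. dist 0 y \<le> R" unfolding bounded_any_center[where a=0] by blast
      have "Some w \<in> W" if "absval w > R" for w
        using R that 2(3) by (force simp: dist_absval)
      then show ?thesis using a by blast
    qed
  next
    assume AB: "?A \<and> ?B"
    then have op: "open (Some -` W)" using A by blast
    show "openin P1 W"
    proof (cases "None \<in> W")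
      case False
      have "W = Some ` (Some -` W)"
      proof -
        have "x \<in> W \<longleftrightarrow> x \<in> Some ` (Some -` W)" for x using False by (cases x) auto
        then show ?thesis by blast
      qed
      then show ?thesis using op unfolding P1_def openin_Alexandroff_compactification by auto
    next
      case True
      define C where "C = - (Some -` W)"
      obtain R where R: "\<And>w. absval w > R \<Longrightarrow> Some w \<in> W" using AB True by blast
      have "C \<subseteq> cball 0 R"
        using R by (auto simp: C_def dist_absval)
      moreover have cl: "closed C" using op by (simp add: C_def closed_Compl)
      ultimately have "compact C" using compact_cball by (metis compact_Int_closed inf.absorb2)
      moreover have "W = insert None (Some ` (UNIV - C))"
      proof -
        have "x \<in> W \<longleftrightarrow> x \<in> insert None (Some ` (UNIV - C))" for x using True by (cases x) (auto simp: C_def)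
        then show ?thesis by blast
      qed
      ultimately show ?thesis using cl unfolding P1_def openin_Alexandroff_compactification by auto
    qed
  qed
qed

lemma openin_P1_Some: "open U \<Longrightarrow> openin P1 (Some ` (U :: 'a::nonarch_local_field set))"
  by (auto simp: P1_def openin_Alexandroff_compactification)

lemma open_vimage_Some: "openin P1 W \<Longrightarrow> open {z :: 'a::nonarch_local_field. Some z \<in> W}"
  by (auto simp: openin_P1_iff open_dist dist_absval)

section \<open>Moebius transformations\<close>

declare mobius.simps [simp del]

lemma mobius_diff:
  fixes a b c d z w :: "'a::field"
  assumes "c * z + d \<noteq> 0" "c * w + d \<noteq> 0"
  shows "(a * w + b) / (c * w + d) - (a * z + b) / (c * z + d) = (a * d - b * c) * (w - z) / ((c * z + d) * (c * w + d))"
  using assms by (simp add: divide_simps) (simp add: algebra_simps)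

text \<open>
  The four cases are a finite point with finite image, the pole, infinity with finite image, and
  infinity as a fixed point.  In each of them the ultrametric inequality makes \<open>\<bar>c w + d\<bar>\<close> or
  \<open>\<bar>a w + b\<bar>\<close> explicit near the point.
\<close>

lemma openin_vimage_mobius:
  fixes A :: "'a::nonarch_local_field ^ 2 ^ 2"
  assumes W: "openin P1 W" and det: "det A \<noteq> 0"
  shows "openin P1 (mobius A -` W)"
proof -
  define a b c d where abcd: "a = A $ 1 $ 1" "b = A $ 1 $ 2" "c = A $ 2 $ 1" "d = A $ 2 $ 2"
  define D where "D = a * d - b * c"
  have D: "D \<noteq> 0" using det by (simp add: D_def abcd det_2)
  have mS: "mobius A (Some w) = (if c * w + d = 0 then None else Some ((a * w + b) / (c * w + d)))" for w
    by (simp add: abcd mobius.simps)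
  have mN: "mobius A None = (if c = 0 then None else Some (a / c))" by (simp add: abcd mobius.simps)
  note WS = conjunct1[OF W[unfolded openin_P1_iff], rule_format] and WN = conjunct2[OF W[unfolded openin_P1_iff], rule_format]
  show ?thesis
    unfolding openin_P1_iff vimage_eq
  proof (intro conjI allI impI)
    fix z assume z: "mobius A (Some z) \<in> W"
    show "\<exists>e>0. \<forall>w. absval (w - z) < e \<longrightarrow> mobius A (Some w) \<in> W"
    proof (cases "c * z + d = 0")
      case False
      let ?q = "absval (c * z + d)"
      have q: "?q > 0" using False by simp
      obtain \<eta> where \<eta>: "\<eta> > 0" "\<And>w. absval (w - (a * z + b) / (c * z + d)) < \<eta> \<Longrightarrow> Some w \<in> W"
        using WS z mS False by force
      \<comment> \<open>the first bound keeps the denominator at its absolute value ?q, the second one makes the difference of the images less than \<eta>\<close>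
      define e where "e = min (?q / (absval c + 1)) (\<eta> * ?q\<^sup>2 / absval D)"
      have cp: "0 < absval c + 1" using absval_nonneg[of c] by linarith
      have "e > 0" using q \<eta>(1) D cp by (simp add: e_def)
      moreover have "mobius A (Some w) \<in> W" if w: "absval (w - z) < e" for w
      proof -
        have "absval (w - z) * (absval c + 1) < ?q" using w cp by (simp add: e_def pos_less_divide_eq)
        moreover have "absval (c * (w - z)) \<le> absval (w - z) * (absval c + 1)"
          by (simp add: absval_mult distrib_left mult.commute)
        ultimately have "absval (c * (w - z)) < ?q" by linarith
        then have qw: "absval (c * w + d) = ?q" using absval_add_eq[of "c * (w - z)" "c * z + d"] by (simp add: algebra_simps)
        then have w0: "c * w + d \<noteq> 0" using q by auto
        have "absval ((a * w + b) / (c * w + d) - (a * z + b) / (c * z + d)) = absval D * absval (w - z) / ?q\<^sup>2"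
          unfolding mobius_diff[OF False w0] by (simp add: D_def[symmetric] absval_mult absval_divide qw power2_eq_square)
        also have "\<dots> < \<eta>"
        proof -
          have "absval (w - z) < \<eta> * ?q\<^sup>2 / absval D" using w by (simp add: e_def)
          then show ?thesis using D q by (simp add: field_simps)
        qed
        finally show ?thesis using \<eta>(2) w0 by (simp add: mS)
      qed
      ultimately show ?thesis by blast
    next
      case True
      have c: "c \<noteq> 0"
      proof
        assume "c = 0"
        then have "d = 0" using True by simp
        then show False using D \<open>c = 0\<close> by (simp add: D_def)
      qed
      have N: "None \<in> W" using z True by (simp add: mS)
      then obtain R where R: "\<And>w. absval w > R \<Longrightarrow> Some w \<in> W" using WN by blast
      \<comment> \<open>the image of w is a / c plus a term that dominates it and has absolute value larger than M\<close>
      define M where "M = max (max R (absval (a / c))) 0 + 1"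
      have M: "M > 0" "M > R" "M > absval (a / c)" by (auto simp: M_def)
      define e where "e = absval D / ((absval c)\<^sup>2 * M)"
      have "e > 0" using D c M by (simp add: e_def)
      moreover have "mobius A (Some w) \<in> W" if w: "absval (w - z) < e" for w
      proof (cases "w = z")
        case True
        then show ?thesis using N \<open>c * z + d = 0\<close> by (simp add: mS)
      next
        case False
        have "c * w + d = c * (w - z) + (c * z + d)" by (simp add: algebra_simps)
        then have cw: "c * w + d = c * (w - z)" using True by simp
        have w0: "c * w + d \<noteq> 0" using False c cw by simp
        have "a * w + b = (a * (c * w + d) - D) / c" using c by (simp add: D_def field_simps)
        then have fw: "(a * w + b) / (c * w + d) = - (D / (c * (c * (w - z)))) + a / c"
          using c False unfolding cw by (simp add: divide_simps)
        have "M < absval (- (D / (c * (c * (w - z)))))"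
        proof -
          have p: "0 < absval (w - z)" using False by simp
          have "absval (w - z) * ((absval c)\<^sup>2 * M) < absval D" using w M(1) c by (simp add: e_def pos_less_divide_eq)
          then have "M < absval D / (absval c * (absval c * absval (w - z)))"
            using p c by (simp add: pos_less_divide_eq power2_eq_square mult_ac)
          then show ?thesis by (simp add: absval_divide absval_mult)
        qed
        then have "absval ((a * w + b) / (c * w + d)) > M"
          unfolding fw using absval_add_eq[of "a / c" "- (D / (c * (c * (w - z))))"] M by simp
        then show ?thesis using R[of "(a * w + b) / (c * w + d)"] M w0 by (simp add: mS)
      qed
      ultimately show ?thesis by blast
    qed
  next
    assume z: "mobius A None \<in> W"
    show "\<exists>R. \<forall>w. R < absval w \<longrightarrow> mobius A (Some w) \<in> W"
    proof (cases "c = 0")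
      case False
      then obtain \<eta> where \<eta>: "\<eta> > 0" "\<And>w. absval (w - a / c) < \<eta> \<Longrightarrow> Some w \<in> W"
        using WS[of "a / c"] z mN by auto
      define R where "R = max (absval (d / c)) (absval D / ((absval c)\<^sup>2 * \<eta>))"
      have "mobius A (Some w) \<in> W" if w: "R < absval w" for w
      proof -
        have "absval (d / c) < absval w" using w by (simp add: R_def)
        then have "absval d < absval (c * w)" using False by (simp add: absval_divide absval_mult field_simps)
        then have q: "absval (c * w + d) = absval c * absval w" by (simp add: absval_add_eq absval_mult)
        have w1: "0 < absval w" using \<open>absval (d / c) < absval w\<close> absval_nonneg[of "d / c"] by linarith
        have w0: "c * w + d \<noteq> 0" using q w1 False by (metis absval_eq_0_iff mult_eq_0_iff less_irrefl)
        have "(a * w + b) / (c * w + d) - a / c = - D / (c * (c * w + d))"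
          using False w0 by (simp add: divide_simps) (simp add: D_def algebra_simps)
        then have "absval ((a * w + b) / (c * w + d) - a / c) = absval D / (absval c * (absval c * absval w))"
          by (simp add: absval_divide absval_mult q)
        also have "\<dots> < \<eta>"
        proof -
          have "absval D / ((absval c)\<^sup>2 * \<eta>) < absval w" using w by (simp add: R_def)
          then have "absval D < absval w * ((absval c)\<^sup>2 * \<eta>)" using False \<eta>(1) by (simp add: pos_divide_less_eq)
          then show ?thesis using False w1 by (simp add: pos_divide_less_eq power2_eq_square mult_ac)
        qed
        finally show ?thesis using \<eta>(2) w0 by (simp add: mS)
      qed
      then show ?thesis by blast
    next
      case True
      then have ad: "a \<noteq> 0" "d \<noteq> 0" using D by (auto simp: D_def)
      obtain R where R: "\<And>w. absval w > R \<Longrightarrow> Some w \<in> W" using WN z True mN by auto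
      define R' where "R' = max (absval (b / a)) (R * absval d / absval a)"
      have "mobius A (Some w) \<in> W" if w: "R' < absval w" for w
      proof -
        have "absval (b / a) < absval w" using w by (simp add: R'_def)
        then have "absval b < absval (a * w)" using ad by (simp add: absval_divide absval_mult field_simps)
        then have q: "absval (a * w + b) = absval a * absval w" by (simp add: absval_add_eq absval_mult)
        have "R * absval d / absval a < absval w" using w by (simp add: R'_def)
        then have "R * absval d < absval a * absval w" using ad by (simp add: pos_divide_less_eq mult.commute)
        then have "R < absval ((a * w + b) / d)" using ad unfolding absval_divide q by (simp add: pos_less_divide_eq)
        then show ?thesis using R[of "(a * w + b) / d"] True ad by (simp add: mS)
      qed
      then show ?thesis by blast
    qed
  qed
qed

text \<open>
  Homogeneous coordinates linearise the action, so that composition becomes the matrix product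
  without distinguishing cases.
\<close>

definition proj_point :: "'a::field \<Rightarrow> 'a \<Rightarrow> 'a option" where
  "proj_point u v = (if v = 0 then None else Some (u / v))"

lemma mobius_proj_point:
  assumes "u \<noteq> 0 \<or> v \<noteq> 0"
  shows "mobius A (proj_point u v) = proj_point (A $ 1 $ 1 * u + A $ 1 $ 2 * v) (A $ 2 $ 1 * u + A $ 2 $ 2 * v)"
proof (cases "v = 0")
  case False
  have "A $ 2 $ 1 * (u / v) + A $ 2 $ 2 = (A $ 2 $ 1 * u + A $ 2 $ 2 * v) / v"
    "A $ 1 $ 1 * (u / v) + A $ 1 $ 2 = (A $ 1 $ 1 * u + A $ 1 $ 2 * v) / v"
    using False by (simp_all add: field_simps)
  then show ?thesis using False by (simp add: proj_point_def mobius.simps)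
qed (use assms in \<open>auto simp: proj_point_def mobius.simps\<close>)

lemma proj_point_cases: obtains u v :: "'a::field" where "x = proj_point u v" "u \<noteq> 0 \<or> v \<noteq> 0"
proof (cases x)
  case None
  then show ?thesis using that[of 1 0] by (simp add: proj_point_def)
next
  case (Some z)
  then show ?thesis using that[of z 1] by (simp add: proj_point_def)
qed

lemma mobius_mult:
  fixes A B :: "'a::nonarch_local_field ^ 2 ^ 2"
  assumes "det B \<noteq> 0"
  shows "mobius (A ** B) x = mobius A (mobius B x)"
proof -
  obtain u v where x: "x = proj_point u v" "u \<noteq> 0 \<or> v \<noteq> 0" by (rule proj_point_cases)
  let ?u = "B $ 1 $ 1 * u + B $ 1 $ 2 * v" and ?v = "B $ 2 $ 1 * u + B $ 2 $ 2 * v"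
  have "?u \<noteq> 0 \<or> ?v \<noteq> 0"
  proof (rule ccontr)
    assume "\<not> (?u \<noteq> 0 \<or> ?v \<noteq> 0)"
    then have "?u = 0" "?v = 0" by auto
    moreover have "B $ 2 $ 2 * ?u - B $ 1 $ 2 * ?v = det B * u" "B $ 1 $ 1 * ?v - B $ 2 $ 1 * ?u = det B * v"
      by (simp_all add: det_2 algebra_simps)
    ultimately have "det B * u = 0" "det B * v = 0" by simp_all
    then show False using x(2) assms by simp
  qed
  then show ?thesis
    unfolding x(1) mobius_proj_point[OF x(2)] by (subst mobius_proj_point) (simp_all add: matrix_matrix_mult_def sum_2 algebra_simps)
qed

lemma mobius_scalar: "k \<noteq> 0 \<Longrightarrow> mobius (mat k :: 'a::nonarch_local_field ^ 2 ^ 2) x = x"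
  by (cases x) (simp_all add: mat_def mobius.simps)

lemma GL2_simps [simp]:
  "carrier GL2 = {A. invertible A}" "A \<otimes>\<^bsub>GL2\<^esub> B = A ** B" "\<one>\<^bsub>GL2\<^esub> = mat 1"
  by (simp_all add: GL2_def)

lemma PGL2_elem:
  assumes "\<gamma> \<in> carrier (PGL2 :: ('a::nonarch_local_field ^ 2 ^ 2) set monoid)"
  shows "\<exists>A. det A \<noteq> 0 \<and> \<gamma> = {mat k ** A | k. k \<noteq> 0}"
proof -
  obtain A where A: "A \<in> carrier GL2" "\<gamma> = scalar_matrices #>\<^bsub>GL2\<^esub> A"
    using assms by (auto simp: PGL2_def FactGroup_def RCOSETS_def)
  have "\<gamma> = {mat k ** A | k. k \<noteq> 0}"
    unfolding A(2) by (auto simp: r_coset_def scalar_matrices_def)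
  moreover have "det A \<noteq> 0" using A(1) by (simp add: invertible_det_nz)
  ultimately show ?thesis by blast
qed

lemma mobius_mem:
  assumes \<gamma>: "\<gamma> \<in> carrier (PGL2 :: ('a::nonarch_local_field ^ 2 ^ 2) set monoid)" and C: "C \<in> \<gamma>"
  shows "mobius C = pgl_act \<gamma>" "det C \<noteq> 0"
proof -
  obtain A where A: "det A \<noteq> 0" "\<gamma> = {mat k ** A | k. k \<noteq> 0}" using PGL2_elem[OF \<gamma>] by blast
  have m: "mobius B = mobius A \<and> det B \<noteq> 0" if B: "B \<in> \<gamma>" for B
  proof -
    obtain k where k: "B = mat k ** A" "k \<noteq> 0" using B A(2) by blast
    have "det (mat k :: 'a ^ 2 ^ 2) \<noteq> 0" using invertible_mat[OF k(2)] by (simp add: invertible_det_nz)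
    moreover have "mobius B x = mobius A x" for x
      unfolding k(1) using A(1) k(2) by (simp add: mobius_mult mobius_scalar)
    ultimately show ?thesis using A(1) by (auto simp: k(1) det_mul)
  qed
  have "pgl_rep \<gamma> \<in> \<gamma>" unfolding pgl_rep_def using C by (rule someI)
  then show "mobius C = pgl_act \<gamma>" "det C \<noteq> 0" using m C by (auto simp: pgl_act_def)
qed

lemma pgl_rep_mem:
  assumes "\<gamma> \<in> carrier (PGL2 :: ('a::nonarch_local_field ^ 2 ^ 2) set monoid)"
  shows "pgl_rep \<gamma> \<in> \<gamma>"
proof -
  obtain A where A: "\<gamma> = {mat k ** A | k. k \<noteq> 0}" using PGL2_elem[OF assms] by blast
  have "mat 1 ** A \<in> \<gamma>" unfolding A using one_neq_zero by blast
  then show ?thesis unfolding pgl_rep_def by (rule someI)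
qed

lemma det_pgl_rep:
  "\<gamma> \<in> carrier (PGL2 :: ('a::nonarch_local_field ^ 2 ^ 2) set monoid) \<Longrightarrow> det (pgl_rep \<gamma>) \<noteq> 0"
  using mobius_mem(2)[OF _ pgl_rep_mem] .

lemma pgl_act_mult:
  assumes "\<gamma> \<in> carrier (PGL2 :: ('a::nonarch_local_field ^ 2 ^ 2) set monoid)" "\<delta> \<in> carrier PGL2"
  shows "pgl_act (\<gamma> \<otimes>\<^bsub>PGL2\<^esub> \<delta>) x = pgl_act \<gamma> (pgl_act \<delta> x)"
proof -
  interpret group "PGL2 :: ('a ^ 2 ^ 2) set monoid" by (rule group_PGL2)
  have "pgl_rep \<gamma> ** pgl_rep \<delta> \<in> \<gamma> \<otimes>\<^bsub>PGL2\<^esub> \<delta>"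
    using pgl_rep_mem[OF assms(1)] pgl_rep_mem[OF assms(2)]
    by (auto simp: PGL2_def FactGroup_def set_mult_def)
  from mobius_mem(1)[OF _ this] assms have "pgl_act (\<gamma> \<otimes>\<^bsub>PGL2\<^esub> \<delta>) x = mobius (pgl_rep \<gamma> ** pgl_rep \<delta>) x" by simp
  also have "\<dots> = pgl_act \<gamma> (pgl_act \<delta> x)" using det_pgl_rep[OF assms(2)] by (simp add: mobius_mult pgl_act_def)
  finally show ?thesis .
qed

lemma one_PGL2: "\<one>\<^bsub>PGL2\<^esub> = (scalar_matrices :: ('a::nonarch_local_field ^ 2 ^ 2) set)"
  by (simp add: PGL2_def FactGroup_def)

lemma pgl_act_one [simp]: "pgl_act \<one>\<^bsub>PGL2\<^esub> x = (x :: 'a::nonarch_local_field option)"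
proof -
  interpret group "PGL2 :: ('a ^ 2 ^ 2) set monoid" by (rule group_PGL2)
  have "(mat 1 :: 'a ^ 2 ^ 2) \<in> \<one>\<^bsub>PGL2\<^esub>" by (simp add: one_PGL2 scalar_matricesI)
  from mobius_mem(1)[OF _ this] show ?thesis by (metis mobius_scalar one_closed one_neq_zero)
qed

lemma pgl_act_inv:
  assumes "\<gamma> \<in> carrier (PGL2 :: ('a::nonarch_local_field ^ 2 ^ 2) set monoid)"
  shows "pgl_act (inv\<^bsub>PGL2\<^esub> \<gamma>) (pgl_act \<gamma> x) = x" "pgl_act \<gamma> (pgl_act (inv\<^bsub>PGL2\<^esub> \<gamma>) x) = x"
proof -
  interpret group "PGL2 :: ('a ^ 2 ^ 2) set monoid" by (rule group_PGL2)
  show "pgl_act (inv\<^bsub>PGL2\<^esub> \<gamma>) (pgl_act \<gamma> x) = x" "pgl_act \<gamma> (pgl_act (inv\<^bsub>PGL2\<^esub> \<gamma>) x) = x"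
    using assms by (simp_all flip: pgl_act_mult)
qed

lemma openin_pgl_act_vimage:
  "\<gamma> \<in> carrier (PGL2 :: ('a::nonarch_local_field ^ 2 ^ 2) set monoid) \<Longrightarrow> openin P1 W \<Longrightarrow> openin P1 (pgl_act \<gamma> -` W)"
  unfolding pgl_act_def by (rule openin_vimage_mobius) (simp_all add: det_pgl_rep)

lemma pgl_act_image_eq:
  assumes "\<gamma> \<in> carrier (PGL2 :: ('a::nonarch_local_field ^ 2 ^ 2) set monoid)"
  shows "pgl_act \<gamma> ` W = pgl_act (inv\<^bsub>PGL2\<^esub> \<gamma>) -` W"
  using pgl_act_inv[OF assms] by (auto simp: image_iff) metis

lemma openin_pgl_act_image:
  assumes "\<gamma> \<in> carrier (PGL2 :: ('a::nonarch_local_field ^ 2 ^ 2) set monoid)" "openin P1 W"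
  shows "openin P1 (pgl_act \<gamma> ` W)"
proof -
  interpret group "PGL2 :: ('a ^ 2 ^ 2) set monoid" by (rule group_PGL2)
  show ?thesis unfolding pgl_act_image_eq[OF assms(1)] by (rule openin_pgl_act_vimage) (use assms in auto)
qed

section \<open>Fundamental domains\<close>

locale schottky_domain =
  fixes \<Gamma> :: "('a::nonarch_local_field ^ 2 ^ 2) set set" and F :: "'a set"
  assumes sub: "subgroup \<Gamma> PGL2" and fund: "fundamental_domain \<Gamma> F"
begin

lemma \<Gamma>_PGL2: "\<gamma> \<in> \<Gamma> \<Longrightarrow> \<gamma> \<in> carrier PGL2"
  using subgroup.mem_carrier[OF sub] .

lemma one_\<Gamma>: "\<one>\<^bsub>PGL2\<^esub> \<in> \<Gamma>" using subgroup.one_closed[OF sub] .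
lemma mult_\<Gamma>: "\<gamma> \<in> \<Gamma> \<Longrightarrow> \<delta> \<in> \<Gamma> \<Longrightarrow> \<gamma> \<otimes>\<^bsub>PGL2\<^esub> \<delta> \<in> \<Gamma>" using subgroup.m_closed[OF sub] .
lemma inv_\<Gamma>: "\<gamma> \<in> \<Gamma> \<Longrightarrow> inv\<^bsub>PGL2\<^esub> \<gamma> \<in> \<Gamma>" using subgroup.m_inv_closed[OF sub] .

lemma limit_points_invariant:
  assumes \<gamma>: "\<gamma> \<in> \<Gamma>" and a: "a \<in> limit_points \<Gamma>"
  shows "pgl_act \<gamma> a \<in> limit_points \<Gamma>"
proof -
  interpret group "PGL2 :: ('a ^ 2 ^ 2) set monoid" by (rule group_PGL2)
  obtain b \<sigma> where \<sigma>: "inj \<sigma>" "range \<sigma> \<subseteq> \<Gamma>" "limitin P1 (\<lambda>n::nat. pgl_act (\<sigma> n) b) a sequentially"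
    using a by (auto simp: limit_points_def)
  define \<tau> where "\<tau> n = \<gamma> \<otimes>\<^bsub>PGL2\<^esub> \<sigma> n" for n
  have s: "\<sigma> n \<in> \<Gamma>" for n using \<sigma>(2) by auto
  have "inj \<tau>"
  proof (rule injI)
    fix m n assume "\<tau> m = \<tau> n"
    then have "\<sigma> m = \<sigma> n" using Units_l_cancel[of \<gamma> "\<sigma> m" "\<sigma> n"] \<Gamma>_PGL2 s \<gamma> by (simp add: \<tau>_def Units_eq)
    then show "m = n" using \<sigma>(1) by (simp add: inj_eq)
  qed
  moreover have "range \<tau> \<subseteq> \<Gamma>" using mult_\<Gamma> \<gamma> s by (auto simp: \<tau>_def)
  moreover have "limitin P1 (\<lambda>n. pgl_act (\<tau> n) b) (pgl_act \<gamma> a) sequentially"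
    unfolding limitin_def
  proof (intro conjI allI impI)
    fix U assume U: "openin P1 U \<and> pgl_act \<gamma> a \<in> U"
    then have "openin P1 (pgl_act \<gamma> -` U)" "a \<in> pgl_act \<gamma> -` U"
      using openin_pgl_act_vimage \<Gamma>_PGL2 \<gamma> by auto
    then have "\<forall>\<^sub>F n in sequentially. pgl_act (\<sigma> n) b \<in> pgl_act \<gamma> -` U" using \<sigma>(3) by (auto simp: limitin_def)
    then show "\<forall>\<^sub>F n in sequentially. pgl_act (\<tau> n) b \<in> U"
      by eventually_elim (simp add: \<tau>_def pgl_act_mult \<Gamma>_PGL2 \<gamma> s)
  qed simp
  ultimately show ?thesis by (auto simp: limit_points_def)
qed

abbreviation "\<Omega> \<equiv> regular_domain \<Gamma>"
abbreviation "T \<equiv> Omega_topology \<Gamma>"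

lemma \<Omega>_invariant:
  assumes \<gamma>: "\<gamma> \<in> \<Gamma>" and x: "x \<in> \<Omega>"
  shows "pgl_act \<gamma> x \<in> \<Omega>"
proof -
  have cl: "pgl_act \<delta> y \<in> P1 closure_of limit_points \<Gamma>" if \<delta>: "\<delta> \<in> \<Gamma>" and y: "y \<in> P1 closure_of limit_points \<Gamma>" for \<delta> y
    unfolding in_closure_of
  proof (intro conjI allI impI)
    fix U assume U: "pgl_act \<delta> y \<in> U \<and> openin P1 U"
    then have "openin P1 (pgl_act \<delta> -` U)" "y \<in> pgl_act \<delta> -` U"
      using openin_pgl_act_vimage \<Gamma>_PGL2 \<delta> by auto
    then obtain l where "l \<in> limit_points \<Gamma>" "pgl_act \<delta> l \<in> U" using y by (auto simp: in_closure_of)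
    then show "\<exists>z. z \<in> limit_points \<Gamma> \<and> z \<in> U" using limit_points_invariant[OF \<delta>] by blast
  qed simp
  show ?thesis
  proof (rule ccontr)
    assume "pgl_act \<gamma> x \<notin> \<Omega>"
    then have "pgl_act \<gamma> x \<in> P1 closure_of limit_points \<Gamma>" by (simp add: regular_domain_def)
    from cl[OF inv_\<Gamma>[OF \<gamma>] this] have "x \<in> P1 closure_of limit_points \<Gamma>" by (simp add: pgl_act_inv \<Gamma>_PGL2 \<gamma>)
    then show False using x by (simp add: regular_domain_def)
  qed
qed

lemma openin_\<Omega>: "openin P1 \<Omega>"
  unfolding regular_domain_def by (rule openin_diff) (simp_all only: closedin_closure_of openin_topspace)

lemma openin_T: "openin T W \<longleftrightarrow> openin P1 W \<and> W \<subseteq> \<Omega>"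
  unfolding Omega_topology_def by (rule openin_open_subtopology[OF openin_\<Omega>])

lemma topspace_T [simp]: "topspace T = \<Omega>"
  by (simp add: Omega_topology_def)

lemma F_props: "compact F" "open F" "closed F" "Some ` F \<subseteq> \<Omega>"
  and F_ex1: "x \<in> \<Omega> \<Longrightarrow> \<exists>!\<gamma>. \<gamma> \<in> \<Gamma> \<and> x \<in> translate \<gamma> F"
  using fund by (auto simp: fundamental_domain_def)

text \<open>
  \<open>x\<close> lies in the translate of the fundamental domain by \<open>tile x\<close>, and \<open>fold_F x\<close> is its representative
  in the fundamental domain.
\<close>

definition tile :: "'a option \<Rightarrow> ('a ^ 2 ^ 2) set" where
  "tile x = (THE \<gamma>. \<gamma> \<in> \<Gamma> \<and> x \<in> translate \<gamma> F)"

definition fold_F :: "'a option \<Rightarrow> 'a" where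
  "fold_F x = the (pgl_act (inv\<^bsub>PGL2\<^esub> (tile x)) x)"

lemma translate_\<Omega>: "\<gamma> \<in> \<Gamma> \<Longrightarrow> V \<subseteq> F \<Longrightarrow> translate \<gamma> V \<subseteq> \<Omega>"
  using \<Omega>_invariant F_props(4) unfolding translate_def by blast

lemma tile_mem: "x \<in> \<Omega> \<Longrightarrow> tile x \<in> \<Gamma> \<and> x \<in> translate (tile x) F"
  unfolding tile_def using F_ex1 by (rule theI')

lemma tile_eqI: "\<gamma> \<in> \<Gamma> \<Longrightarrow> x \<in> translate \<gamma> F \<Longrightarrow> tile x = \<gamma>"
  unfolding tile_def using F_ex1[of x] translate_\<Omega>[of \<gamma> F] by (intro the1_equality) auto

lemma fold_F:
  assumes "x \<in> \<Omega>"
  shows "fold_F x \<in> F" "pgl_act (inv\<^bsub>PGL2\<^esub> (tile x)) x = Some (fold_F x)" "pgl_act (tile x) (Some (fold_F x)) = x"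
proof -
  obtain z where z: "z \<in> F" "x = pgl_act (tile x) (Some z)" using tile_mem[OF assms] by (auto simp: translate_def)
  have *: "pgl_act (inv\<^bsub>PGL2\<^esub> (tile x)) x = Some z"
    using z(2) pgl_act_inv(1)[of "tile x" "Some z"] tile_mem[OF assms] \<Gamma>_PGL2 by auto
  then show "fold_F x \<in> F" "pgl_act (inv\<^bsub>PGL2\<^esub> (tile x)) x = Some (fold_F x)" "pgl_act (tile x) (Some (fold_F x)) = x"
    using z by (auto simp: fold_F_def)
qed

lemma tile_pgl_act: "\<gamma> \<in> \<Gamma> \<Longrightarrow> z \<in> F \<Longrightarrow> tile (pgl_act \<gamma> (Some z)) = \<gamma>"
  by (rule tile_eqI) (auto simp: translate_def)

lemma fold_F_pgl_act: "\<gamma> \<in> \<Gamma> \<Longrightarrow> z \<in> F \<Longrightarrow> fold_F (pgl_act \<gamma> (Some z)) = z"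
  by (simp add: fold_F_def tile_pgl_act pgl_act_inv \<Gamma>_PGL2)

lemma tile_Some: "z \<in> F \<Longrightarrow> tile (Some z) = \<one>\<^bsub>PGL2\<^esub>"
  using tile_pgl_act[OF one_\<Gamma>, of z] by simp

lemma fold_F_Some: "z \<in> F \<Longrightarrow> fold_F (Some z) = z"
  using fold_F_pgl_act[OF one_\<Gamma>, of z] by simp

lemma fold_F_invariant:
  assumes "\<gamma> \<in> \<Gamma>" "x \<in> \<Omega>"
  shows "fold_F (pgl_act \<gamma> x) = fold_F x"
proof -
  have "pgl_act \<gamma> x = pgl_act (\<gamma> \<otimes>\<^bsub>PGL2\<^esub> tile x) (Some (fold_F x))"
    using fold_F(3)[OF assms(2)] tile_mem[OF assms(2)] by (simp add: pgl_act_mult \<Gamma>_PGL2 assms)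
  then show ?thesis using fold_F_pgl_act[OF mult_\<Gamma>] fold_F(1)[OF assms(2)] tile_mem[OF assms(2)] assms by simp
qed

lemma mem_translate_iff:
  assumes "\<gamma> \<in> \<Gamma>" "V \<subseteq> F" "x \<in> \<Omega>"
  shows "x \<in> translate \<gamma> V \<longleftrightarrow> tile x = \<gamma> \<and> fold_F x \<in> V"
proof
  assume "x \<in> translate \<gamma> V"
  then show "tile x = \<gamma> \<and> fold_F x \<in> V"
    using assms tile_pgl_act fold_F_pgl_act by (auto simp: translate_def)
next
  assume "tile x = \<gamma> \<and> fold_F x \<in> V"
  then show "x \<in> translate \<gamma> V"
    using fold_F(3)[OF assms(3)] by (auto simp: translate_def intro!: rev_image_eqI)
qed

lemma openin_translate:
  assumes "\<gamma> \<in> \<Gamma>" "open V" "V \<subseteq> F"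
  shows "openin T (translate \<gamma> V)"
  unfolding openin_T using openin_pgl_act_image[OF \<Gamma>_PGL2[OF assms(1)] openin_P1_Some[OF assms(2)]] translate_\<Omega> assms
  by (auto simp: translate_def)

text \<open>
  The set is the union of all translates of \<open>V\<close>.
\<close>

lemma openin_fold_vimage:
  assumes "open V"
  shows "openin T {x \<in> \<Omega>. fold_F x \<in> V}"
proof -
  have "{x \<in> \<Omega>. fold_F x \<in> V} = (\<Union>\<gamma>\<in>\<Gamma>. translate \<gamma> (V \<inter> F))"
  proof (intro subset_antisym subsetI)
    fix x assume "x \<in> {x \<in> \<Omega>. fold_F x \<in> V}"
    then have x: "x \<in> \<Omega>" "fold_F x \<in> V \<inter> F" using fold_F(1) by auto
    then show "x \<in> (\<Union>\<gamma>\<in>\<Gamma>. translate \<gamma> (V \<inter> F))"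
      using mem_translate_iff[of "tile x" "V \<inter> F" x] tile_mem[of x] by auto
  next
    fix x assume "x \<in> (\<Union>\<gamma>\<in>\<Gamma>. translate \<gamma> (V \<inter> F))"
    then obtain \<gamma> where g: "\<gamma> \<in> \<Gamma>" "x \<in> translate \<gamma> (V \<inter> F)" by blast
    then have "x \<in> \<Omega>" using translate_\<Omega>[OF g(1), of "V \<inter> F"] by auto
    then show "x \<in> {x \<in> \<Omega>. fold_F x \<in> V}" using mem_translate_iff[OF g(1), of "V \<inter> F" x] g by auto
  qed
  moreover have "openin T (translate \<gamma> (V \<inter> F))" if "\<gamma> \<in> \<Gamma>" for \<gamma>
    by (rule openin_translate[OF that]) (use assms F_props(2) in auto)
  ultimately show ?thesis by (auto intro!: openin_Union)
qed

end

section \<open>Haar measure and similarities\<close>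

lemma cball_disjoint_or_eq:
  "cball (x::'a::nonarch_local_field) r \<inter> cball y r \<noteq> {} \<Longrightarrow> cball x r = cball y r"
proof -
  assume "cball x r \<inter> cball y r \<noteq> {}"
  then obtain z where "z \<in> cball x r" "z \<in> cball y r" by blast
  then show ?thesis using cball_absorb[of z x r] cball_absorb[of z y r] by simp
qed

lemma uniform_cball_subset:
  assumes "compact V" "open (V::'a::nonarch_local_field set)"
  shows "\<exists>r>0. \<forall>a\<in>V. cball a r \<subseteq> V"
proof -
  obtain e where e: "e > 0" "\<And>x. x \<in> V \<Longrightarrow> \<exists>G\<in>{V}. ball x e \<subseteq> G"
    using Heine_Borel_lemma[OF assms(1), of "{V}"] assms(2) by auto
  have "cball a (e / 2) \<subseteq> V" if "a \<in> V" for a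
    using e(2)[OF that] e(1) by (force simp: subset_eq)
  then show ?thesis using e(1) by (intro exI[of _ "e / 2"]) auto
qed

lemma finite_cballs:
  assumes "compact V" "0 < r"
  shows "finite ((\<lambda>a. cball a r) ` (V::'a::nonarch_local_field set))"
proof -
  have "V \<subseteq> (\<Union>a\<in>V. cball a r)" using assms(2) by auto
  then obtain A where A: "A \<subseteq> V" "finite A" "V \<subseteq> (\<Union>a\<in>A. cball a r)"
    by (rule compactE_image[OF assms(1), of V "\<lambda>a. cball a r", rotated]) (use open_cball[OF assms(2)] in auto)
  have "(\<lambda>a. cball a r) ` V \<subseteq> (\<lambda>a. cball a r) ` A"
  proof (rule image_subsetI)
    fix b assume "b \<in> V"
    then obtain a where a: "a \<in> A" "b \<in> cball a r" using A(3) by blast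
    show "cball b r \<in> (\<lambda>a. cball a r) ` A" unfolding cball_absorb[OF a(2)] using a(1) by (rule imageI)
  qed
  then show ?thesis using A(2) finite_subset by blast
qed

locale haar =
  fixes \<mu> :: "'a::nonarch_local_field measure"
  assumes haar: "haar_measure \<mu>"
begin

lemma sets_haar [simp, measurable_cong]: "sets \<mu> = sets borel" and space_haar [simp]: "space \<mu> = UNIV"
  using haar by (auto simp: haar_measure_def dest: sets_eq_imp_space_eq)

lemma emeasure_cball: "emeasure \<mu> (cball a r) = emeasure \<mu> (cball b r)"
proof -
  have *: "emeasure \<mu> (cball a r) = emeasure \<mu> (cball 0 r)" for a
  proof -
    have "(+) a ` cball 0 r = cball a r"
    proof (intro subset_antisym subsetI)
      fix w assume "w \<in> cball a r"
      then show "w \<in> (+) a ` cball 0 r"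
        by (intro image_eqI[of _ _ "w - a"]) (auto simp: dist_absval absval_minus_commute)
    qed (auto simp: dist_absval)
    then show ?thesis using haar borel_closed[OF closed_cball[of 0 r]] unfolding haar_measure_def by metis
  qed
  show ?thesis using *[of a] *[of b] by simp
qed

lemma emeasure_cball_1: "emeasure \<mu> (cball a 1) = 1"
proof -
  have "cball (0::'a) 1 = {x. absval x \<le> 1}" by (auto simp: dist_absval)
  then show ?thesis using haar emeasure_cball[of a 1 0] by (simp add: haar_measure_def)
qed

lemma emeasure_compact_le:
  assumes "compact C" "0 < r"
  shows "\<exists>n::nat. emeasure \<mu> C \<le> of_nat n * emeasure \<mu> (cball 0 r)"
proof -
  let ?B = "(\<lambda>a. cball a r) ` C"
  have fin: "finite ?B" by (rule finite_cballs[OF assms])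
  have "emeasure \<mu> C \<le> emeasure \<mu> (\<Union>?B)"
  proof (rule emeasure_mono)
    show "C \<subseteq> \<Union>?B" using assms(2) by auto
    show "\<Union>?B \<in> sets \<mu>" using fin by (rule sets.finite_Union) auto
  qed
  also have "\<dots> \<le> (\<Sum>B\<in>?B. emeasure \<mu> B)"
  proof -
    have "?B \<subseteq> sets \<mu>" by auto
    then show ?thesis using fin emeasure_subadditive_finite[of ?B "\<lambda>B. B" \<mu>] by simp
  qed
  also have "\<dots> = of_nat (card ?B) * emeasure \<mu> (cball 0 r)"
    using emeasure_cball[of _ r 0] by (subst sum.cong[OF refl, of _ _ "\<lambda>_. emeasure \<mu> (cball 0 r)"]) auto
  finally show ?thesis by blast
qed

lemma emeasure_compact_finite: "compact C \<Longrightarrow> emeasure \<mu> C < \<infinity>"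
  using emeasure_compact_le[of C 1] emeasure_cball_1 by (auto simp: ennreal_of_nat_eq_real_of_nat intro: le_less_trans)

lemma similarity_inverse:
  assumes k: "k > 0" and sim: "\<And>z w. z \<in> V \<Longrightarrow> w \<in> V \<Longrightarrow> dist (\<psi> z) (\<psi> w) = k * dist z w"
  shows "z \<in> V \<Longrightarrow> inv_into V \<psi> (\<psi> z) = z"
    and "inv_into V \<psi> \<in> restrict_space \<mu> (\<psi> ` V) \<rightarrow>\<^sub>M borel"
proof -
  let ?V' = "\<psi> ` V" and ?\<chi> = "inv_into V \<psi>"
  have inj: "inj_on \<psi> V"
  proof (rule inj_onI)
    fix z w assume "z \<in> V" "w \<in> V" "\<psi> z = \<psi> w"
    then show "z = w" using sim[of z w] k by simp
  qed
  have chi: "?\<chi> (\<psi> z) = z" if "z \<in> V" for z using inj that by simp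
  have cont': "continuous_on ?V' ?\<chi>"
    unfolding continuous_on_iff
  proof (intro ballI allI impI)
    fix y e assume y: "y \<in> ?V'" and e: "0 < (e::real)"
    show "\<exists>d>0. \<forall>w\<in>?V'. dist w y < d \<longrightarrow> dist (?\<chi> w) (?\<chi> y) < e"
    proof (intro exI[of _ "e * k"] conjI ballI impI)
      fix w assume w: "w \<in> ?V'" "dist w y < e * k"
      obtain z z' where zz: "z \<in> V" "y = \<psi> z" "z' \<in> V" "w = \<psi> z'" using y w by auto
      then show "dist (?\<chi> w) (?\<chi> y) < e" using w(2) k sim[of z' z] by (simp add: chi mult.commute)
    qed (use e k in simp)
  qed
  show "z \<in> V \<Longrightarrow> ?\<chi> (\<psi> z) = z" by (rule chi)
  show "?\<chi> \<in> restrict_space \<mu> ?V' \<rightarrow>\<^sub>M borel"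
    using borel_measurable_continuous_on_restrict[OF cont'] by (simp cong: measurable_cong_sets sets_restrict_space_cong)
qed

text \<open>
  A similarity maps small balls of radius \<open>r\<close> to balls of radius \<open>k r\<close>.  By translation invariance the
  measure of a ball depends only on its radius, and \<open>V\<close> is a disjoint union of \<open>n\<close> balls of radius \<open>r\<close>,
  its image one of \<open>n\<close> balls of radius \<open>k r\<close>.  So for all small balls the measures of image and ball have
  the ratio \<open>c = \<mu> (\<psi> ` V) / \<mu> V\<close> (or both vanish).  Open sets are increasing unions of such balls.
\<close>

lemma similarity_pushforward:
  assumes V: "compact V" "open V" and V': "open (\<psi> ` V)" and k: "k > 0"
    and sim: "\<And>z w. z \<in> V \<Longrightarrow> w \<in> V \<Longrightarrow> dist (\<psi> z) (\<psi> w) = k * dist z w"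
  shows "\<exists>c\<ge>0. distr (restrict_space \<mu> (\<psi> ` V)) borel (inv_into V \<psi>) = density \<mu> (\<lambda>z. ennreal c * indicator V z)"
proof -
  let ?V' = "\<psi> ` V" and ?\<chi> = "inv_into V \<psi>"
  note chi = similarity_inverse(1)[OF k sim]
  have cont: "continuous_on V \<psi>"
    unfolding continuous_on_iff
  proof (intro ballI allI impI)
    fix z e assume "z \<in> V" "0 < (e::real)"
    then show "\<exists>d>0. \<forall>w\<in>V. dist w z < d \<longrightarrow> dist (\<psi> w) (\<psi> z) < e"
      using k by (intro exI[of _ "e / k"]) (auto simp: sim field_simps)
  qed
  have cV': "compact ?V'" using compact_continuous_image[OF cont V(1)] .
  obtain r0 where r0: "r0 > 0" "\<And>a. a \<in> V \<Longrightarrow> cball a r0 \<subseteq> V" using uniform_cball_subset[OF V] by blast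
  obtain r0' where r0': "r0' > 0" "\<And>a. a \<in> ?V' \<Longrightarrow> cball a r0' \<subseteq> ?V'" using uniform_cball_subset[OF cV' V'] by blast
  \<comment> \<open>balls of radius at most r1 stay inside V, and their images fill balls inside the image of V\<close>
  define r1 where "r1 = min r0 (r0' / k)"
  have r1: "r1 > 0" using r0(1) r0'(1) k by (simp add: r1_def)
  have sub: "cball a r \<subseteq> V" if "a \<in> V" "r \<le> r1" for a r
    using r0(2)[OF that(1)] that(2) by (auto simp: r1_def subset_eq)
  have img: "\<psi> ` cball a r = cball (\<psi> a) (k * r)" if a: "a \<in> V" "r \<le> r1" for a r
  proof (intro subset_antisym subsetI)
    fix y assume "y \<in> \<psi> ` cball a r"
    then obtain z where "z \<in> cball a r" "y = \<psi> z" by blast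
    then show "y \<in> cball (\<psi> a) (k * r)" using sub[OF a] sim[of a z] k a by auto
  next
    fix y assume y: "y \<in> cball (\<psi> a) (k * r)"
    have "k * r \<le> r0'" using a(2) k by (simp add: r1_def field_simps)
    then have "y \<in> cball (\<psi> a) r0'" using y by simp
    then have "y \<in> ?V'" using r0'(2)[of "\<psi> a"] a by blast
    then obtain z where z: "z \<in> V" "y = \<psi> z" by blast
    then have "k * dist a z \<le> k * r" using y sim[of a z] a by simp
    then show "y \<in> \<psi> ` cball a r" using z k by auto
  qed
  define \<nu> where "\<nu> = distr (restrict_space \<mu> ?V') borel ?\<chi>"
  note chi_meas = similarity_inverse(2)[OF k sim]
  have V'_sets: "?V' \<in> sets borel" using V' by simp
  have nu: "emeasure \<nu> E = emeasure \<mu> (\<psi> ` (E \<inter> V))" if E: "E \<in> sets borel" for E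
  proof -
    have "?\<chi> -` E \<inter> ?V' = \<psi> ` (E \<inter> V)" using chi by (auto simp: image_iff)
    moreover have "emeasure \<nu> E = emeasure (restrict_space \<mu> ?V') (?\<chi> -` E \<inter> space (restrict_space \<mu> ?V'))"
      unfolding \<nu>_def by (rule emeasure_distr[OF chi_meas E])
    moreover have "space (restrict_space \<mu> ?V') = ?V'" by (simp add: space_restrict_space)
    ultimately show ?thesis
      using V'_sets by (simp add: emeasure_restrict_space image_mono)
  qed
  have fin: "emeasure \<mu> V < \<infinity>" "emeasure \<mu> ?V' < \<infinity>" by (rule emeasure_compact_finite[OF V(1)], rule emeasure_compact_finite[OF cV'])
  define \<phi> where "\<phi> r = emeasure \<mu> (cball 0 r)" for r
  have cball_phi: "emeasure \<mu> (cball a r) = \<phi> r" for a r unfolding \<phi>_def by (rule emeasure_cball)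
  have nu_ball: "emeasure \<nu> (cball a r) = \<phi> (k * r)" if "a \<in> V" "r \<le> r1" for a r
  proof -
    have "cball a r \<inter> V = cball a r" using sub[OF that] by blast
    then show ?thesis using nu[of "cball a r"] img[OF that] by (simp add: cball_phi)
  qed
  let ?B = "\<lambda>r. (\<lambda>a. cball a r) ` V"
  have dis: "disjoint_family_on (\<lambda>B. B) (?B r)" for r
    unfolding disjoint_family_on_def
  proof (intro ballI impI)
    fix A B assume "A \<in> ?B r" "B \<in> ?B r" "A \<noteq> B"
    then obtain x y where "A = cball x r" "B = cball y r" by blast
    with \<open>A \<noteq> B\<close> show "A \<inter> B = {}" using cball_disjoint_or_eq[of x r y] by blast
  qed
  have count: "emeasure M (\<Union>S) = of_nat (card S) * x"
    if M: "sets M = sets borel" "\<And>B. B \<in> S \<Longrightarrow> emeasure M B = x" and S: "S \<subseteq> ?B r" and r: "0 < r" for M S x r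
  proof -
    have f: "finite S" using finite_cballs[OF V(1) r] S finite_subset by blast
    have "(\<Sum>B\<in>S. emeasure M B) = emeasure M (\<Union>B\<in>S. B)"
    proof (rule sum_emeasure)
      show "disjoint_family_on (\<lambda>B. B) S" using dis[of r] S by (rule disjoint_family_on_mono[rotated])
      show "(\<lambda>B. B) ` S \<subseteq> sets M" using S M(1) by auto
    qed (rule f)
    then show ?thesis using M(2) by simp
  qed
  have cover: "\<Union>(?B r) = V" if "0 < r" "r \<le> r1" for r using that sub by force
  have "\<exists>c\<ge>0. \<forall>r. 0 < r \<and> r \<le> r1 \<and> V \<noteq> {} \<longrightarrow> \<phi> (k * r) = ennreal c * \<phi> r"
  proof (cases "V = {}")
    case False
    have muV: "emeasure \<mu> V = of_nat (card (?B r)) * \<phi> r" "emeasure \<mu> ?V' = of_nat (card (?B r)) * \<phi> (k * r)"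
      if r: "0 < r" "r \<le> r1" for r
    proof -
      show "emeasure \<mu> V = of_nat (card (?B r)) * \<phi> r"
      proof -
        have "emeasure \<mu> B = \<phi> r" if "B \<in> ?B r" for B using that cball_phi by auto
        from count[OF _ this subset_refl r(1)] show ?thesis by (simp only: cover[OF r] sets_haar)
      qed
      have "emeasure \<nu> V = emeasure \<mu> ?V'" using nu[of V] V by simp
      then show "emeasure \<mu> ?V' = of_nat (card (?B r)) * \<phi> (k * r)"
      proof -
        have "emeasure \<nu> B = \<phi> (k * r)" if "B \<in> ?B r" for B using that nu_ball[OF _ r(2)] by auto
        moreover have "sets \<nu> = sets borel" by (simp add: \<nu>_def)
        ultimately have "emeasure \<nu> (\<Union>(?B r)) = of_nat (card (?B r)) * \<phi> (k * r)"
          by (intro count[OF _ _ subset_refl r(1)])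
        then show ?thesis using \<open>emeasure \<nu> V = emeasure \<mu> ?V'\<close> by (simp only: cover[OF r])
      qed
    qed
    have card_pos: "card (?B r) \<noteq> 0" if "0 < r" for r using finite_cballs[OF V(1) that] False by auto
    show ?thesis
    proof (cases "emeasure \<mu> V = 0")
      case True
      then have "\<phi> r1 = 0" using muV(1)[of r1] r1 card_pos by auto
      then have "emeasure \<mu> ?V' = 0" using emeasure_compact_le[OF cV' r1] by (auto simp: \<phi>_def)
      then have "\<phi> (k * r) = 0" if "0 < r" "r \<le> r1" for r using muV(2)[OF that] card_pos[OF that(1)] by auto
      then show ?thesis by (intro exI[of _ 0]) auto
    next
      case nz: False
      obtain a where a: "emeasure \<mu> V = ennreal a" "a > 0" using fin(1) nz by (cases "emeasure \<mu> V") (auto simp: less_le)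
      obtain b where b: "emeasure \<mu> ?V' = ennreal b" "b \<ge> 0" using fin(2) by (cases "emeasure \<mu> ?V'") auto
      have "\<phi> (k * r) = ennreal (b / a) * \<phi> r" if r: "0 < r" "r \<le> r1" for r
      proof -
        let ?n = "card (?B r)"
        have n: "?n \<noteq> 0" by (rule card_pos[OF r(1)])
        have fin\<phi>: "\<phi> t < \<infinity>" for t unfolding \<phi>_def by (rule emeasure_compact_finite[OF compact_cball])
        obtain u where u: "\<phi> r = ennreal u" "u \<ge> 0" using fin\<phi>[of r] by (cases "\<phi> r") auto
        obtain v where v: "\<phi> (k * r) = ennreal v" "v \<ge> 0" using fin\<phi>[of "k * r"] by (cases "\<phi> (k * r)") auto
        have "a = real ?n * u" using muV(1)[OF r] a u by (simp add: ennreal_of_nat_eq_real_of_nat flip: ennreal_mult)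
        moreover have "b = real ?n * v" using muV(2)[OF r] b v by (simp add: ennreal_of_nat_eq_real_of_nat flip: ennreal_mult)
        ultimately have "v = b / a * u" using n a(2) by auto
        then show ?thesis using u v a b by (simp flip: ennreal_mult)
      qed
      then show ?thesis using a b by (intro exI[of _ "b / a"]) auto
    qed
  qed auto
  then obtain c where c: "c \<ge> 0" "\<And>r. 0 < r \<Longrightarrow> r \<le> r1 \<Longrightarrow> V \<noteq> {} \<Longrightarrow> \<phi> (k * r) = ennreal c * \<phi> r" by blast
  define \<nu>2 where "\<nu>2 = density \<mu> (\<lambda>z. ennreal c * indicator V z)"
  have V_sets: "V \<in> sets borel" using V by simp
  have nu2: "emeasure \<nu>2 E = ennreal c * emeasure \<mu> (E \<inter> V)" if E: "E \<in> sets borel" for E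
  proof -
    have "emeasure \<nu>2 E = (\<integral>\<^sup>+z. ennreal c * indicator V z * indicator E z \<partial>\<mu>)"
      unfolding \<nu>2_def using E V_sets by (intro emeasure_density) auto
    also have "\<dots> = (\<integral>\<^sup>+z. ennreal c * indicator (E \<inter> V) z \<partial>\<mu>)"
      by (intro nn_integral_cong) (auto split: split_indicator)
    also have "\<dots> = ennreal c * emeasure \<mu> (E \<inter> V)"
      using E V_sets by (intro nn_integral_cmult_indicator) auto
    finally show ?thesis .
  qed
  have eq_open: "emeasure \<nu> S = emeasure \<nu>2 S" if S: "open S" for S
  proof -
    \<comment> \<open>exhaust the open set by the balls of radius \<rho> n that it contains\<close>
    define \<rho> where "\<rho> n = r1 / real (Suc n)" for n
    have \<rho>: "0 < \<rho> n" "\<rho> n \<le> r1" for n using r1 by (auto simp: \<rho>_def divide_le_eq)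
    define Q where "Q n = {B \<in> ?B (\<rho> n). B \<subseteq> S}" for n
    have Q: "\<Union>(Q n) = {w \<in> V. cball w (\<rho> n) \<subseteq> S}" for n
    proof (intro subset_antisym subsetI)
      fix w assume "w \<in> \<Union>(Q n)"
      then obtain a where a: "a \<in> V" "w \<in> cball a (\<rho> n)" "cball a (\<rho> n) \<subseteq> S" by (auto simp: Q_def)
      then show "w \<in> {w \<in> V. cball w (\<rho> n) \<subseteq> S}"
        using sub[OF a(1) \<rho>(2)] cball_absorb[OF a(2)] by blast
    next
      fix w assume "w \<in> {w \<in> V. cball w (\<rho> n) \<subseteq> S}"
      then have "cball w (\<rho> n) \<in> Q n" "w \<in> cball w (\<rho> n)" using \<rho>(1)[of n] by (auto simp: Q_def)
      then show "w \<in> \<Union>(Q n)" by blast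
    qed
    have inc: "incseq (\<lambda>n. \<Union>(Q n))"
    proof (rule incseq_SucI)
      fix n
      have "\<rho> (Suc n) \<le> \<rho> n" using r1 by (auto simp: \<rho>_def intro!: divide_left_mono)
      then have "cball w (\<rho> (Suc n)) \<subseteq> cball w (\<rho> n)" for w by auto
      then show "\<Union>(Q n) \<subseteq> \<Union>(Q (Suc n))" unfolding Q by blast
    qed
    have un: "(\<Union>n. \<Union>(Q n)) = S \<inter> V"
    proof (intro subset_antisym subsetI)
      fix w assume "w \<in> (\<Union>n. \<Union>(Q n))"
      then obtain n where "w \<in> V" "cball w (\<rho> n) \<subseteq> S" unfolding Q by blast
      moreover have "w \<in> cball w (\<rho> n)" using \<rho>(1)[of n] by simp
      ultimately show "w \<in> S \<inter> V" by blast
    next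
      fix w assume w: "w \<in> S \<inter> V"
      then obtain e where e: "e > 0" "cball w e \<subseteq> S" using S open_contains_cball by blast
      obtain n where n: "r1 / e < real (Suc n)" using reals_Archimedean2 by (metis less_trans lessI of_nat_less_iff)
      then have "\<rho> n \<le> e" using e(1) by (simp add: \<rho>_def field_simps)
      then have "cball w (\<rho> n) \<subseteq> S" using e(2) by (auto simp: subset_eq)
      then show "w \<in> (\<Union>n. \<Union>(Q n))" unfolding Q using w by blast
    qed
    have Qs: "Q n \<subseteq> ?B (\<rho> n)" for n by (auto simp: Q_def)
    have eqn: "emeasure \<nu> (\<Union>(Q n)) = emeasure \<nu>2 (\<Union>(Q n))" for n
    proof (cases "V = {}")
      case True
      then show ?thesis by (simp add: Q)
    next
      case False
      have "emeasure \<nu> (\<Union>(Q n)) = of_nat (card (Q n)) * \<phi> (k * \<rho> n)"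
        by (rule count[OF _ _ Qs \<rho>(1)]) (use \<rho> nu_ball in \<open>auto simp: \<nu>_def Q_def\<close>)
      moreover have "emeasure \<nu>2 (\<Union>(Q n)) = of_nat (card (Q n)) * (ennreal c * \<phi> (\<rho> n))"
      proof (rule count[OF _ _ Qs \<rho>(1)])
        show "sets \<nu>2 = sets borel" by (simp add: \<nu>2_def)
        fix B assume "B \<in> Q n"
        then obtain a where a: "a \<in> V" "B = cball a (\<rho> n)" by (auto simp: Q_def)
        then have "B \<inter> V = B" using sub[OF a(1) \<rho>(2)] by blast
        then show "emeasure \<nu>2 B = ennreal c * \<phi> (\<rho> n)" using nu2[of B] a by (simp add: cball_phi)
      qed
      ultimately show ?thesis using c(2)[OF \<rho> False] by simp
    qed
    have Qb: "range (\<lambda>n. \<Union>(Q n)) \<subseteq> sets borel"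
    proof -
      have "\<Union>(Q n) \<in> sets borel" for n
        using finite_subset[OF Qs finite_cballs[OF V(1) \<rho>(1)]] Qs[of n] by (intro sets.finite_Union) auto
      then show ?thesis by blast
    qed
    have "emeasure \<nu> (S \<inter> V) = (SUP n. emeasure \<nu> (\<Union>(Q n)))"
      unfolding un[symmetric] by (rule SUP_emeasure_incseq[symmetric]) (use inc Qb in \<open>auto simp: \<nu>_def\<close>)
    also have "\<dots> = (SUP n. emeasure \<nu>2 (\<Union>(Q n)))" by (simp only: eqn)
    also have "\<dots> = emeasure \<nu>2 (S \<inter> V)"
      unfolding un[symmetric] by (rule SUP_emeasure_incseq) (use inc Qb in \<open>auto simp: \<nu>2_def\<close>)
    finally show ?thesis using nu[of S] nu[of "S \<inter> V"] nu2[of S] nu2[of "S \<inter> V"] S V by (simp add: Int_assoc)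
  qed
  have "\<nu> = \<nu>2"
  proof (rule measure_eqI_generator_eq[where E="{S. open S}" and \<Omega>=UNIV and A="\<lambda>_. UNIV"])
    show "Int_stable {S :: 'a set. open S}" by (auto simp: Int_stable_def)
    show "sets \<nu> = sigma_sets UNIV {S. open S}" "sets \<nu>2 = sigma_sets UNIV {S. open S}"
      by (simp_all add: \<nu>_def \<nu>2_def borel_def)
    show "emeasure \<nu> UNIV \<noteq> \<infinity>" using nu[of UNIV] fin(2) by simp
  qed (use eq_open in auto)
  then show ?thesis using c(1) unfolding \<nu>_def \<nu>2_def by blast
qed

lemma similarity_change_of_variables:
  assumes V: "compact V" "open V" and V': "open (\<psi> ` V)" and k: "k > 0"
    and sim: "\<And>z w. z \<in> V \<Longrightarrow> w \<in> V \<Longrightarrow> dist (\<psi> z) (\<psi> w) = k * dist z w"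
  shows "\<exists>c\<ge>0. \<forall>G :: 'a \<Rightarrow> real. (\<lambda>z. indicator V z * G z) \<in> borel_measurable borel \<longrightarrow>
    (LINT y:\<psi> ` V|\<mu>. G (inv_into V \<psi> y)) = c * (LINT z:V|\<mu>. G z)"
proof -
  let ?V' = "\<psi> ` V" and ?\<chi> = "inv_into V \<psi>"
  obtain c where c: "c \<ge> 0" "distr (restrict_space \<mu> ?V') borel ?\<chi> = density \<mu> (\<lambda>z. ennreal c * indicator V z)"
    using similarity_pushforward[OF assms] by blast
  note chi = similarity_inverse(1)[OF k sim]
    and chi_meas = similarity_inverse(2)[OF k sim]
  show ?thesis
  proof (intro exI[of _ c] conjI allI impI c(1))
    fix G :: "'a \<Rightarrow> real"
    assume G: "(\<lambda>z. indicator V z * G z) \<in> borel_measurable borel"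
    have V_sets: "V \<in> sets borel" "?V' \<in> sets borel" using V V' by simp_all
    have "(LINT y:?V'|\<mu>. G (?\<chi> y)) = (\<integral>y. indicator V (?\<chi> y) * G (?\<chi> y) \<partial>restrict_space \<mu> ?V')"
      using V_sets unfolding set_lebesgue_integral_def
      by (subst integral_restrict_space) (auto intro!: Bochner_Integration.integral_cong simp: chi split: split_indicator)
    also have "\<dots> = (\<integral>z. indicator V z * G z \<partial>distr (restrict_space \<mu> ?V') borel ?\<chi>)"
      by (rule integral_distr[symmetric, OF chi_meas G])
    also have "\<dots> = (\<integral>z. indicator V z * G z \<partial>density \<mu> (\<lambda>z. ennreal (c * indicator V z)))"
      using c by (simp add: ennreal_mult' ennreal_indicator)
    also have "\<dots> = (\<integral>z. (c * indicator V z) *\<^sub>R (indicator V z * G z) \<partial>\<mu>)"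
      by (rule integral_density) (use G V_sets c(1) in auto)
    also have "\<dots> = (\<integral>z. c * (indicator V z * G z) \<partial>\<mu>)"
      by (intro Bochner_Integration.integral_cong) (auto split: split_indicator)
    also have "\<dots> = c * (LINT z:V|\<mu>. G z)" by (simp add: set_lebesgue_integral_def)
    finally show "(LINT y:?V'|\<mu>. G (?\<chi> y)) = c * (LINT z:V|\<mu>. G z)" .
  qed
qed

end

section \<open>Verticial coverings and the diffusion operator\<close>

text \<open>
  A point outside of \<open>U\<close> has a distance different from \<open>r\<close> to one of the centres.  By the isosceles
  property its distance to a point of \<open>U\<close> is then the larger one of this distance and \<open>r\<close>.
\<close>

lemma verticial_dist_eq:
  assumes "verticial \<U>" "U \<in> \<U>" "z \<in> U" "w \<in> U" "(p::'a::nonarch_local_field) \<notin> U"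
  shows "dist p z = dist p w"
proof -
  have "\<exists>r>0. \<exists>C. C \<noteq> {} \<and> U = (\<Inter>a\<in>C. sphere a r)"
    using assms(1,2) unfolding verticial_def by (rule bspec)
  then obtain r C where r: "r > 0" "C \<noteq> {}" "U = (\<Inter>a\<in>C. sphere a r)" by (elim exE conjE)
  then obtain a where a: "a \<in> C" "dist a p \<noteq> r" using assms(5) by auto
  have z: "dist a z = r" "dist a w = r" using assms(3,4) r(3) a(1) by auto
  show ?thesis
  proof (cases "dist a p < r")
    case True
    then have "dist p z = dist a z" "dist p w = dist a w"
      using dist_eq_of_less[of p a z] dist_eq_of_less[of p a w] z by (simp_all add: dist_commute)
    then show ?thesis using z by simp
  next
    case False
    then have "dist z p = dist a p" "dist w p = dist a p"
      using dist_eq_of_less[of z a p] dist_eq_of_less[of w a p] z a by (simp_all add: dist_commute)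
    then show ?thesis by (simp add: dist_commute)
  qed
qed

lemma holed_disc_clopen:
  assumes "holed_disc (U :: 'a::nonarch_local_field set)"
  shows "open U" "closed U"
proof -
  obtain D \<H> where U: "disc D" "finite \<H>" "\<forall>H\<in>\<H>. disc H" "U = D - \<Union>\<H>" using assms by (auto simp: holed_disc_def)
  have d: "open H \<and> closed H" if "disc H" for H :: "'a set" using that open_cball by (auto simp: disc_def)
  have "closed (\<Union>\<H>)" "open (\<Union>\<H>)" using U(2,3) d by (auto intro!: closed_Union open_Union)
  then show "open U" "closed U" using d[OF U(1)] by (auto simp: U(4) open_Diff closed_Diff)
qed

lemma measurable_Some_P1: "Some \<in> (borel :: 'a::nonarch_local_field measure) \<rightarrow>\<^sub>M borel_of P1"
  unfolding borel_of_def
  by (rule measurable_measure_of) (auto simp: vimage_def dest: open_vimage_Some)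

lemma measurable_indicator_continuous_map:
  assumes f: "continuous_map (subtopology X S) euclideanreal f" and S: "openin X S"
  shows "(\<lambda>y. indicator S y * f y) \<in> borel_measurable (borel_of X)"
proof (rule borel_measurableI)
  fix G :: "real set" assume G: "open G"
  have SX: "S \<subseteq> topspace X" using S by (rule openin_subset)
  have "openin (subtopology X S) {y \<in> topspace (subtopology X S). f y \<in> G}"
    using f G by (auto simp: continuous_map_def)
  then have 1: "openin X {y \<in> S. f y \<in> G}"
  proof -
    have eq: "topspace (subtopology X S) = S" using SX by auto
    from \<open>openin (subtopology X S) _\<close> show ?thesis unfolding eq using openin_open_subtopology[OF S] by blast
  qed
  have "(\<lambda>y. indicator S y * f y) -` G \<inter> space (borel_of X) = {y \<in> S. f y \<in> G} \<union> (if 0 \<in> G then topspace X - S else {})"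
    using SX by (auto split: split_indicator_asm if_splits)
  also have "\<dots> \<in> sets (borel_of X)"
    using borel_of_open[OF 1] borel_of_open[OF S] sets.compl_sets[of S "borel_of X"] by auto
  finally show "(\<lambda>y. indicator S y * f y) -` G \<inter> space (borel_of X) \<in> sets (borel_of X)" .
qed

locale schottky_cover = schottky_domain \<Gamma> F + haar \<mu>
  for \<Gamma> :: "('a::nonarch_local_field ^ 2 ^ 2) set set" and F :: "'a set" and \<mu> :: "'a measure" +
  fixes \<U> :: "'a set set"
  assumes cov: "\<U> \<in> Cov F" and vert: "verticial \<U>"
begin

lemma \<U>_props:
  assumes "U \<in> \<U>"
  shows "U \<subseteq> F" "open U" "closed U" "compact U"
proof -
  show "U \<subseteq> F" "open U" "closed U" using cov assms holed_disc_clopen by (auto simp: Cov_def)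
  then show "compact U" using compact_Int_closed[OF F_props(1), of U] by (simp add: Int_absorb1)
qed

lemma \<U>_disjoint: "U \<in> \<U> \<Longrightarrow> V \<in> \<U> \<Longrightarrow> z \<in> U \<Longrightarrow> z \<in> V \<Longrightarrow> U = V"
  using cov by (auto simp: Cov_def dest: disjointD)

lemma \<U>_cover: "z \<in> F \<Longrightarrow> \<exists>U\<in>\<U>. z \<in> U"
  using cov by (auto simp: Cov_def)

lemma finite_\<U>: "finite \<U>"
proof -
  have "F \<subseteq> \<Union>\<U>" using \<U>_cover by blast
  then obtain \<V> where V: "\<V> \<subseteq> \<U>" "finite \<V>" "F \<subseteq> \<Union>\<V>"
    using compactE[OF F_props(1), of \<U>] \<U>_props(2) by blast
  have "\<U> \<subseteq> insert {} \<V>"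
  proof
    fix U assume U: "U \<in> \<U>"
    show "U \<in> insert {} \<V>"
    proof (cases "U = {}")
      case False
      then obtain z where z: "z \<in> U" by blast
      then obtain W where "W \<in> \<V>" "z \<in> W" using V(3) \<U>_props(1)[OF U] by blast
      then show ?thesis using \<U>_disjoint[OF U _ z] V(1) by blast
    qed simp
  qed
  then show ?thesis using V(2) finite_subset by blast
qed

text \<open>
  The union of all translates of \<open>U\<close>.
\<close>

definition orbit_cell :: "'a set \<Rightarrow> 'a option set" where
  "orbit_cell U = {x \<in> \<Omega>. fold_F x \<in> U}"

lemma openin_orbit_cell: "U \<in> \<U> \<Longrightarrow> openin T (orbit_cell U)"
  unfolding orbit_cell_def by (rule openin_fold_vimage) (rule \<U>_props(2))

lemma orbit_cell_cover: "x \<in> \<Omega> \<Longrightarrow> \<exists>U\<in>\<U>. x \<in> orbit_cell U"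
  using fold_F(1) \<U>_cover by (auto simp: orbit_cell_def)

lemma orbit_cell_\<Omega>: "x \<in> orbit_cell U \<Longrightarrow> x \<in> \<Omega>"
  by (simp add: orbit_cell_def)

lemma orbit_cell_disjoint: "U \<in> \<U> \<Longrightarrow> V \<in> \<U> \<Longrightarrow> x \<in> orbit_cell U \<Longrightarrow> x \<in> orbit_cell V \<Longrightarrow> U = V"
  using \<U>_disjoint by (auto simp: orbit_cell_def)

text \<open>
  The distance of any two points of different cells; the choice does not matter, by the next lemma.
\<close>

definition cell_dist :: "'a set \<Rightarrow> 'a set \<Rightarrow> real" where
  "cell_dist U V = dist (SOME z. z \<in> U) (SOME w. w \<in> V)"

lemma cell_dist:
  assumes U: "U \<in> \<U>" and V: "V \<in> \<U>" and "U \<noteq> V" and z: "z \<in> U" and w: "w \<in> V"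
  shows "dist z w = cell_dist U V"
proof -
  define z' w' where "z' = (SOME z. z \<in> U)" and "w' = (SOME w. w \<in> V)"
  have z': "z' \<in> U" unfolding z'_def using z by (rule someI)
  have w': "w' \<in> V" unfolding w'_def using w by (rule someI)
  have "z \<notin> V" "w' \<notin> U" using \<U>_disjoint[OF U V] assms w' by auto
  then have "dist z w = dist z w'" "dist w' z = dist w' z'"
    using verticial_dist_eq[OF vert V w w', of z] verticial_dist_eq[OF vert U z z', of w'] by auto
  then show ?thesis by (simp add: cell_dist_def z'_def w'_def dist_commute)
qed

lemma indicator_translate:
  assumes "\<gamma> \<in> \<Gamma>" "V \<in> \<U>" "x \<in> \<Omega>"
  shows "(indicator (translate \<gamma> V) x :: real) = (if tile x = \<gamma> \<and> x \<in> orbit_cell V then 1 else 0)"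
  using mem_translate_iff[OF assms(1) \<U>_props(1)[OF assms(2)] assms(3)] assms(3)
  by (simp add: indicator_def orbit_cell_def)

lemma diffusion_kernel_eq:
  assumes A: "A U U = 0" and U: "U \<in> \<U>" "x \<in> orbit_cell U" and V: "V \<in> \<U>" "y \<in> orbit_cell V"
  shows "diffusion_kernel \<Gamma> \<U> A \<alpha> x y = A U V * cell_dist U V powr \<alpha>"
proof -
  have x: "x \<in> \<Omega>" and y: "y \<in> \<Omega>" using U V orbit_cell_\<Omega> by auto
  define k where "k = absval (fold_F x - fold_F y) powr \<alpha>"
  have inner: "(\<Sum>\<^sub>\<infinity>(\<gamma>, \<delta>)\<in>\<Gamma> \<times> \<Gamma>.
        absval (the (pgl_act (inv\<^bsub>PGL2\<^esub> \<gamma>) x) - the (pgl_act (inv\<^bsub>PGL2\<^esub> \<delta>) y)) powr \<alpha>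
        * indicator (translate \<gamma> U') x * indicator (translate \<delta> V') y)
     = (if U' = U then if V' = V then k else 0 else 0)" (is "infsum ?f _ = _") if U': "U' \<in> \<U>" and V': "V' \<in> \<U>" for U' V'
  proof -
    have "infsum ?f (\<Gamma> \<times> \<Gamma>) = infsum ?f {(tile x, tile y)}"
    proof (rule infsum_cong_neutral)
      fix p assume "p \<in> \<Gamma> \<times> \<Gamma> - {(tile x, tile y)}"
      then obtain \<gamma> \<delta> where p: "p = (\<gamma>, \<delta>)" "\<gamma> \<in> \<Gamma>" "\<delta> \<in> \<Gamma>" "\<gamma> \<noteq> tile x \<or> \<delta> \<noteq> tile y" by (cases p) auto
      then show "?f p = 0"
        using indicator_translate[OF p(2) U' x] indicator_translate[OF p(3) V' y] by auto
    qed (use tile_mem x y in auto)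
    also have "\<dots> = ?f (tile x, tile y)" by simp
    also have "\<dots> = k * (if x \<in> orbit_cell U' then 1 else 0) * (if y \<in> orbit_cell V' then 1 else 0)"
      using indicator_translate[OF _ U' x, of "tile x"] indicator_translate[OF _ V' y, of "tile y"] tile_mem[OF x] tile_mem[OF y]
      by (simp add: k_def fold_F_def)
    also have "\<dots> = (if U' = U then if V' = V then k else 0 else 0)"
      using orbit_cell_disjoint[OF U' U(1)] orbit_cell_disjoint[OF V' V(1)] U V by auto
    finally show ?thesis .
  qed
  have "diffusion_kernel \<Gamma> \<U> A \<alpha> x y = (\<Sum>U'\<in>\<U>. \<Sum>V'\<in>\<U>. A U' V' * (if U' = U then if V' = V then k else 0 else 0))"
    unfolding diffusion_kernel_def by (intro sum.cong refl) (simp only: inner)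
  also have "\<dots> = (\<Sum>U'\<in>\<U>. if U' = U then (\<Sum>V'\<in>\<U>. if V' = V then A U V * k else 0) else 0)"
    by (intro sum.cong refl) (auto intro!: sum.cong sum.neutral)
  also have "\<dots> = A U V * k" using finite_\<U> U V by simp
  also have "\<dots> = A U V * cell_dist U V powr \<alpha>"
  proof (cases "U = V")
    case False
    then show ?thesis using cell_dist[OF U(1) V(1) False, of "fold_F x" "fold_F y"] U V
      by (simp add: k_def orbit_cell_def dist_absval)
  qed (use A in simp)
  finally show ?thesis .
qed

abbreviation "IC \<equiv> invariant_continuous \<Gamma>"

lemma IC_D: "f \<in> IC \<Longrightarrow> continuous_map T euclideanreal f" "f \<in> IC \<Longrightarrow> \<gamma> \<in> \<Gamma> \<Longrightarrow> x \<in> \<Omega> \<Longrightarrow> f (pgl_act \<gamma> x) = f x"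
  by (auto simp: invariant_continuous_def)

lemma Some_\<Omega>: "z \<in> F \<Longrightarrow> Some z \<in> \<Omega>"
  using F_props(4) by blast

lemma set_integral_Omega_measure:
  assumes W: "openin T W" and f: "continuous_map T euclideanreal f"
  shows "(LINT y:W|Omega_measure \<Gamma> \<mu>. f y) = (LINT z:{z. Some z \<in> W}|\<mu>. f (Some z))"
proof -
  have P: "openin P1 W" "W \<subseteq> \<Omega>" using W by (auto simp: openin_T)
  have sub: "subtopology T W = subtopology P1 W"
    using P(2) by (simp add: Omega_topology_def subtopology_subtopology Int_absorb1)
  have m: "(\<lambda>y. indicator W y * f y) \<in> borel_measurable (borel_of P1)"
    by (rule measurable_indicator_continuous_map[OF _ P(1)])
       (use continuous_map_from_subtopology[OF f, of W] sub in simp)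
  have S: "Some \<in> \<mu> \<rightarrow>\<^sub>M borel_of P1"
    using measurable_Some_P1 by (simp add: measurable_cong_sets[OF sets_haar refl])
  have "(LINT y:W|Omega_measure \<Gamma> \<mu>. f y) = (\<integral>y. indicator \<Omega> y *\<^sub>R (indicator W y *\<^sub>R f y) \<partial>distr \<mu> (borel_of P1) Some)"
    unfolding set_lebesgue_integral_def Omega_measure_def
    by (rule integral_restrict_space) (use borel_of_open[OF openin_\<Omega>] in simp)
  also have "\<dots> = (\<integral>y. indicator W y * f y \<partial>distr \<mu> (borel_of P1) Some)"
    using P(2) by (intro Bochner_Integration.integral_cong) (auto split: split_indicator)
  also have "\<dots> = (\<integral>z. indicator W (Some z) * f (Some z) \<partial>\<mu>)" by (rule integral_distr[OF S m])
  also have "\<dots> = (LINT z:{z. Some z \<in> W}|\<mu>. f (Some z))"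
    unfolding set_lebesgue_integral_def by (intro Bochner_Integration.integral_cong) (auto split: split_indicator)
  finally show ?thesis .
qed

lemma weight_pole:
  assumes "z \<in> V" "(pgl_rep \<gamma>) $ 2 $ 1 * z + (pgl_rep \<gamma>) $ 2 $ 2 = 0"
  shows "weight s \<gamma> V = 0"
proof -
  have "abs_deriv \<gamma> z = \<infinity>" using assms(2) by (simp add: abs_deriv_def Let_def)
  moreover have "abs_deriv \<gamma> z \<le> (SUP x\<in>V. abs_deriv \<gamma> x)" using assms(1) by (rule SUP_upper)
  ultimately have "\<infinity> \<le> max_deriv \<gamma> V" unfolding max_deriv_def by (simp add: le_max_iff_disj)
  then have "max_deriv \<gamma> V = \<infinity>" by (simp add: top_unique)
  then show ?thesis by (simp add: weight_def)
qed

lemma measurable_indicator_Some: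
  assumes V: "V \<in> \<U>" and f: "continuous_map T euclideanreal f"
  shows "(\<lambda>z. indicator V z * f (Some z)) \<in> borel_measurable borel"
proof -
  have W: "openin T (translate \<one>\<^bsub>PGL2\<^esub> V)" by (rule openin_translate[OF one_\<Gamma>]) (use \<U>_props[OF V] in auto)
  have tr: "translate \<one>\<^bsub>PGL2\<^esub> V = Some ` V" by (simp add: translate_def)
  have P: "openin P1 (Some ` V)" "Some ` V \<subseteq> \<Omega>" using W by (auto simp: openin_T tr)
  have "subtopology T (Some ` V) = subtopology P1 (Some ` V)"
    using P(2) by (simp add: Omega_topology_def subtopology_subtopology Int_absorb1)
  then have "(\<lambda>y. indicator (Some ` V) y * f y) \<in> borel_measurable (borel_of P1)"
    using measurable_indicator_continuous_map[OF _ P(1), of f] continuous_map_from_subtopology[OF f, of "Some ` V"] by simp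
  from measurable_compose[OF measurable_Some_P1 this]
  have "(\<lambda>z. indicator (Some ` V) (Some z) * f (Some z)) \<in> borel_measurable borel" by simp
  moreover have "(\<lambda>z. indicator (Some ` V) (Some z) * f (Some z)) = (\<lambda>z. indicator V z * f (Some z))"
    by (auto simp: indicator_def)
  ultimately show ?thesis by simp
qed

text \<open>
  Either \<open>\<delta>\<close> has its pole in \<open>V\<close> and the weight is 0, or \<open>\<bar>c z + d\<bar>\<close> is constant on \<open>V\<close> and \<open>\<delta>\<close> is a
  similarity there.  The factor is left implicit, since \<open>absval\<close> may be any power of the module of Haar
  measure.
\<close>

lemma set_integral_translate:
  assumes \<delta>: "\<delta> \<in> \<Gamma>" and V: "V \<in> \<U>"
  shows "\<exists>c\<ge>0. \<forall>g\<in>IC. weight s \<delta> V * (LINT y:translate \<delta> V|Omega_measure \<Gamma> \<mu>. g y) = c * (LINT z:V|\<mu>. g (Some z))"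
proof -
  define a b c d where abcd: "a = pgl_rep \<delta> $ 1 $ 1" "b = pgl_rep \<delta> $ 1 $ 2" "c = pgl_rep \<delta> $ 2 $ 1" "d = pgl_rep \<delta> $ 2 $ 2"
  show ?thesis
  proof (cases "\<exists>z\<in>V. c * z + d = 0")
    case True
    then have "weight s \<delta> V = 0" using weight_pole by (auto simp: abcd)
    then show ?thesis by (intro exI[of _ 0]) auto
  next
    case False
    then have nz: "c * z + d \<noteq> 0" if "z \<in> V" for z using that by blast
    note Vp = \<U>_props[OF V]
    define D where "D = a * d - b * c"
    have D: "D \<noteq> 0" using det_pgl_rep[OF \<Gamma>_PGL2[OF \<delta>]] by (simp add: D_def abcd det_2)
    define \<psi> where "\<psi> z = (a * z + b) / (c * z + d)" for z
    have act: "pgl_act \<delta> (Some z) = Some (\<psi> z)" if "z \<in> V" for z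
      using nz[OF that] by (simp add: pgl_act_def mobius.simps \<psi>_def abcd)
    have q: "absval (c * z + d) = absval (c * w + d)" if zw: "z \<in> V" "w \<in> V" for z w
    proof (cases "c = 0")
      case c: False
      let ?p = "- (d / c)"
      have "?p \<notin> V" using nz[of ?p] c by auto
      from verticial_dist_eq[OF vert V zw this] have "absval (?p - z) = absval (?p - w)" by (simp add: dist_absval)
      moreover have "c * z + d = - (c * (?p - z))" for z using c by (simp add: algebra_simps)
      ultimately show ?thesis by (simp only: absval_minus absval_mult)
    qed simp
    obtain k where k: "k > 0" "\<And>z w. z \<in> V \<Longrightarrow> w \<in> V \<Longrightarrow> dist (\<psi> z) (\<psi> w) = k * dist z w"
    proof (cases "V = {}")
      case False
      then obtain z0 where z0: "z0 \<in> V" by blast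
      let ?q = "absval (c * z0 + d)"
      have q0: "?q > 0" using nz[OF z0] by simp
      show ?thesis
      proof (rule that[of "absval D / ?q\<^sup>2"])
        show "0 < absval D / ?q\<^sup>2" using D q0 by simp
        fix z w assume zw: "z \<in> V" "w \<in> V"
        show "dist (\<psi> z) (\<psi> w) = absval D / ?q\<^sup>2 * dist z w"
          unfolding dist_absval \<psi>_def mobius_diff[OF nz[OF zw(2)] nz[OF zw(1)]]
          using q[OF zw(1) z0] q[OF zw(2) z0] by (simp add: D_def absval_mult absval_divide power2_eq_square)
      qed
    qed (use that[of 1] in simp)
    have tr: "translate \<delta> V = Some ` \<psi> ` V" using act by (auto simp: translate_def image_image)
    have opT: "openin T (translate \<delta> V)" by (rule openin_translate[OF \<delta> Vp(2) Vp(1)])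
    have pre: "{z. Some z \<in> translate \<delta> V} = \<psi> ` V" by (auto simp: tr)
    then have opV': "open (\<psi> ` V)" using open_vimage_Some[of "translate \<delta> V"] opT by (simp add: openin_T)
    obtain e where e: "e \<ge> 0" "\<And>G :: 'a \<Rightarrow> real. (\<lambda>z. indicator V z * G z) \<in> borel_measurable borel \<Longrightarrow>
        (LINT y:\<psi> ` V|\<mu>. G (inv_into V \<psi> y)) = e * (LINT z:V|\<mu>. G z)"
      using similarity_change_of_variables[OF Vp(4) Vp(2) opV' k] by blast
    have "weight s \<delta> V * (LINT y:translate \<delta> V|Omega_measure \<Gamma> \<mu>. g y) = weight s \<delta> V * e * (LINT z:V|\<mu>. g (Some z))"
      if g: "g \<in> IC" for g
    proof -
      have "(LINT y:translate \<delta> V|Omega_measure \<Gamma> \<mu>. g y) = (LINT y:\<psi> ` V|\<mu>. g (Some y))"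
        using set_integral_Omega_measure[OF opT IC_D(1)[OF g]] by (simp add: pre)
      also have "\<dots> = (LINT y:\<psi> ` V|\<mu>. g (Some (inv_into V \<psi> y)))"
        unfolding set_lebesgue_integral_def
      proof (intro Bochner_Integration.integral_cong refl)
        fix y
        show "indicator (\<psi> ` V) y *\<^sub>R g (Some y) = indicator (\<psi> ` V) y *\<^sub>R g (Some (inv_into V \<psi> y))"
        proof (cases "y \<in> \<psi> ` V")
          case True
          then have i: "inv_into V \<psi> y \<in> V" "\<psi> (inv_into V \<psi> y) = y" by (auto intro: inv_into_into f_inv_into_f)
          have "g (pgl_act \<delta> (Some (inv_into V \<psi> y))) = g (Some (inv_into V \<psi> y))"
            by (rule IC_D(2)[OF g \<delta>]) (use i(1) Vp(1) Some_\<Omega> in blast)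
          then show ?thesis using act[OF i(1)] i(2) by simp
        qed simp
      qed
      also have "\<dots> = e * (LINT z:V|\<mu>. g (Some z))"
        by (rule e(2)[OF measurable_indicator_Some[OF V IC_D(1)[OF g]]])
      finally show ?thesis by simp
    qed
    moreover have "0 \<le> weight s \<delta> V * e" using e(1) by (simp add: weight_def)
    ultimately show ?thesis by blast
  qed
qed

lemma IC_affine:
  assumes "f \<in> IC" shows "(\<lambda>y. k * (f y - c)) \<in> IC"
proof -
  have "continuous_map T euclideanreal (\<lambda>y. k * (f y - c))"
    by (intro continuous_intros IC_D(1)[OF assms])
  then show ?thesis using IC_D(2)[OF assms] by (simp add: invariant_continuous_def)
qed

text \<open>
  The coefficient of a cell is the sum of the factors of \<open>set_integral_translate\<close> over the group.  It
  is 0 if that sum diverges, in accordance with the convention for the weighted integral.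
\<close>

lemma diffusion_operator_eq:
  "\<exists>c. (\<forall>V. 0 \<le> c V) \<and> (\<forall>A \<alpha>. (\<forall>U\<in>\<U>. A U U = 0) \<longrightarrow> (\<forall>f\<in>IC. \<forall>U\<in>\<U>. \<forall>x\<in>orbit_cell U.
     diffusion_operator \<mu> \<Gamma> \<U> A \<alpha> s f x =
     (\<Sum>V\<in>\<U>. c V * (A U V * cell_dist U V powr \<alpha>) * (LINT z:V|\<mu>. f (Some z) - f x))))"
proof -
  have "\<forall>\<delta>\<in>\<Gamma>. \<forall>V\<in>\<U>. \<exists>c\<ge>0. \<forall>g\<in>IC. weight s \<delta> V * (LINT y:translate \<delta> V|Omega_measure \<Gamma> \<mu>. g y) = c * (LINT z:V|\<mu>. g (Some z))"
    using set_integral_translate by blast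
  then obtain C where C: "\<And>\<delta> V. \<delta> \<in> \<Gamma> \<Longrightarrow> V \<in> \<U> \<Longrightarrow> 0 \<le> C \<delta> V"
    "\<And>\<delta> V g. \<delta> \<in> \<Gamma> \<Longrightarrow> V \<in> \<U> \<Longrightarrow> g \<in> IC \<Longrightarrow>
      weight s \<delta> V * (LINT y:translate \<delta> V|Omega_measure \<Gamma> \<mu>. g y) = C \<delta> V * (LINT z:V|\<mu>. g (Some z))"
    by metis
  define c where "c V = (if V \<in> \<U> then \<Sum>\<^sub>\<infinity>\<delta>\<in>\<Gamma>. C \<delta> V else 0)" for V
  have "0 \<le> c V" for V using C(1) by (auto simp: c_def intro!: infsum_nonneg)
  moreover have "diffusion_operator \<mu> \<Gamma> \<U> A \<alpha> s f x =
     (\<Sum>V\<in>\<U>. c V * (A U V * cell_dist U V powr \<alpha>) * (LINT z:V|\<mu>. f (Some z) - f x))"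
    if A: "\<forall>U\<in>\<U>. A U U = 0" and f: "f \<in> IC" and U: "U \<in> \<U>" "x \<in> orbit_cell U" for A \<alpha> f U x
    unfolding diffusion_operator_def weighted_integral_def
  proof (rule sum.cong[OF refl])
    fix V assume V: "V \<in> \<U>"
    define k where "k = A U V * cell_dist U V powr \<alpha>"
    have "(\<Sum>\<^sub>\<infinity>\<delta>\<in>\<Gamma>. weight s \<delta> V * (LINT y:translate \<delta> V|Omega_measure \<Gamma> \<mu>. diffusion_kernel \<Gamma> \<U> A \<alpha> x y * (f y - f x)))
      = (\<Sum>\<^sub>\<infinity>\<delta>\<in>\<Gamma>. C \<delta> V * (k * (LINT z:V|\<mu>. f (Some z) - f x)))"
    proof (rule infsum_cong)
      fix \<delta> assume \<delta>: "\<delta> \<in> \<Gamma>"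
      have "(LINT y:translate \<delta> V|Omega_measure \<Gamma> \<mu>. diffusion_kernel \<Gamma> \<U> A \<alpha> x y * (f y - f x))
        = (LINT y:translate \<delta> V|Omega_measure \<Gamma> \<mu>. k * (f y - f x))"
        unfolding set_lebesgue_integral_def
      proof (intro Bochner_Integration.integral_cong refl)
        fix y
        show "indicator (translate \<delta> V) y *\<^sub>R (diffusion_kernel \<Gamma> \<U> A \<alpha> x y * (f y - f x))
          = indicator (translate \<delta> V) y *\<^sub>R (k * (f y - f x))"
        proof (cases "y \<in> translate \<delta> V")
          case True
          then have "y \<in> \<Omega>" using translate_\<Omega>[OF \<delta> \<U>_props(1)[OF V]] by blast
          then have "y \<in> orbit_cell V" using True mem_translate_iff[OF \<delta> \<U>_props(1)[OF V]] by (simp add: orbit_cell_def)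
          then show ?thesis using diffusion_kernel_eq[of A U x V y \<alpha>] A U V by (simp add: k_def)
        qed simp
      qed
      then show "weight s \<delta> V * (LINT y:translate \<delta> V|Omega_measure \<Gamma> \<mu>. diffusion_kernel \<Gamma> \<U> A \<alpha> x y * (f y - f x))
        = C \<delta> V * (k * (LINT z:V|\<mu>. f (Some z) - f x))"
        using C(2)[OF \<delta> V IC_affine[OF f, of k "f x"]] by simp
    qed
    also have "\<dots> = (\<Sum>\<^sub>\<infinity>\<delta>\<in>\<Gamma>. C \<delta> V) * (k * (LINT z:V|\<mu>. f (Some z) - f x))"
      by (rule infsum_cmult_left')
    finally show "(\<Sum>\<^sub>\<infinity>\<delta>\<in>\<Gamma>. weight s \<delta> V * (LINT y:translate \<delta> V|Omega_measure \<Gamma> \<mu>. diffusion_kernel \<Gamma> \<U> A \<alpha> x y * (f y - f x)))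
      = c V * (A U V * cell_dist U V powr \<alpha>) * (LINT z:V|\<mu>. f (Some z) - f x)"
      using V by (simp add: c_def k_def)
  qed
  ultimately show ?thesis by blast
qed

lemma IC_measurable: "f \<in> IC \<Longrightarrow> f \<in> borel_measurable (borel_of T)"
proof (rule borel_measurableI)
  fix G :: "real set" assume f: "f \<in> IC" and G: "open G"
  have "openin T {x \<in> topspace T. f x \<in> G}" using IC_D(1)[OF f] G by (auto simp: continuous_map_def)
  moreover have "f -` G \<inter> space (borel_of T) = {x \<in> topspace T. f x \<in> G}" by auto
  ultimately show "f -` G \<inter> space (borel_of T) \<in> sets (borel_of T)" by (simp only: borel_of_open)
qed

lemma IC_fold: "f \<in> IC \<Longrightarrow> x \<in> \<Omega> \<Longrightarrow> f x = f (Some (fold_F x))"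
  using IC_D(2)[of f "tile x" "Some (fold_F x)"] fold_F[of x] tile_mem[of x] Some_\<Omega> by auto

lemma IC_bounded:
  assumes f: "f \<in> IC" shows "\<exists>C. \<forall>x\<in>\<Omega>. \<bar>f x\<bar> \<le> C"
proof -
  have "continuous_on F (\<lambda>z. f (Some z))"
    unfolding continuous_on_open_vimage[OF F_props(2)]
  proof (intro allI impI)
    fix G :: "real set" assume "open G"
    then have "openin T {x \<in> topspace T. f x \<in> G}" using IC_D(1)[OF f] by (auto simp: continuous_map_def)
    then have "open {z. Some z \<in> {x \<in> topspace T. f x \<in> G}}" by (intro open_vimage_Some) (simp add: openin_T)
    then have "open ({z. Some z \<in> {x \<in> topspace T. f x \<in> G}} \<inter> F)" using F_props(2) by (rule open_Int)
    moreover have "{z. Some z \<in> {x \<in> topspace T. f x \<in> G}} \<inter> F = (\<lambda>z. f (Some z)) -` G \<inter> F"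
      using Some_\<Omega> by auto
    ultimately show "open ((\<lambda>z. f (Some z)) -` G \<inter> F)" by simp
  qed
  then have "bounded ((\<lambda>z. f (Some z)) ` F)" using F_props(1) compact_continuous_image compact_imp_bounded by blast
  then obtain C where C: "\<forall>y\<in>(\<lambda>z. f (Some z)) ` F. \<bar>y\<bar> \<le> C" unfolding bounded_iff by auto
  have "\<bar>f x\<bar> \<le> C" if "x \<in> \<Omega>" for x using C IC_fold[OF f that] fold_F(1)[OF that] by simp
  then show ?thesis by blast
qed

text \<open>
  Cells are open and unions of orbits, so a function that varies on each cell at most as much as an
  invariant continuous one inherits both properties.
\<close>

lemma IC_cellwise_lipschitz:
  assumes f: "f \<in> IC" and c: "0 \<le> c"
    and g: "\<And>U x y. U \<in> \<U> \<Longrightarrow> x \<in> orbit_cell U \<Longrightarrow> y \<in> orbit_cell U \<Longrightarrow> \<bar>g x - g y\<bar> \<le> c * \<bar>f x - f y\<bar>"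
  shows "g \<in> IC"
  unfolding invariant_continuous_def
proof (intro CollectI conjI ballI)
  fix \<gamma> x assume \<gamma>: "\<gamma> \<in> \<Gamma>" and x: "x \<in> \<Omega>"
  obtain U where U: "U \<in> \<U>" "x \<in> orbit_cell U" using orbit_cell_cover[OF x] by blast
  then have "pgl_act \<gamma> x \<in> orbit_cell U" by (simp add: orbit_cell_def \<Omega>_invariant \<gamma> fold_F_invariant)
  from g[OF U(1) this U(2)] show "g (pgl_act \<gamma> x) = g x" using IC_D(2)[OF f \<gamma> x] by simp
next
  show "continuous_map T euclideanreal g"
    unfolding continuous_map_def
  proof (intro conjI allI impI)
    fix G :: "real set" assume "openin euclideanreal G"
    then have G: "open G" by simp
    show "openin T {x \<in> topspace T. g x \<in> G}"
    proof (subst openin_subopen, intro ballI)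
      fix x assume "x \<in> {x \<in> topspace T. g x \<in> G}"
      then have x: "x \<in> \<Omega>" "g x \<in> G" by auto
      then obtain e where e: "e > 0" "ball (g x) e \<subseteq> G" using G open_contains_ball by blast
      obtain U where U: "U \<in> \<U>" "x \<in> orbit_cell U" using orbit_cell_cover[OF x(1)] by blast
      define W where "W = {y \<in> topspace T. f y \<in> ball (f x) (e / (c + 1))} \<inter> orbit_cell U"
      have "openin T {y \<in> topspace T. f y \<in> ball (f x) (e / (c + 1))}"
        using IC_D(1)[OF f] open_ball by (auto simp: continuous_map_def simp del: mem_ball)
      then have "openin T W" unfolding W_def using openin_orbit_cell[OF U(1)] by (rule openin_Int)
      moreover have "x \<in> W" using x e(1) c U by (simp add: W_def)
      moreover have "W \<subseteq> {x \<in> topspace T. g x \<in> G}"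
      proof
        fix y assume y: "y \<in> W"
        then have "\<bar>g x - g y\<bar> \<le> c * \<bar>f x - f y\<bar>" by (intro g[OF U]) (simp add: W_def)
        also have "\<dots> \<le> c * (e / (c + 1))" using y c by (intro mult_left_mono) (auto simp: W_def dist_real_def)
        also have "\<dots> < e" using c e(1) by (simp add: field_simps)
        finally have "g y \<in> ball (g x) e" by (simp add: dist_real_def)
        then show "y \<in> {x \<in> topspace T. g x \<in> G}" using e(2) y by (auto simp: W_def)
      qed
      ultimately show "\<exists>W. openin T W \<and> x \<in> W \<and> W \<subseteq> {x \<in> topspace T. g x \<in> G}" by blast
    qed
  qed simp
qed

lemma C1_locally_bounded:
  assumes "C1_with_derivative \<Gamma> k k'" "0 \<le> t"
  shows "\<exists>d>0. \<exists>B. \<forall>r\<ge>0. \<bar>r - t\<bar> < d \<longrightarrow> (\<forall>x\<in>\<Omega>. \<bar>k r x\<bar> \<le> B)"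
proof -
  have k: "k t \<in> IC" "k' t \<in> IC" "uniform_limit \<Omega> (\<lambda>r x. (k r x - k t x) / (r - t)) (k' t) (at t within {0..})"
    using assms by (auto simp: C1_with_derivative_def)
  obtain B1 B2 where B: "\<And>x. x \<in> \<Omega> \<Longrightarrow> \<bar>k t x\<bar> \<le> B1" "\<And>x. x \<in> \<Omega> \<Longrightarrow> \<bar>k' t x\<bar> \<le> B2"
    using IC_bounded[OF k(1)] IC_bounded[OF k(2)] by blast
  have "\<forall>\<^sub>F r in at t within {0..}. \<forall>x\<in>\<Omega>. dist ((k r x - k t x) / (r - t)) (k' t x) < 1"
    using k(3) by (rule uniform_limitD) simp
  then obtain d where d: "d > 0" "\<And>r x. 0 \<le> r \<Longrightarrow> r \<noteq> t \<Longrightarrow> dist r t < d \<Longrightarrow> x \<in> \<Omega> \<Longrightarrow> dist ((k r x - k t x) / (r - t)) (k' t x) < 1"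
    unfolding eventually_at by auto
  have "\<bar>k r x\<bar> \<le> B1 + d * (B2 + 1)" if r: "0 \<le> r" "\<bar>r - t\<bar> < d" and x: "x \<in> \<Omega>" for r x
  proof (cases "r = t")
    case True
    have "0 \<le> B2" using B(2)[OF x] by linarith
    then show ?thesis using B(1)[OF x] True d(1) by (smt (verit) mult_nonneg_nonneg)
  next
    case False
    have "\<bar>(k r x - k t x) / (r - t)\<bar> \<le> B2 + 1"
    proof -
      have "dist ((k r x - k t x) / (r - t)) (k' t x) < 1"
        by (rule d(2)[OF r(1) False _ x]) (use r(2) in \<open>simp add: dist_real_def\<close>)
      then show ?thesis using B(2)[OF x] unfolding dist_real_def by linarith
    qed
    then have "\<bar>k r x - k t x\<bar> \<le> \<bar>r - t\<bar> * (B2 + 1)" using False by (simp add: abs_divide divide_le_eq mult.commute)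
    also have "\<dots> \<le> d * (B2 + 1)" using r(2) B(2)[OF x] by (intro mult_right_mono) auto
    finally show ?thesis using B(1)[OF x] by linarith
  qed
  then show ?thesis using d(1) by blast
qed

lemma C1_pointwise:
  assumes "C1_with_derivative \<Gamma> k k'" "0 \<le> t" "x \<in> \<Omega>"
  shows "((\<lambda>r. k r x) has_real_derivative k' t x) (at t within {0..})"
  unfolding has_field_derivative_iff
  using assms(1,2) by (intro tendsto_uniform_limitI[OF _ assms(3)]) (auto simp: C1_with_derivative_def)

end

section \<open>The jump process of the diffusion operator\<close>

text \<open>
  The process with the generator \<open>\<lambda>f x. \<Sum>V. q U V * \<integral>\<^sub>V (f z - f x) dz\<close> for \<open>x\<close> in the orbit of \<open>U\<close>.
\<close>

locale schottky_jump = schottky_cover \<Gamma> F \<mu> \<U>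
  for \<Gamma> :: "('a::nonarch_local_field ^ 2 ^ 2) set set" and F :: "'a set" and \<mu> :: "'a measure" and \<U> :: "'a set set" +
  fixes q :: "'a set \<Rightarrow> 'a set \<Rightarrow> real"
  assumes q_nonneg: "U \<in> \<U> \<Longrightarrow> V \<in> \<U> \<Longrightarrow> 0 \<le> q U V"
begin

definition mass :: real where "mass = measure \<mu> F"

text \<open>
  The law of the proposals.  If the fundamental domain were a null set, all rates would be multiplied
  by 0 and any law would do.
\<close>

definition \<kappa> :: "'a measure" where
  "\<kappa> = (if mass = 0 then return borel 0 else density \<mu> (\<lambda>z. ennreal (indicator F z / mass)))"

lemma F_sets: "F \<in> sets borel"
  using F_props(2) by simp

lemma emeasure_F: "emeasure \<mu> F = ennreal mass"
  using emeasure_compact_finite[OF F_props(1)] by (simp add: mass_def emeasure_eq_ennreal_measure)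

lemma mass_nonneg: "0 \<le> mass" by (simp add: mass_def)

lemma sets_\<kappa> [simp, measurable_cong]: "sets \<kappa> = sets borel" and space_\<kappa> [simp]: "space \<kappa> = UNIV"
  by (auto simp: \<kappa>_def)

lemma prob_space_\<kappa>: "prob_space \<kappa>"
proof (cases "mass = 0")
  case False
  then have m: "mass > 0" using mass_nonneg by simp
  have "emeasure (density \<mu> (\<lambda>z. ennreal (indicator F z / mass))) UNIV = (\<integral>\<^sup>+z. ennreal (indicator F z / mass) * indicator UNIV z \<partial>\<mu>)"
    by (rule emeasure_density) (use F_sets in auto)
  also have "\<dots> = (\<integral>\<^sup>+z. ennreal (1 / mass) * indicator F z \<partial>\<mu>)"
    by (intro nn_integral_cong) (auto split: split_indicator)
  also have "\<dots> = ennreal (1 / mass) * ennreal mass"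
    using F_sets by (subst nn_integral_cmult_indicator) (auto simp: emeasure_F)
  also have "\<dots> = 1" using m by (simp flip: ennreal_mult)
  finally show ?thesis using False by (intro prob_spaceI) (simp add: \<kappa>_def)
qed (simp add: \<kappa>_def prob_space_return)

lemma integral_\<kappa>:
  assumes V: "V \<in> \<U>" and G: "(\<lambda>z. indicator V z * G z :: real) \<in> borel_measurable borel"
  shows "mass * (\<integral>z. indicator V z * G z \<partial>\<kappa>) = (LINT z:V|\<mu>. G z)"
proof (cases "mass = 0")
  case True
  have "emeasure \<mu> V \<le> emeasure \<mu> F" using \<U>_props(1)[OF V] F_sets by (intro emeasure_mono) auto
  then have "V \<in> null_sets \<mu>" using True emeasure_F \<U>_props(2)[OF V] by (auto simp: null_sets_def)
  then have "AE z in \<mu>. z \<notin> V" by (rule AE_not_in)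
  then have "(LINT z:V|\<mu>. G z) = 0"
    unfolding set_lebesgue_integral_def by (intro integral_eq_zero_AE) (auto elim!: eventually_mono)
  then show ?thesis using True by simp
next
  case False
  then have m: "mass > 0" using mass_nonneg by simp
  have "(\<integral>z. indicator V z * G z \<partial>\<kappa>) = (\<integral>z. indicator V z * G z \<partial>density \<mu> (\<lambda>z. ennreal (indicator F z / mass)))"
    using False by (simp add: \<kappa>_def)
  also have "\<dots> = (\<integral>z. (indicator F z / mass) *\<^sub>R (indicator V z * G z) \<partial>\<mu>)"
    by (rule integral_density) (use G F_sets m in auto)
  also have "\<dots> = (\<integral>z. (1 / mass) * (indicator V z * G z) \<partial>\<mu>)"
    using \<U>_props(1)[OF V] by (intro Bochner_Integration.integral_cong) (auto split: split_indicator)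
  also have "\<dots> = (1 / mass) * (LINT z:V|\<mu>. G z)" by (simp add: set_lebesgue_integral_def)
  finally show ?thesis using m by simp
qed

text \<open>
  The summand 1 keeps the rate of the clock positive if there are no jumps at all.
\<close>

definition total_rate :: real where "total_rate = 1 + (\<Sum>U\<in>\<U>. \<Sum>V\<in>\<U>. q U V * mass)"

definition accept :: "'a set \<Rightarrow> 'a set \<Rightarrow> real" where "accept U V = q U V * mass / total_rate"

lemma q_mass_nonneg: "U \<in> \<U> \<Longrightarrow> V \<in> \<U> \<Longrightarrow> 0 \<le> q U V * mass"
  using q_nonneg mass_nonneg by simp

lemma total_rate_ge: "U \<in> \<U> \<Longrightarrow> V \<in> \<U> \<Longrightarrow> q U V * mass \<le> total_rate" and total_rate_pos: "total_rate > 0"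
proof -
  have pos: "0 \<le> (\<Sum>V\<in>\<U>. q U V * mass)" if "U \<in> \<U>" for U by (rule sum_nonneg) (use q_mass_nonneg that in blast)
  then have "0 \<le> (\<Sum>U\<in>\<U>. \<Sum>V\<in>\<U>. q U V * mass)" by (rule sum_nonneg)
  then show "total_rate > 0" by (simp add: total_rate_def)
  assume U: "U \<in> \<U>" and V: "V \<in> \<U>"
  have "q U V * mass \<le> (\<Sum>V\<in>\<U>. q U V * mass)"
    by (rule member_le_sum[OF V _ finite_\<U>]) (use q_mass_nonneg U in auto)
  also have "\<dots> \<le> (\<Sum>U\<in>\<U>. \<Sum>V\<in>\<U>. q U V * mass)"
    by (rule member_le_sum[OF U _ finite_\<U>]) (use pos in auto)
  finally show "q U V * mass \<le> total_rate" by (simp add: total_rate_def)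
qed

lemma accept_01: "U \<in> \<U> \<Longrightarrow> V \<in> \<U> \<Longrightarrow> 0 \<le> accept U V \<and> accept U V \<le> 1"
  using q_mass_nonneg total_rate_ge total_rate_pos by (simp add: accept_def divide_le_eq)

definition accept_at :: "'a option \<Rightarrow> 'a \<Rightarrow> real" where
  "accept_at x z = (\<Sum>U\<in>\<U>. \<Sum>V\<in>\<U>. accept U V * indicator (orbit_cell U) x * indicator V z)"

lemma accept_at:
  assumes "U \<in> \<U>" "x \<in> orbit_cell U"
  shows "accept_at x z = (\<Sum>V\<in>\<U>. accept U V * indicator V z)"
proof -
  have "accept_at x z = (\<Sum>U'\<in>\<U>. if U' = U then (\<Sum>V\<in>\<U>. accept U V * indicator V z) else 0)"
    unfolding accept_at_def
  proof (rule sum.cong[OF refl])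
    fix U' assume "U' \<in> \<U>"
    then have "x \<in> orbit_cell U' \<longleftrightarrow> U' = U" using orbit_cell_disjoint[OF _ assms(1) _ assms(2)] assms(2) by blast
    then have "(indicator (orbit_cell U') x :: real) = (if U' = U then 1 else 0)"
      by (simp add: indicator_def)
    then show "(\<Sum>V\<in>\<U>. accept U' V * indicator (orbit_cell U') x * indicator V z) = (if U' = U then (\<Sum>V\<in>\<U>. accept U V * indicator V z) else 0)"
      by simp
  qed
  then show ?thesis using assms finite_\<U> by simp
qed

lemma sum_indicator_cell:
  assumes "V \<in> \<U>" "z \<in> V"
  shows "(\<Sum>V'\<in>\<U>. g V' * indicator V' z) = (g V :: real)"
proof -
  have "(\<Sum>V'\<in>\<U>. g V' * indicator V' z) = (\<Sum>V'\<in>\<U>. if V' = V then g V else 0)"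
  proof (rule sum.cong[OF refl])
    fix V' assume "V' \<in> \<U>"
    then have "z \<in> V' \<longleftrightarrow> V' = V" using \<U>_disjoint[OF _ assms(1) _ assms(2)] assms(2) by blast
    then show "g V' * indicator V' z = (if V' = V then g V else 0)" by (simp add: indicator_def)
  qed
  then show ?thesis using finite_\<U> assms by simp
qed

definition unif :: "real measure" where "unif = uniform_measure lborel {0..1}"

definition R :: "('a \<times> real) measure" where "R = \<kappa> \<Otimes>\<^sub>M unif"

text \<open>
  Rejection sampling: the first component of the mark is the proposed point, the second one decides
  on its acceptance.
\<close>

definition step :: "'a option \<Rightarrow> 'a \<times> real \<Rightarrow> 'a option" where
  "step x u = (if fst u \<in> F \<and> snd u < accept_at x (fst u) then Some (fst u) else x)"

lemma sets_unif [simp, measurable_cong]: "sets unif = sets borel"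
  by (simp add: unif_def)

lemma prob_space_unif: "prob_space unif"
  unfolding unif_def by (rule prob_space_uniform_measure) auto

lemma measure_unif: "0 \<le> a \<Longrightarrow> a \<le> 1 \<Longrightarrow> measure unif {..<a} = a"
proof -
  assume a: "0 \<le> a" "a \<le> 1"
  then have "{0..1} \<inter> {..<a} = {0..<a}" by auto
  then show ?thesis using a unfolding unif_def by (subst measure_uniform_measure) auto
qed

lemma orbit_cell_sets [measurable]: "U \<in> \<U> \<Longrightarrow> orbit_cell U \<in> sets (borel_of T)"
  by (rule borel_of_open[OF openin_orbit_cell])

lemma cell_sets [measurable]: "U \<in> \<U> \<Longrightarrow> U \<in> sets borel"
  using \<U>_props(2) by auto

lemma Some_vimage_sets:
  assumes "B \<in> sets (borel_of T)" shows "{z \<in> F. Some z \<in> B} \<in> sets borel"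
proof -
  have sp: "space (restrict_space borel F) = F" by (simp add: space_restrict_space)
  have "Some \<in> restrict_space borel F \<rightarrow>\<^sub>M borel_of T"
  proof (rule measurable_borel_ofI)
    show "Some \<in> space (restrict_space borel F) \<rightarrow> topspace T" using Some_\<Omega> by (auto simp: sp)
    fix W assume "openin T W"
    then have "open {z. Some z \<in> W}" by (intro open_vimage_Some) (simp add: openin_T)
    moreover have "Some -` W \<inter> space (restrict_space borel F) = {z. Some z \<in> W} \<inter> F" by (auto simp: sp)
    ultimately show "Some -` W \<inter> space (restrict_space borel F) \<in> sets (restrict_space borel F)"
      using F_props(2) F_sets by (auto simp: sets_restrict_space_iff)
  qed
  from measurable_sets[OF this assms] have "Some -` B \<inter> F \<in> sets (restrict_space borel F)" by (simp add: sp)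
  moreover have "Some -` B \<inter> F = {z \<in> F. Some z \<in> B}" by auto
  ultimately show ?thesis using F_sets by (simp add: sets_restrict_space_iff)
qed

lemma measurable_accept_at [measurable]:
  "(\<lambda>p. accept_at (fst p) (fst (snd p))) \<in> borel_measurable (borel_of T \<Otimes>\<^sub>M R)"
proof -
  have [measurable]: "(\<lambda>p. fst (snd p)) \<in> borel_of T \<Otimes>\<^sub>M R \<rightarrow>\<^sub>M borel" unfolding R_def by measurable
  show ?thesis
    unfolding accept_at_def
  proof (intro borel_measurable_sum)
    fix U V assume "U \<in> \<U>" "V \<in> \<U>"
    note [measurable] = orbit_cell_sets[OF \<open>U \<in> \<U>\<close>] cell_sets[OF \<open>V \<in> \<U>\<close>]
    show "(\<lambda>p. accept U V * indicator (orbit_cell U) (fst p) * indicator V (fst (snd p))) \<in> borel_measurable (borel_of T \<Otimes>\<^sub>M R)"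
      by measurable
  qed
qed

lemma sets_R: "sets R = sets (borel \<Otimes>\<^sub>M borel)"
  unfolding R_def by (intro sets_pair_measure_cong) auto

lemma space_R [simp]: "space R = UNIV"
  using sets_eq_imp_space_eq[OF sets_R] by (simp add: space_pair_measure)

lemma measurable_R_step: "(\<lambda>(x, u). step x u) \<in> borel_of T \<Otimes>\<^sub>M R \<rightarrow>\<^sub>M borel_of T"
proof (rule measurableI)
  fix p assume "p \<in> space (borel_of T \<Otimes>\<^sub>M R)"
  then show "(case p of (x, u) \<Rightarrow> step x u) \<in> space (borel_of T)"
    using Some_\<Omega> by (auto simp: space_pair_measure step_def)
next
  fix B assume B[measurable]: "B \<in> sets (borel_of T)"
  have [measurable]: "(\<lambda>p. fst (snd p)) \<in> borel_of T \<Otimes>\<^sub>M R \<rightarrow>\<^sub>M borel" "(\<lambda>p. snd (snd p)) \<in> borel_of T \<Otimes>\<^sub>M R \<rightarrow>\<^sub>M borel"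
    unfolding R_def by measurable
  note [measurable] = Some_vimage_sets[OF B] F_sets
  have "(\<lambda>(x, u). step x u) -` B \<inter> space (borel_of T \<Otimes>\<^sub>M R) =
    {p \<in> space (borel_of T \<Otimes>\<^sub>M R). if fst (snd p) \<in> F \<and> snd (snd p) < accept_at (fst p) (fst (snd p))
        then fst (snd p) \<in> {z \<in> F. Some z \<in> B} else fst p \<in> B}"
    by (auto simp: step_def split: if_splits)
  also have "\<dots> \<in> sets (borel_of T \<Otimes>\<^sub>M R)" by measurable
  finally show "(\<lambda>(x, u). step x u) -` B \<inter> space (borel_of T \<Otimes>\<^sub>M R) \<in> sets (borel_of T \<Otimes>\<^sub>M R)" .
qed

text \<open>
  Points in a translate of weight less than 1 cannot carry any mass, so the process starts from their
  representative in the fundamental domain.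
\<close>

definition start :: "'a option \<Rightarrow> 'a option" where
  "start x = (if x \<in> weight_one_points \<Gamma> \<U> then x else Some (fold_F x))"

lemma max_deriv_one: "max_deriv \<one>\<^bsub>PGL2\<^esub> (U :: 'a set) = 1"
proof -
  interpret group "PGL2 :: ('a ^ 2 ^ 2) set monoid" by (rule group_PGL2)
  have "pgl_rep \<one>\<^bsub>PGL2\<^esub> \<in> (scalar_matrices :: ('a ^ 2 ^ 2) set)" using pgl_rep_mem[OF one_closed] by (simp add: one_PGL2)
  then obtain k :: 'a where k: "pgl_rep \<one>\<^bsub>PGL2\<^esub> = mat k" "k \<noteq> 0" by (rule scalar_matricesE)
  have "abs_deriv \<one>\<^bsub>PGL2\<^esub> x = 1" for x :: 'a
    using k by (simp add: abs_deriv_def Let_def det_2 mat_def power2_eq_square)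
  then have "(SUP x\<in>U. abs_deriv \<one>\<^bsub>PGL2\<^esub> x) \<le> 1" by (intro SUP_least) simp
  then show ?thesis by (simp add: max_deriv_def max_absorb1)
qed

lemma weight_one_points_iff:
  assumes U: "U \<in> \<U>" "x \<in> orbit_cell U"
  shows "x \<in> weight_one_points \<Gamma> \<U> \<longleftrightarrow> max_deriv (tile x) U = 1"
proof
  assume "x \<in> weight_one_points \<Gamma> \<U>"
  then obtain \<gamma> V where \<gamma>: "\<gamma> \<in> \<Gamma>" "V \<in> \<U>" "max_deriv \<gamma> V = 1" "x \<in> translate \<gamma> V" by (auto simp: weight_one_points_def)
  then have "tile x = \<gamma>" "fold_F x \<in> V"
    using mem_translate_iff[OF \<gamma>(1) \<U>_props(1)[OF \<gamma>(2)] orbit_cell_\<Omega>[OF U(2)]] by auto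
  moreover have "V = U" using \<U>_disjoint[OF \<gamma>(2) U(1)] U(2) \<open>fold_F x \<in> V\<close> by (simp add: orbit_cell_def)
  ultimately show "max_deriv (tile x) U = 1" using \<gamma>(3) by simp
next
  assume "max_deriv (tile x) U = 1"
  moreover have "x \<in> translate (tile x) U"
    using mem_translate_iff[OF _ \<U>_props(1)[OF U(1)] orbit_cell_\<Omega>[OF U(2)]] tile_mem[OF orbit_cell_\<Omega>[OF U(2)]] U(2)
    by (simp add: orbit_cell_def)
  ultimately show "x \<in> weight_one_points \<Gamma> \<U>"
    using U(1) tile_mem[OF orbit_cell_\<Omega>[OF U(2)]] by (auto simp: weight_one_points_def)
qed

lemma Some_weight_one: "z \<in> F \<Longrightarrow> Some z \<in> weight_one_points \<Gamma> \<U>"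
proof -
  assume z: "z \<in> F"
  then obtain U where "U \<in> \<U>" "z \<in> U" using \<U>_cover by blast
  then show ?thesis
    using weight_one_points_iff[of U "Some z"] max_deriv_one Some_\<Omega>[OF z] by (simp add: orbit_cell_def tile_Some z fold_F_Some)
qed

lemma openin_weight_one: "openin T (weight_one_points \<Gamma> \<U>)"
  unfolding weight_one_points_def using \<U>_props by (auto intro!: openin_Union openin_translate)

lemma weight_one_\<Omega>: "weight_one_points \<Gamma> \<U> \<subseteq> \<Omega>"
  using openin_subset[OF openin_weight_one] by simp

lemma measurable_R_start: "start \<in> borel_of T \<rightarrow>\<^sub>M borel_of T"
proof -
  have fold: "(\<lambda>x. Some (fold_F x)) \<in> borel_of T \<rightarrow>\<^sub>M borel_of T"
  proof (rule measurable_borel_ofI)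
    show "(\<lambda>x. Some (fold_F x)) \<in> space (borel_of T) \<rightarrow> topspace T"
      using Some_\<Omega> fold_F(1) by auto
    fix W assume "openin T W"
    then have "open {z. Some z \<in> W}" by (intro open_vimage_Some) (simp add: openin_T)
    from openin_fold_vimage[OF this] have "openin T {x \<in> \<Omega>. Some (fold_F x) \<in> W}" by simp
    moreover have "(\<lambda>x. Some (fold_F x)) -` W \<inter> space (borel_of T) = {x \<in> \<Omega>. Some (fold_F x) \<in> W}"
      by auto
    ultimately show "(\<lambda>x. Some (fold_F x)) -` W \<inter> space (borel_of T) \<in> sets (borel_of T)"
      by (simp only: borel_of_open)
  qed
  note [measurable] = fold borel_of_open[OF openin_weight_one]
  show ?thesis unfolding start_def[abs_def] by measurable
qed

lemma start_cell: "x \<in> \<Omega> \<Longrightarrow> start x \<in> \<Omega> \<and> fold_F (start x) = fold_F x"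
  using Some_\<Omega> fold_F(1) by (simp add: start_def fold_F_Some)

lemma start_weight_one: "x \<in> \<Omega> \<Longrightarrow> start x \<in> weight_one_points \<Gamma> \<U>"
  using Some_weight_one fold_F(1) by (simp add: start_def)

sublocale poisson_maps_from R T step total_rate start
proof -
  interpret \<kappa>: prob_space \<kappa> by (rule prob_space_\<kappa>)
  interpret unif: prob_space unif by (rule prob_space_unif)
  interpret pair_prob_space \<kappa> unif ..
  interpret R: prob_space R unfolding R_def by unfold_locales
  show "poisson_maps_from R T step total_rate start"
  proof
    show "(\<lambda>(x, u). step x u) \<in> borel_of T \<Otimes>\<^sub>M R \<rightarrow>\<^sub>M borel_of T" by (rule measurable_R_step)
    show "0 < total_rate" by (rule total_rate_pos)
    show "start \<in> borel_of T \<rightarrow>\<^sub>M borel_of T" by (rule measurable_R_start)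
    show "start (start x) = start x" if "x \<in> topspace T" for x
      using start_weight_one that by (simp add: start_def[of "start x"])
    show "start (step x u) = step x u" if "x \<in> topspace T" "start x = x" for x u
      using that Some_weight_one by (auto simp: step_def start_def split: if_splits)
  qed
qed

text \<open>
  Given the proposal \<open>z\<close> in \<open>V\<close>, the mean change of \<open>f\<close> is \<open>accept U V * (f z - f x)\<close>; the normalisations
  \<open>total_rate\<close> and \<open>mass\<close> cancel.
\<close>

lemma generator_eq:
  assumes f: "f \<in> IC" and U: "U \<in> \<U>" "x \<in> orbit_cell U"
  shows "generator f x = (\<Sum>V\<in>\<U>. q U V * (LINT z:V|\<mu>. f (Some z) - f x))"
proof -
  interpret \<kappa>: prob_space \<kappa> by (rule prob_space_\<kappa>)
  interpret unif: prob_space unif by (rule prob_space_unif)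
  interpret pp: pair_prob_space \<kappa> unif ..
  have x: "x \<in> \<Omega>" using U orbit_cell_\<Omega> by blast
  then have xs[measurable]: "x \<in> space (borel_of T)" by simp
  obtain C where C: "\<And>y. y \<in> \<Omega> \<Longrightarrow> \<bar>f y\<bar> \<le> C" using IC_bounded[OF f] by blast
  note fm[measurable] = IC_measurable[OF f]
  have st: "step x u \<in> \<Omega>" for u using Some_\<Omega> x by (simp add: step_def)
  have int: "integrable (\<kappa> \<Otimes>\<^sub>M unif) (\<lambda>u. f (step x u))"
    by (rule pp.P.integrable_const_bound[where B=C]) (use C st in \<open>auto intro!: AE_I2 simp flip: R_def\<close>)
  have G: "(\<lambda>z. indicator V z * (f (Some z) - f x)) \<in> borel_measurable borel" if "V \<in> \<U>" for V
    using measurable_indicator_Some[OF that IC_D(1)[OF IC_affine[OF f, of 1 "f x"]]] by simp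
  have Gi: "integrable \<kappa> (\<lambda>z. indicator V z * (f (Some z) - f x))" if V: "V \<in> \<U>" for V
  proof (rule \<kappa>.integrable_const_bound[where B="2 * C"])
    show "AE z in \<kappa>. norm (indicator V z * (f (Some z) - f x)) \<le> 2 * C"
    proof (rule AE_I2)
      fix z
      have "0 \<le> C" using C[OF x] by linarith
      moreover have "\<bar>f (Some z) - f x\<bar> \<le> 2 * C" if "z \<in> V"
        using C[OF x] C[OF Some_\<Omega>[of z]] that \<U>_props(1)[OF V] by fastforce
      ultimately show "norm (indicator V z * (f (Some z) - f x)) \<le> 2 * C" by (auto split: split_indicator)
    qed
    show "(\<lambda>z. indicator V z * (f (Some z) - f x)) \<in> borel_measurable \<kappa>"
      using G[OF V] by (simp add: measurable_cong_sets[OF sets_\<kappa> refl])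
  qed
  have inner: "(\<integral>\<xi>. f (step x (z, \<xi>)) \<partial>unif) = f x + (\<Sum>V\<in>\<U>. accept U V * (indicator V z * (f (Some z) - f x)))" for z
  proof (cases "z \<in> F")
    case True
    then obtain V where V: "V \<in> \<U>" "z \<in> V" using \<U>_cover by blast
    have a: "accept_at x z = accept U V"
      unfolding accept_at[OF U] by (rule sum_indicator_cell[OF V])
    have "(\<integral>\<xi>. f (step x (z, \<xi>)) \<partial>unif) = (\<integral>\<xi>. f x + (f (Some z) - f x) * indicator {..<accept U V} \<xi> \<partial>unif)"
      using True by (intro Bochner_Integration.integral_cong) (auto simp: step_def a split: split_indicator)
    also have "\<dots> = f x + (f (Some z) - f x) * accept U V"
      using measure_unif[of "accept U V"] accept_01[OF U(1) V(1)]
      by (subst Bochner_Integration.integral_add) (auto simp: unif.prob_space unif.emeasure_eq_measure)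
    also have "(f (Some z) - f x) * accept U V = (\<Sum>V\<in>\<U>. (accept U V * (f (Some z) - f x)) * indicator V z)"
      by (subst sum_indicator_cell[OF V]) (simp add: mult.commute)
    finally show ?thesis by (simp add: mult_ac)
  next
    case False
    have "indicator V z = (0::real)" if "V \<in> \<U>" for V
    proof -
      have "z \<notin> V" using \<U>_props(1)[OF that] False by blast
      then show ?thesis by (simp add: indicator_def)
    qed
    then show ?thesis using False by (simp add: step_def unif.prob_space)
  qed
  have "jump_mean f x = (\<integral>z. (\<integral>\<xi>. f (step x (z, \<xi>)) \<partial>unif) \<partial>\<kappa>)"
    unfolding jump_mean_def unfolding R_def using pp.integral_fst'[OF int] by simp
  also have "\<dots> = f x + (\<Sum>V\<in>\<U>. accept U V * (\<integral>z. indicator V z * (f (Some z) - f x) \<partial>\<kappa>))"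
    unfolding inner using Gi \<kappa>.prob_space
    by (subst Bochner_Integration.integral_add) auto
  finally have "generator f x = (\<Sum>V\<in>\<U>. total_rate * (accept U V * (\<integral>z. indicator V z * (f (Some z) - f x) \<partial>\<kappa>)))"
    by (simp add: generator_def sum_distrib_left)
  also have "\<dots> = (\<Sum>V\<in>\<U>. q U V * (LINT z:V|\<mu>. f (Some z) - f x))"
  proof (rule sum.cong[OF refl])
    fix V assume V: "V \<in> \<U>"
    show "total_rate * (accept U V * (\<integral>z. indicator V z * (f (Some z) - f x) \<partial>\<kappa>)) = q U V * (LINT z:V|\<mu>. f (Some z) - f x)"
      unfolding integral_\<kappa>[OF V G[OF V], symmetric] using total_rate_pos by (simp add: accept_def)
  qed
  finally show ?thesis .
qed

lemma step_coupling:
  assumes "U \<in> \<U>" "x \<in> orbit_cell U" "y \<in> orbit_cell U"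
  shows "step x u = step y u \<or> (step x u = x \<and> step y u = y)"
  using accept_at[OF assms(1,2)] accept_at[OF assms(1,3)] by (simp add: step_def)

text \<open>
  The acceptance probability depends on the cell only, so processes that start in the same cell are
  coupled.
\<close>

lemma expect_coupling_cell:
  assumes f: "f \<in> IC" and U: "U \<in> \<U>" "x \<in> orbit_cell U" "y \<in> orbit_cell U"
  shows "\<bar>expect t f x - expect t f y\<bar> \<le> \<bar>f x - f y\<bar>"
proof -
  obtain C where C: "\<And>y. y \<in> \<Omega> \<Longrightarrow> \<bar>f y\<bar> \<le> C" using IC_bounded[OF f] by blast
  show ?thesis
    by (rule expect_coupling[OF IC_measurable[OF f], of C]) (use C U step_coupling orbit_cell_\<Omega> in auto)
qed

lemma expect_IC: "f \<in> IC \<Longrightarrow> expect t f \<in> IC"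
  by (rule IC_cellwise_lipschitz[of f 1]) (auto intro: expect_coupling_cell)

lemma generator_IC:
  assumes f: "f \<in> IC" shows "generator f \<in> IC"
proof (rule IC_cellwise_lipschitz[OF f, of "2 * total_rate"])
  show "0 \<le> 2 * total_rate" using total_rate_pos by simp
  fix U x y assume U: "U \<in> \<U>" "x \<in> orbit_cell U" "y \<in> orbit_cell U"
  obtain C where C: "\<And>y. y \<in> \<Omega> \<Longrightarrow> \<bar>f y\<bar> \<le> C" using IC_bounded[OF f] by blast
  have "\<bar>jump_mean f x - jump_mean f y\<bar> \<le> \<bar>f x - f y\<bar>"
    by (rule jump_mean_coupling[OF IC_measurable[OF f], of C]) (use C U step_coupling orbit_cell_\<Omega> in auto)
  then have "\<bar>(jump_mean f x - jump_mean f y) - (f x - f y)\<bar> \<le> 2 * \<bar>f x - f y\<bar>"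
    by (intro order_trans[OF abs_triangle_ineq4]) simp
  then have "total_rate * \<bar>(jump_mean f x - jump_mean f y) - (f x - f y)\<bar> \<le> total_rate * (2 * \<bar>f x - f y\<bar>)"
    using total_rate_pos by (intro mult_left_mono) auto
  moreover have "generator f x - generator f y = total_rate * ((jump_mean f x - jump_mean f y) - (f x - f y))"
    by (simp add: generator_def algebra_simps)
  ultimately show "\<bar>generator f x - generator f y\<bar> \<le> 2 * total_rate * \<bar>f x - f y\<bar>"
    using total_rate_pos by (simp add: abs_mult mult_ac)
qed

lemma expect_start: "f \<in> IC \<Longrightarrow> x \<in> \<Omega> \<Longrightarrow> expect t f (start x) = expect t f x"
  using IC_fold[OF expect_IC, of f "start x" t] IC_fold[OF expect_IC, of f x t] start_cell[of x] by simp

lemma expect_C1: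
  assumes f: "f \<in> IC"
  shows "C1_with_derivative \<Gamma> (\<lambda>t. expect t f) (\<lambda>t. generator (expect t f))"
  unfolding C1_with_derivative_def
proof (intro allI impI conjI)
  fix t :: real assume t: "0 \<le> t"
  show "expect t f \<in> IC" "generator (expect t f) \<in> IC" by (simp_all add: expect_IC generator_IC f)
  obtain C where C: "\<And>y. y \<in> \<Omega> \<Longrightarrow> \<bar>f y\<bar> \<le> C" using IC_bounded[OF f] by blast
  then have "\<And>y. y \<in> space N \<Longrightarrow> \<bar>f y\<bar> \<le> C" by simp
  from expect_deriv[OF IC_measurable[OF f] this]
  obtain M where M: "M \<ge> 0"
    "\<And>r x. 0 \<le> r \<Longrightarrow> x \<in> \<Omega> \<Longrightarrow> \<bar>r - t\<bar> \<le> 1 \<Longrightarrow> r \<noteq> t \<Longrightarrow> \<bar>(expect r f x - expect t f x) / (r - t) - generator (expect t f) x\<bar> \<le> M * \<bar>r - t\<bar>"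
    "\<And>r x. 0 \<le> r \<Longrightarrow> x \<in> \<Omega> \<Longrightarrow> \<bar>r - t\<bar> \<le> 1 \<Longrightarrow> \<bar>generator (expect r f) x - generator (expect t f) x\<bar> \<le> M * \<bar>r - t\<bar>"
    using t by auto
  have ul: "uniform_limit \<Omega> h l (at t within {0..})"
    if h: "\<And>r x. 0 \<le> r \<Longrightarrow> r \<noteq> t \<Longrightarrow> x \<in> \<Omega> \<Longrightarrow> \<bar>r - t\<bar> \<le> 1 \<Longrightarrow> \<bar>h r x - l x\<bar> \<le> M * \<bar>r - t\<bar>" for h l
  proof (rule uniform_limitI)
    fix e :: real assume e: "0 < e"
    define d where "d = min 1 (e / (M + 1))"
    have d: "d > 0" using e M(1) by (simp add: d_def)
    have "dist (h r x) (l x) < e" if r: "r \<in> {0..}" "r \<noteq> t" "dist r t < d" and x: "x \<in> \<Omega>" for r x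
    proof -
      have "\<bar>h r x - l x\<bar> \<le> M * \<bar>r - t\<bar>" by (rule h) (use r x in \<open>auto simp: d_def dist_real_def\<close>)
      also have "\<dots> \<le> M * (e / (M + 1))" using r M(1) by (intro mult_left_mono) (auto simp: d_def dist_real_def)
      also have "\<dots> < e" using e M(1) by (simp add: field_simps)
      finally show ?thesis by (simp add: dist_real_def)
    qed
    then show "\<forall>\<^sub>F r in at t within {0..}. \<forall>x\<in>\<Omega>. dist (h r x) (l x) < e"
      unfolding eventually_at using d by blast
  qed
  show "uniform_limit \<Omega> (\<lambda>r x. (expect r f x - expect t f x) / (r - t)) (generator (expect t f)) (at t within {0..})"
    by (rule ul) (rule M(2))
  show "uniform_limit \<Omega> (\<lambda>t. generator (expect t f)) (generator (expect t f)) (at t within {0..})"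
    by (rule ul) (rule M(3))
qed

lemma expect_0:
  assumes f: "f \<in> IC" and x: "x \<in> \<Omega>" shows "expect 0 f x = f x"
proof -
  note [measurable] = IC_measurable[OF f]
  have xs[measurable]: "x \<in> space N" using x by simp
  have "expect 0 f x = (\<integral>\<omega>. f x \<partial>noise)"
    unfolding expect_def
    by (rule integral_cong_AE, measurable, use AE_position_0[of x] in eventually_elim) simp
  then show ?thesis by (simp add: noise.prob_space)
qed

lemma evolution_unique:
  assumes k: "C1_with_derivative \<Gamma> k k'" "\<And>t x. 0 \<le> t \<Longrightarrow> x \<in> \<Omega> \<Longrightarrow> k' t x = generator (k t) x"
    and l: "C1_with_derivative \<Gamma> l l'" "\<And>t x. 0 \<le> t \<Longrightarrow> x \<in> \<Omega> \<Longrightarrow> l' t x = generator (l t) x"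
    and init: "\<And>x. x \<in> \<Omega> \<Longrightarrow> k 0 x = l 0 x"
    and t: "0 \<le> t" and x: "x \<in> \<Omega>"
  shows "k t x = l t x"
proof -
  have IC: "k t \<in> IC" "l t \<in> IC" if "0 \<le> t" for t using k(1) l(1) that by (auto simp: C1_with_derivative_def)
  have "k t x - l t x = 0"
  proof (rule linear_evolution_zero[where w="\<lambda>t x. k t x - l t x" and w'="\<lambda>t x. k' t x - l' t x" and K="2 * total_rate" and S=\<Omega>, OF _ _ _ _ t x])
    show "((\<lambda>r. k r x - l r x) has_real_derivative k' t x - l' t x) (at t within {0..})" if "0 \<le> t" "x \<in> \<Omega>" for t x
      by (intro DERIV_diff C1_pointwise[OF k(1) that] C1_pointwise[OF l(1) that])
    show "\<bar>k' t x - l' t x\<bar> \<le> 2 * total_rate * B" if t: "0 \<le> t" and x: "x \<in> \<Omega>" and B: "\<And>y. y \<in> \<Omega> \<Longrightarrow> \<bar>k t y - l t y\<bar> \<le> B" for t x B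
    proof -
      obtain C C' where "\<And>y. y \<in> \<Omega> \<Longrightarrow> \<bar>k t y\<bar> \<le> C" "\<And>y. y \<in> \<Omega> \<Longrightarrow> \<bar>l t y\<bar> \<le> C'"
        using IC_bounded[OF IC(1)[OF t]] IC_bounded[OF IC(2)[OF t]] by blast
      then show ?thesis
        unfolding k(2)[OF t x] l(2)[OF t x]
        by (intro generator_diff_le[OF IC_measurable[OF IC(1)[OF t]] _ IC_measurable[OF IC(2)[OF t]], of C C'])
           (use x B in auto)
    qed
    show "\<exists>B. \<forall>t\<in>{0..b}. \<forall>x\<in>\<Omega>. \<bar>k t x - l t x\<bar> \<le> B" for b
    proof -
      obtain B1 where B1: "\<forall>t\<in>{0..b}. \<forall>x\<in>\<Omega>. \<bar>k t x\<bar> \<le> B1"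
        using locally_bounded_family[of \<Omega> k b] C1_locally_bounded[OF k(1)] by blast
      obtain B2 where B2: "\<forall>t\<in>{0..b}. \<forall>x\<in>\<Omega>. \<bar>l t x\<bar> \<le> B2"
        using locally_bounded_family[of \<Omega> l b] C1_locally_bounded[OF l(1)] by blast
      have "\<bar>k t x - l t x\<bar> \<le> B1 + B2" if "t \<in> {0..b}" "x \<in> \<Omega>" for t x
        using B1 B2 that abs_triangle_ineq4[of "k t x" "l t x"] by fastforce
      then show ?thesis by blast
    qed
  qed (use init in simp)
  then show ?thesis by simp
qed

lemma position_cases:
  assumes "x \<in> \<Omega>"
  shows "position t x \<omega> = x \<or> position t x \<omega> \<in> Some ` F"
proof -
  have "chain step n x \<omega> = x \<or> chain step n x \<omega> \<in> Some ` F" for n x \<omega>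
  proof (induction n arbitrary: x \<omega>)
    case (Suc n)
    show ?case using Suc.IH[of "step x (snd (shd \<omega>))" "stl \<omega>"] by (auto simp: step_def)
  qed simp
  then show ?thesis by (simp add: position_def)
qed

text \<open>
  The law charges only translates of weight 1, and of these only the fundamental domain and the tile
  of the starting point; hence the sum over the group is finite and equals the integral.
\<close>

lemma weighted_integral_law:
  assumes f: "f \<in> IC" and x: "x \<in> \<Omega>"
  shows "weighted_integral \<Gamma> \<U> s (law t x) f = expect t f x"
proof -
  define x0 where "x0 = start x"
  have x0: "x0 \<in> \<Omega>" "x0 \<in> weight_one_points \<Gamma> \<U>" using start_cell start_weight_one x by (auto simp: x0_def)
  then have x0s: "x0 \<in> space N" by simp
  note fm[measurable] = IC_measurable[OF f]
  have pm[measurable]: "position t x0 \<in> noise \<rightarrow>\<^sub>M N" by (rule measurable_position_at) (simp add: x0)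
  obtain C where C: "\<And>y. y \<in> \<Omega> \<Longrightarrow> \<bar>f y\<bar> \<le> C" using IC_bounded[OF f] by blast
  have pos_\<Omega>: "position t x0 \<omega> \<in> \<Omega>" for \<omega>
    using position_cases[OF x0(1), of t \<omega>] x0 Some_\<Omega> by auto
  have pos_E: "position t x0 \<omega> \<in> weight_one_points \<Gamma> \<U>" for \<omega>
    using position_cases[OF x0(1), of t \<omega>] x0 Some_weight_one by auto
  \<comment> \<open>a path stays in the tile of its starting point until it jumps into the fundamental domain\<close>
  define G where "G = {\<one>\<^bsub>PGL2\<^esub>, tile x0}"
  have G: "finite G" "G \<subseteq> \<Gamma>" using one_\<Gamma> tile_mem[OF x0(1)] by (auto simp: G_def)
  have pos_G: "tile (position t x0 \<omega>) \<in> G" for \<omega>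
    using position_cases[OF x0(1), of t \<omega>] tile_Some by (auto simp: G_def)
  define I where "I \<gamma> U \<omega> = (if tile (position t x0 \<omega>) = \<gamma> \<and> position t x0 \<omega> \<in> orbit_cell U then f (position t x0 \<omega>) else 0)" for \<gamma> U \<omega>
  have tr_sets[measurable]: "translate \<gamma> U \<in> sets N" if "\<gamma> \<in> \<Gamma>" "U \<in> \<U>" for \<gamma> U
    using openin_translate[OF that(1)] \<U>_props[OF that(2)] borel_of_open by blast
  have ind: "indicator (translate \<gamma> U) (position t x0 \<omega>) * f (position t x0 \<omega>) = I \<gamma> U \<omega>" if "\<gamma> \<in> \<Gamma>" "U \<in> \<U>" for \<gamma> U \<omega>
    using indicator_translate[OF that pos_\<Omega>] by (simp add: I_def)
  have lint: "(LINT y:translate \<gamma> U|law t x. f y) = (\<integral>\<omega>. I \<gamma> U \<omega> \<partial>noise)" if "\<gamma> \<in> \<Gamma>" "U \<in> \<U>" for \<gamma> U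
  proof -
    have [measurable]: "translate \<gamma> U \<in> sets N" by (rule tr_sets[OF that])
    have "(LINT y:translate \<gamma> U|law t x. f y) = (\<integral>\<omega>. indicator (translate \<gamma> U) (position t x0 \<omega>) *\<^sub>R f (position t x0 \<omega>) \<partial>noise)"
      unfolding set_lebesgue_integral_def law_def x0_def[symmetric] by (rule integral_distr[OF pm]) measurable
    then show ?thesis by (simp add: ind[OF that])
  qed
  have intI: "integrable noise (I \<gamma> U)" if "\<gamma> \<in> \<Gamma>" "U \<in> \<U>" for \<gamma> U
  proof (rule noise.integrable_const_bound[where B=C])
    have "0 \<le> C" using C[OF x] by linarith
    then show "AE \<omega> in noise. norm (I \<gamma> U \<omega>) \<le> C" using C pos_\<Omega> by (auto simp: I_def)
    have [measurable]: "translate \<gamma> U \<in> sets N" by (rule tr_sets[OF that])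
    have "(\<lambda>\<omega>. indicator (translate \<gamma> U) (position t x0 \<omega>) * f (position t x0 \<omega>)) \<in> borel_measurable noise" by measurable
    then show "I \<gamma> U \<in> borel_measurable noise" by (simp add: ind[OF that])
  qed
  have term_eq: "weight s \<gamma> U * (\<integral>\<omega>. I \<gamma> U \<omega> \<partial>noise) = (\<integral>\<omega>. I \<gamma> U \<omega> \<partial>noise)" if "\<gamma> \<in> \<Gamma>" "U \<in> \<U>" for \<gamma> U
  proof (cases "max_deriv \<gamma> U = 1")
    case True
    then show ?thesis by (simp add: weight_def)
  next
    case False
    have "I \<gamma> U \<omega> = 0" for \<omega>
      using weight_one_points_iff[OF that(2), of "position t x0 \<omega>"] pos_E[of \<omega>] False by (auto simp: I_def)
    then have "(\<integral>\<omega>. I \<gamma> U \<omega> \<partial>noise) = 0" by simp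
    then show ?thesis by simp
  qed
  have inner: "(\<Sum>\<^sub>\<infinity>\<gamma>\<in>\<Gamma>. weight s \<gamma> U * (LINT y:translate \<gamma> U|law t x. f y)) = (\<Sum>\<gamma>\<in>G. \<integral>\<omega>. I \<gamma> U \<omega> \<partial>noise)" if U: "U \<in> \<U>" for U
  proof -
    have "(\<Sum>\<^sub>\<infinity>\<gamma>\<in>\<Gamma>. weight s \<gamma> U * (LINT y:translate \<gamma> U|law t x. f y)) = (\<Sum>\<^sub>\<infinity>\<gamma>\<in>G. \<integral>\<omega>. I \<gamma> U \<omega> \<partial>noise)"
    proof (rule infsum_cong_neutral)
      fix \<gamma> assume "\<gamma> \<in> \<Gamma> - G"
      then have "\<gamma> \<in> \<Gamma>" "I \<gamma> U \<omega> = 0" for \<omega> using pos_G[of \<omega>] by (auto simp: I_def)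
      then show "weight s \<gamma> U * (LINT y:translate \<gamma> U|law t x. f y) = 0" using lint[OF _ U] by simp
    qed (use G in \<open>auto simp: lint U term_eq\<close>)
    then show ?thesis using G(1) by simp
  qed
  have "weighted_integral \<Gamma> \<U> s (law t x) f = (\<Sum>U\<in>\<U>. \<Sum>\<gamma>\<in>G. \<integral>\<omega>. I \<gamma> U \<omega> \<partial>noise)"
    unfolding weighted_integral_def by (rule sum.cong[OF refl inner])
  also have "\<dots> = (\<integral>\<omega>. (\<Sum>U\<in>\<U>. \<Sum>\<gamma>\<in>G. I \<gamma> U \<omega>) \<partial>noise)"
    using intI G by (simp add: Bochner_Integration.integral_sum subset_eq)
  also have "\<dots> = (\<integral>\<omega>. f (position t x0 \<omega>) \<partial>noise)"
  proof (rule Bochner_Integration.integral_cong[OF refl])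
    fix \<omega>
    let ?y = "position t x0 \<omega>"
    obtain V where V: "V \<in> \<U>" "?y \<in> orbit_cell V" using orbit_cell_cover[OF pos_\<Omega>] by blast
    have "(\<Sum>\<gamma>\<in>G. I \<gamma> U \<omega>) = (if U = V then f ?y else 0)" if U: "U \<in> \<U>" for U
    proof -
      have "?y \<in> orbit_cell U \<longleftrightarrow> U = V" using orbit_cell_disjoint[OF U V(1) _ V(2)] V(2) by blast
      then have "(\<Sum>\<gamma>\<in>G. I \<gamma> U \<omega>) = (\<Sum>\<gamma>\<in>G. if \<gamma> = tile ?y then (if U = V then f ?y else 0) else 0)"
        by (intro sum.cong) (auto simp: I_def)
      then show ?thesis using G(1) pos_G[of \<omega>] by simp
    qed
    then have "(\<Sum>U\<in>\<U>. \<Sum>\<gamma>\<in>G. I \<gamma> U \<omega>) = (\<Sum>U\<in>\<U>. if U = V then f ?y else 0)" by (rule sum.cong[OF refl])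
    then show "(\<Sum>U\<in>\<U>. \<Sum>\<gamma>\<in>G. I \<gamma> U \<omega>) = f ?y" using finite_\<U> V by simp
  qed
  also have "\<dots> = expect t f x" using expect_start[OF f x, of t] by (simp add: expect_def x0_def)
  finally show ?thesis .
qed

end

section \<open>The Cauchy problem\<close>

theorem theorem6p10:
  fixes \<mu> :: "'a::nonarch_local_field measure"
    and \<Gamma> :: "('a ^ 2 ^ 2) set set"
    and g :: nat
    and F :: "'a set"
    and \<U> :: "'a set set"
    and A :: "'a set \<Rightarrow> 'a set \<Rightarrow> real"
    and \<alpha> s \<epsilon> :: real
  assumes "haar_measure \<mu>"
    and "schottky_group g \<Gamma>"
    and "fundamental_domain \<Gamma> F"
    and "\<U> \<in> Cov F"
    and "verticial \<U>"
    and "\<And>U V. U \<in> \<U> \<Longrightarrow> V \<in> \<U> \<Longrightarrow> A U V = A V U"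
    and "\<And>U V. U \<in> \<U> \<Longrightarrow> V \<in> \<U> \<Longrightarrow> A U V \<ge> 0"
    and "\<And>U. U \<in> \<U> \<Longrightarrow> A U U = 0"
    and "s > 1"
    and "\<epsilon> > 0"
  shows "\<exists>p :: real \<Rightarrow> 'a option \<Rightarrow> 'a option measure.
     (\<forall>t\<ge>0. \<forall>x \<in> regular_domain \<Gamma>.
        prob_space (p t x) \<and> sets (p t x) = sets (borel_of (Omega_topology \<Gamma>))) \<and>
     (\<forall>h0 \<in> invariant_continuous \<Gamma>. \<exists>h.
        cauchy_solution \<mu> \<Gamma> \<U> A \<alpha> s \<epsilon> h0 h \<and>
        (\<forall>k. cauchy_solution \<mu> \<Gamma> \<U> A \<alpha> s \<epsilon> h0 k \<longrightarrow>
           (\<forall>t\<ge>0. \<forall>x \<in> regular_domain \<Gamma>. k t x = h t x)) \<and>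
        (\<forall>t\<ge>0. \<forall>x \<in> regular_domain \<Gamma>.
           h t x = weighted_integral \<Gamma> \<U> s (p t x) h0)) \<and>
     transition_function (Omega_topology \<Gamma>) (weight_one_points \<Gamma> \<U>) p \<and>
     (\<exists>(W :: (real \<Rightarrow> 'a option) measure) X P.
        markov_process (Omega_topology \<Gamma>) p W X P \<and>
        right_continuous_with_jumps (Omega_topology \<Gamma>) W X)"
proof -
  have sub: "subgroup \<Gamma> PGL2" using assms(2) by (simp add: schottky_group_def discrete_subgroup_def)
  interpret schottky_cover \<Gamma> F \<mu> \<U>
    by (rule schottky_cover.intro[OF schottky_domain.intro[OF sub assms(3)] haar.intro[OF assms(1)]
          schottky_cover_axioms.intro[OF assms(4,5)]])
  obtain c where c0: "\<forall>V. 0 \<le> c V" and c1: "\<forall>A \<alpha>. (\<forall>U\<in>\<U>. A U U = 0) \<longrightarrow> (\<forall>f\<in>IC. \<forall>U\<in>\<U>. \<forall>x\<in>orbit_cell U.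
     diffusion_operator \<mu> \<Gamma> \<U> A \<alpha> s f x =
     (\<Sum>V\<in>\<U>. c V * (A U V * cell_dist U V powr \<alpha>) * (LINT z:V|\<mu>. f (Some z) - f x)))"
    using diffusion_operator_eq[of s] by (elim exE conjE)
  have c: "\<And>V. 0 \<le> c V"
    "\<And>f U x. f \<in> IC \<Longrightarrow> U \<in> \<U> \<Longrightarrow> x \<in> orbit_cell U \<Longrightarrow> diffusion_operator \<mu> \<Gamma> \<U> A \<alpha> s f x =
       (\<Sum>V\<in>\<U>. c V * (A U V * cell_dist U V powr \<alpha>) * (LINT z:V|\<mu>. f (Some z) - f x))"
    using c0 c1[rule_format] assms(8) by simp_all
  define q where "q U V = \<epsilon> * (c V * (A U V * cell_dist U V powr \<alpha>))" for U V
  interpret schottky_jump \<Gamma> F \<mu> \<U> q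
    by unfold_locales (use c(1) assms(7,10) in \<open>simp add: q_def\<close>)
  have gen: "\<epsilon> * diffusion_operator \<mu> \<Gamma> \<U> A \<alpha> s f x = generator f x" if f: "f \<in> IC" and x: "x \<in> \<Omega>" for f x
  proof -
    obtain U where U: "U \<in> \<U>" "x \<in> orbit_cell U" using orbit_cell_cover[OF x] by blast
    show ?thesis
      unfolding c(2)[OF f U] generator_eq[OF f U] by (simp add: q_def sum_distrib_left mult.assoc)
  qed
  have sol_iff: "cauchy_solution \<mu> \<Gamma> \<U> A \<alpha> s \<epsilon> h0 k \<longleftrightarrow>
     (\<exists>k'. C1_with_derivative \<Gamma> k k' \<and> (\<forall>t\<ge>0. \<forall>x\<in>\<Omega>. k' t x = generator (k t) x)) \<and> (\<forall>x\<in>\<Omega>. k 0 x = h0 x)" for h0 k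
  proof -
    have "(\<forall>t\<ge>0. \<forall>x\<in>\<Omega>. k' t x - \<epsilon> * diffusion_operator \<mu> \<Gamma> \<U> A \<alpha> s (k t) x = 0) \<longleftrightarrow>
      (\<forall>t\<ge>0. \<forall>x\<in>\<Omega>. k' t x = generator (k t) x)" if "C1_with_derivative \<Gamma> k k'" for k'
      using that gen by (auto simp: C1_with_derivative_def)
    then show ?thesis unfolding cauchy_solution_def by blast
  qed
  show ?thesis
  proof (intro exI[of _ law] conjI allI impI ballI)
    show "prob_space (law t x)" "sets (law t x) = sets (borel_of T)" if "x \<in> \<Omega>" for t x
      using prob_space_law that by simp_all
    show "transition_function T (weight_one_points \<Gamma> \<U>) law"
      by (rule transition_function_law) (use weight_one_\<Omega> in \<open>auto simp: start_def\<close>)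
    show "\<exists>(W :: (real \<Rightarrow> 'a option) measure) X P. markov_process T law W X P \<and> right_continuous_with_jumps T W X"
      using markov_process_path_law right_continuous_path_space by blast
    fix h0 assume h0: "h0 \<in> IC"
    have sol: "cauchy_solution \<mu> \<Gamma> \<U> A \<alpha> s \<epsilon> h0 (\<lambda>t. expect t h0)"
      unfolding sol_iff using expect_C1[OF h0] expect_0[OF h0] by blast
    show "\<exists>h. cauchy_solution \<mu> \<Gamma> \<U> A \<alpha> s \<epsilon> h0 h \<and>
        (\<forall>k. cauchy_solution \<mu> \<Gamma> \<U> A \<alpha> s \<epsilon> h0 k \<longrightarrow> (\<forall>t\<ge>0. \<forall>x\<in>\<Omega>. k t x = h t x)) \<and>
        (\<forall>t\<ge>0. \<forall>x\<in>\<Omega>. h t x = weighted_integral \<Gamma> \<U> s (law t x) h0)"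
    proof (intro exI[of _ "\<lambda>t. expect t h0"] conjI allI impI ballI sol)
      fix k and t :: real and x assume k: "cauchy_solution \<mu> \<Gamma> \<U> A \<alpha> s \<epsilon> h0 k" and t: "0 \<le> t" and x: "x \<in> \<Omega>"
      obtain k' where k': "C1_with_derivative \<Gamma> k k'" "\<And>t x. 0 \<le> t \<Longrightarrow> x \<in> \<Omega> \<Longrightarrow> k' t x = generator (k t) x"
        "\<And>x. x \<in> \<Omega> \<Longrightarrow> k 0 x = h0 x"
        using k unfolding sol_iff by blast
      show "k t x = expect t h0 x"
        by (rule evolution_unique[OF k'(1,2) expect_C1[OF h0] _ _ t x]) (simp_all add: k'(3) expect_0 h0)
    next
      fix t x assume "x \<in> \<Omega>"
      then show "expect t h0 x = weighted_integral \<Gamma> \<U> s (law t x) h0" by (simp add: weighted_integral_law h0)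
    qed
  qed
qed

end
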